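(* Let $\alpha>0$, $\beta\in\mathbb{R}$. Suppose $(n_q,k_q)_{q\ge1}$ is a Stoltz sequence. For any $s\in\mathbb{C}$ such that $\Re(s)>-\frac12$, $s\ne1$, any $0\le a<1$, and any non-negative integer $k$, we have $$\lim_{q\to\infty}\frac1{k_q}\sum_{j=1}^{k_q}\zeta^{(k)}\bigl(s+iT_{\alpha,\beta}^{n_q+j}(x),a\bigr)=\frac{\alpha}{\pi}\int_{\mathbb{R}}\frac{\zeta^{(k)}(s+i\tau,a)}{\alpha^2+(\tau-\beta)^2}\,d\tau$$ for almost all $x\in\mathbb{R}$.
   Context: The Hurwitz zeta function is here normalised as $\zeta(s,a)=\sum_{n=1}^{\infty}\frac{1}{(n+a)^s}$ for $\Re(s)>1$, continued meromorphically to $\mathbb{C}$ (with a single pole, at $s=1$); $\zeta^{(k)}(\cdot,a)$ is its $k$-th derivative in the first variable, with $\zeta^{(0)}=\zeta$. For $\alpha>0$ and $\beta\in\mathbb{R}$, $T_{\alpha,\beta}:\mathbb{R}\to\mathbb{R}$ is the map $T_{\alpha,\beta}(x)=\frac{\alpha}{2}\left(\frac{x+\beta}{\alpha}-\frac{\alpha}{x-\beta}\right)$ if $x\ne\beta$, and $T_{\alpha,\beta}(\beta)=\beta$; $T_{\alpha,\beta}^{j}$ denotes its $j$-th iterate. It preserves, and is ergodic for, the probability measure $\mu_{\alpha,\beta}(A)=\frac{\alpha}{\pi}\int_A\frac{dt}{\alpha^2+(t-\beta)^2}$. Stoltz sequences. For a set $Z\subseteq\mathbb{Z}\times\mathbb{N}$,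 put $Z^h=\{(n,k)\in Z:k\ge h\}$, $Z^h_{\alpha}=\{(z,s)\in\mathbb{Z}^2:|z-y|<\alpha(s-r)\text{ for some }(y,r)\in Z^h\}$, and $Z^h_{\alpha}(\lambda)=\{n:(n,\lambda)\in Z^h_{\alpha}\}$ for $\lambda\in\mathbb{N}$ (in these definitions $\alpha$ is a generic aperture parameter, unrelated to the $\alpha$ of $T_{\alpha,\beta}$). A sequence of pairs of natural numbers $(n_l,k_l)_{l\ge1}$ is Stoltz if there exist a set $Z\subseteq\mathbb{Z}\times\mathbb{N}$ and a function $h=h(t)$ tending to infinity with $t$ such that $(n_l,k_l)\in Z^{h(t)}$ for all $l\ge t$, and there exist $h_0$, $\alpha_0>0$ and $A>0$ such that $|Z^{h_0}_{\alpha_0}(\lambda)|\le A\lambda$ for all integers $\lambda>0$.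
   Formalization: The case Re(s)=1 is excluded (not only s=1), because there the line s+iτ passes through the pole of ζ^{(k)}(·,a) at τ=-Im(s) and the integral on the right-hand side diverges. *)

theory Defs
  imports "HOL-Complex_Analysis.Complex_Analysis"
begin

text \<open>
  The series starts at \<open>n = 1\<close>, so this is the Hurwitz zeta function with parameter \<open>1 + a\<close> in
  the normalisation whose series starts at \<open>n = 0\<close>, and \<open>a = 0\<close> gives the Riemann zeta function.
  The continuation is unique off the pole \<open>1\<close> by the identity theorem; prescribing the value
  \<open>0\<close> at the pole makes it unique as a total function.
\<close>

definition hurwitz_zeta :: "complex \<Rightarrow> real \<Rightarrow> complex" where
  "hurwitz_zeta s a =
     (THE f. f holomorphic_on (- {1}) \<and> is_pole f 1 \<and> f 1 = 0 \<and>
        (\<forall>z. Re z > 1 \<longrightarrow> f z = (\<Sum>n. 1 / (of_nat (Suc n) + of_real a) powr z))) s"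

definition hurwitz_zeta_deriv :: "nat \<Rightarrow> complex \<Rightarrow> real \<Rightarrow> complex" where
  "hurwitz_zeta_deriv k s a = (deriv ^^ k) (\<lambda>z. hurwitz_zeta z a) s"

definition boole_map :: "real \<Rightarrow> real \<Rightarrow> real \<Rightarrow> real" where
  "boole_map \<alpha> \<beta> x =
     (if x = \<beta> then \<beta> else \<alpha> / 2 * ((x + \<beta>) / \<alpha> - \<alpha> / (x - \<beta>)))"

definition trunc_set :: "(int \<times> nat) set \<Rightarrow> real \<Rightarrow> (int \<times> nat) set" where
  "trunc_set Z h = {(n, k). (n, k) \<in> Z \<and> real k \<ge> h}"

definition cone_set :: "(int \<times> nat) set \<Rightarrow> real \<Rightarrow> real \<Rightarrow> (int \<times> int) set" where
  "cone_set Z h \<alpha> =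
     {(z, s). \<exists>(y, r) \<in> trunc_set Z h. real_of_int \<bar>z - y\<bar> < \<alpha> * (real_of_int s - real r)}"

definition cone_section :: "(int \<times> nat) set \<Rightarrow> real \<Rightarrow> real \<Rightarrow> int \<Rightarrow> int set" where
  "cone_section Z h \<alpha> l = {n. (n, l) \<in> cone_set Z h \<alpha>}"

text \<open>
  Sequences are indexed from \<open>1\<close>; their value at index \<open>0\<close> is irrelevant. Finiteness of the
  sections is part of the cardinality bound and has to be demanded separately, since \<open>card\<close> is
  \<open>0\<close> on infinite sets.
\<close>

definition stoltz :: "(nat \<Rightarrow> nat) \<Rightarrow> (nat \<Rightarrow> nat) \<Rightarrow> bool" where
  "stoltz n k \<longleftrightarrow>
     (\<exists>(Z :: (int \<times> nat) set) (h :: nat \<Rightarrow> real).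
        filterlim h at_top sequentially \<and>
        (\<forall>t\<ge>1. \<forall>l\<ge>t. (int (n l), k l) \<in> trunc_set Z (h t)) \<and>
        (\<exists>h\<^sub>0 \<alpha>\<^sub>0 A. \<alpha>\<^sub>0 > 0 \<and> A > 0 \<and>
           (\<forall>l>0. finite (cone_section Z h\<^sub>0 \<alpha>\<^sub>0 l) \<and>
                  real (card (cone_section Z h\<^sub>0 \<alpha>\<^sub>0 l)) \<le> A * real_of_int l)))"

end

theory Submission
  imports Defs "HOL-Probability.Probability_Measure"
begin

text \<open>
  After an affine change of variables the map is \<open>x \<mapsto> (x - 1 / x) / 2\<close>, whose two branches
  are increasing bijections onto the line, each carrying half of the Cauchy measure.  Hence
  correlations of rays with arbitrary events decay like \<open>2 ^ - j\<close>, and the Cesaro averages of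
  every integrable function converge in mean.  The cone condition bounds the number of windows that
  can be charged to one window of a Vitali selection, which gives a weak type (1,1) inequality for the
  moving averages; as integrable functions are approximated in mean by constants plus bounded
  coboundaries, the moving averages converge almost everywhere.

  It remains to see that \<open>\<zeta>\<^sup>(\<^sup>k\<^sup>) (\<sigma> + i t, a) / (1 + t\<^sup>2)\<close> is integrable for \<open>\<sigma> > - 1 / 2\<close>.  On a block
  \<open>T \<le> \<bar>t\<bar> \<le> 2 T\<close> split off the first \<open>N = 40 T\<close> terms of the series.  The tail is controlled by a
  recursion in \<open>s\<close> that also yields the analytic continuation, and is \<open>O (T powr (1 / 2))\<close>.
  The sum of the first terms is as large as \<open>T powr (1 - \<sigma>)\<close> when bounded trivially, but has mean
  square \<open>O (T powr (3 - \<epsilon>))\<close> over the block, which suffices.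
\<close>

section \<open>Analytic continuation of the Hurwitz zeta function\<close>

text \<open>The abscissa \<open>- 1 / 2\<close> is the limit of the mean square method. About T
  frequencies on a block of length T give an integrated square of order
  \<open>T powr (2 - 2 * \<sigma>)\<close> for small \<sigma>, up to factors
  \<open>T powr \<epsilon>\<close>. By Cauchy-Schwarz the block contributes a negative power of T
  against the weight \<open>1 / T^2\<close> exactly when this is below \<open>T powr 3\<close>, that
  is, for \<open>\<sigma> > - 1 / 2\<close>. The trivial bound would contribute
  \<open>T powr (- \<sigma>)\<close>, which is summable over dyadic T only for
  \<open>\<sigma> > 0\<close>. The length N must grow like T because the recursion for the tail
  contracts only while the height is a small fraction of the shift \<open>1 + a + N\<close>. On the
  ergodic side the obstacle is that \<open>n_q\<close> may run away much faster than
  \<open>k_q\<close>. A window then fills only a negligible part of the initial orbit segment that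
  contains it, so the maximal function of the ordinary averages does not control it. What replaces
  it is a count of the windows of bounded length that can lie near a given place, and the cone
  condition is such a count.\<close>

lemma holomorphic_on_suminf_locally:
  fixes f :: "nat \<Rightarrow> complex \<Rightarrow> complex"
  assumes S: "open S" and hol: "\<And>n. f n holomorphic_on S"
    and dom: "\<And>x. x \<in> S \<Longrightarrow> \<exists>d>0. \<exists>M. cball x d \<subseteq> S \<and> summable M \<and>
       (\<forall>\<^sub>F n in sequentially. \<forall>z\<in>cball x d. norm (f n z) \<le> M n)"
  shows "(\<lambda>z. \<Sum>n. f n z) holomorphic_on S"
proof (rule holomorphic_uniform_sequence[OF S])
  show "(\<lambda>z. \<Sum>n<N. f n z) holomorphic_on S" for N by (intro holomorphic_intros hol)
next
  fix x assume "x \<in> S"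
  from dom[OF this] obtain d M where d: "d > 0" "cball x d \<subseteq> S" "summable M"
    and ev: "\<forall>\<^sub>F n in sequentially. \<forall>z\<in>cball x d. norm (f n z) \<le> M n" by blast
  \<comment> \<open>Finitely many terms may violate the majorant. This matters for the recursion,
    whose terms obey theirs only from an index on that depends on the disc.\<close>
  have "uniform_limit (cball x d) (\<lambda>N z. \<Sum>n<N. f n z) (\<lambda>z. \<Sum>n. f n z) sequentially"
    by (rule Weierstrass_m_test_ev[OF ev d(3)])
  thus "\<exists>d>0. cball x d \<subseteq> S \<and> uniform_limit (cball x d) (\<lambda>N z. \<Sum>n<N. f n z) (\<lambda>z. \<Sum>n. f n z) sequentially"
    using d by blast
qed

section \<open>Majorants for generalised binomial coefficients\<close>

definition binomial_bound :: "real \<Rightarrow> nat \<Rightarrow> real" where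
  "binomial_bound A j = pochhammer A j / fact j"

lemma binomial_bound_nonneg: "A \<ge> 0 \<Longrightarrow> binomial_bound A j \<ge> 0"
  by (simp add: binomial_bound_def pochhammer_prod prod_nonneg)

lemma norm_gbinomial_le:
  fixes z :: complex
  assumes "norm z \<le> A"
  shows "norm (z gchoose j) \<le> binomial_bound A j"
proof -
  have "norm (pochhammer (- z) j) \<le> pochhammer A j"
    unfolding pochhammer_prod prod_norm[symmetric]
  proof (rule prod_mono)
    fix i
    have "norm (- z + of_nat i) \<le> norm (- z) + norm (of_nat i :: complex)" by (rule norm_triangle_ineq)
    thus "0 \<le> norm (- z + of_nat i) \<and> norm (- z + of_nat i) \<le> A + of_nat i" using assms by simp
  qed
  thus ?thesis
    by (simp add: gbinomial_pochhammer binomial_bound_def norm_mult norm_divide norm_power divide_right_mono)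
qed

text \<open>Up to sign these are the coefficients of \<open>(1 + x) powr (- A)\<close>. So a single
  explicit power dominates the binomial series of every exponent of norm at most
  \<open>A\<close>.\<close>

lemma binomial_bound_sums:
  assumes "0 \<le> x" "x < 1"
  shows "(\<lambda>j. binomial_bound A j * x ^ j) sums ((1 - x) powr (- A))"
proof -
  have "((- A) gchoose j) * (- x) ^ j = binomial_bound A j * x ^ j" for j
  proof -
    have "((- A) gchoose j) * (- x) ^ j = ((- 1) ^ j * (- 1) ^ j) * (binomial_bound A j * x ^ j)"
      unfolding gbinomial_pochhammer binomial_bound_def power_minus[of x] by simp
    thus ?thesis by (simp flip: power_mult_distrib)
  qed
  thus ?thesis using gen_binomial_real[of "-x" "-A"] assms by simp
qed

lemma summable_binomial_bound_Suc:
  assumes "w > 1" shows "summable (\<lambda>j. binomial_bound A (Suc j) * (1 / w) ^ j)"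
proof -
  have "summable (\<lambda>j. binomial_bound A j * (1 / w) ^ j)"
    using sums_summable[OF binomial_bound_sums[of "1 / w" A]] assms by simp
  hence "summable (\<lambda>j. w * (binomial_bound A (Suc j) * (1 / w) ^ Suc j))"
    by (intro summable_mult iffD2[OF summable_Suc_iff[of "\<lambda>j. binomial_bound A j * (1 / w) ^ j"]])
  thus ?thesis using assms by (simp add: field_simps)
qed

text \<open>The classical Hurwitz zeta function of parameter \<open>w\<close>, with series from
  \<open>n = 0\<close>. For \<open>w = 1 + a + real N\<close> it is what remains of the series for
  \<open>hurwitz_zeta\<close> after \<open>N\<close> terms. The value carries meaning only for
  \<open>Re s > 1\<close>.\<close>

definition hurwitz_tail :: "real \<Rightarrow> complex \<Rightarrow> complex" where
  "hurwitz_tail w s = (\<Sum>n. of_real (real n + w) powr (- s))"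

lemma norm_of_real_powr: "x > 0 \<Longrightarrow> norm (complex_of_real x powr s) = x powr Re s"
  by (subst norm_powr_real_powr) auto

text \<open>Integral comparison by hand: \<open>F\<close> is, up to sign, an antiderivative of the
  summand. The mean value theorem bounds the term at \<open>Suc n\<close> by the drop
  \<open>F n - F (Suc n)\<close>, and the drops telescope to \<open>F 0\<close>.\<close>

lemma hurwitz_majorant:
  assumes w: "w > 0" and \<sigma>: "\<sigma> > (1 :: real)"
  shows "summable (\<lambda>n. (real n + w) powr (- \<sigma>))"
    and "(\<Sum>n. (real n + w) powr (- \<sigma>)) \<le> w powr (- \<sigma>) + w powr (1 - \<sigma>) / (\<sigma> - 1)"
proof -
  define F where "F = (\<lambda>n. (real n + w) powr (1 - \<sigma>) / (\<sigma> - 1))"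
  have "filterlim (\<lambda>n. real n + w) at_top sequentially"
    by (rule filterlim_tendsto_add_at_top[OF tendsto_const filterlim_real_sequentially, of w, unfolded add.commute[of w]])
  hence "(\<lambda>n. (real n + w) powr (1 - \<sigma>)) \<longlonglongrightarrow> 0"
    by (rule tendsto_neg_powr[rotated]) (use \<sigma> in simp)
  hence "F \<longlonglongrightarrow> 0" unfolding F_def using tendsto_divide[OF _ tendsto_const, of _ 0 _ "\<sigma> - 1"] \<sigma> by force
  hence tele: "(\<lambda>n. F n - F (Suc n)) sums (F 0 - 0)" by (rule telescope_sums')
  have le: "(real (Suc n) + w) powr (- \<sigma>) \<le> F n - F (Suc n)" for n
  proof -
    define x where "x = real n + w"
    have x: "x > 0" using w by (simp add: x_def)
    have "\<exists>z. z > x \<and> z < x + 1 \<and> (x + 1) powr (1 - \<sigma>) - x powr (1 - \<sigma>) = (x + 1 - x) * ((1 - \<sigma>) * z powr (- \<sigma>))"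
    proof (rule MVT2)
      fix z assume "x \<le> z" "z \<le> x + 1"
      thus "DERIV (\<lambda>x. x powr (1 - \<sigma>)) z :> (1 - \<sigma>) * z powr (- \<sigma>)"
        using x by (auto intro!: derivative_eq_intros)
    qed simp
    then obtain z where z: "z > x" "z < x + 1" "x powr (1 - \<sigma>) - (x + 1) powr (1 - \<sigma>) = (\<sigma> - 1) * z powr (- \<sigma>)"
      by (auto simp: algebra_simps)
    have "(x + 1) powr (- \<sigma>) \<le> z powr (- \<sigma>)" using z x \<sigma> by (intro powr_mono2') auto
    also have "z powr (- \<sigma>) = F n - F (Suc n)"
      using z(3) \<sigma> by (simp add: F_def x_def add_ac diff_divide_distrib[symmetric])
    finally show ?thesis by (simp add: x_def add_ac)
  qed
  have sS: "summable (\<lambda>n. (real (Suc n) + w) powr (- \<sigma>))"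
    by (rule summable_comparison_test'[of _ 0, OF sums_summable[OF tele]]) (use le in auto)
  thus sm: "summable (\<lambda>n. (real n + w) powr (- \<sigma>))"
    by (rule iffD1[OF summable_Suc_iff[of "\<lambda>n. (real n + w) powr (- \<sigma>)"]])
  have "(\<Sum>n. (real n + w) powr (- \<sigma>)) = w powr (- \<sigma>) + (\<Sum>n. (real (Suc n) + w) powr (- \<sigma>))"
    using suminf_split_head[OF sm] by simp
  also have "(\<Sum>n. (real (Suc n) + w) powr (- \<sigma>)) \<le> F 0 - 0"
    using suminf_le[OF le sS sums_summable[OF tele]] sums_unique[OF tele] by simp
  finally show "(\<Sum>n. (real n + w) powr (- \<sigma>)) \<le> w powr (- \<sigma>) + w powr (1 - \<sigma>) / (\<sigma> - 1)"
    by (simp add: F_def)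
qed

lemma summable_hurwitz_tail:
  assumes w: "w > 0" and s: "Re s > 1"
  shows "summable (\<lambda>n. norm (complex_of_real (real n + w) powr (- s)))"
    and "summable (\<lambda>n. complex_of_real (real n + w) powr (- s))"
proof -
  show "summable (\<lambda>n. norm (complex_of_real (real n + w) powr (- s)))"
    using hurwitz_majorant(1)[OF w s] w by (subst norm_of_real_powr) auto
  thus "summable (\<lambda>n. complex_of_real (real n + w) powr (- s))" by (rule summable_norm_cancel)
qed

lemma norm_hurwitz_tail_le:
  assumes w: "w > 0" and s: "Re s > 1"
  shows "norm (hurwitz_tail w s) \<le> w powr (- Re s) + w powr (1 - Re s) / (Re s - 1)"
proof -
  have "norm (hurwitz_tail w s) \<le> (\<Sum>n. norm (complex_of_real (real n + w) powr (- s)))"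
    unfolding hurwitz_tail_def by (rule summable_norm[OF summable_hurwitz_tail(1)[OF assms]])
  also have "\<dots> = (\<Sum>n. (real n + w) powr (- Re s))"
    using w by (intro suminf_cong) (subst norm_of_real_powr, auto)
  finally show ?thesis using hurwitz_majorant(2)[OF assms] by linarith
qed

lemma hurwitz_tail_shift:
  assumes "w > 0" "Re s > 1"
  shows "hurwitz_tail w s = (\<Sum>n<N. of_real (real n + w) powr (- s)) + hurwitz_tail (w + real N) s"
  unfolding hurwitz_tail_def
  using suminf_split_initial_segment[OF summable_hurwitz_tail(2)[OF assms], of N]
  by (simp add: add_ac)

lemma holomorphic_hurwitz_tail:
  assumes w: "w \<ge> 1"
  shows "hurwitz_tail w holomorphic_on {s. Re s > 1}"
  unfolding hurwitz_tail_def[abs_def]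
proof (rule holomorphic_on_suminf_locally)
  show "open {s. Re s > 1}" by (rule open_halfspace_Re_gt)
  have "complex_of_real (real n + w) \<noteq> 0" for n using w by (simp only: of_real_eq_0_iff)
  thus "(\<lambda>s. complex_of_real (real n + w) powr (- s)) holomorphic_on {s. Re s > 1}" for n
    by (intro holomorphic_intros)
  fix x :: complex assume x: "x \<in> {s. Re s > 1}"
  define d where "d = (Re x - 1) / 2"
  have d: "d > 0" using x by (simp add: d_def)
  have re: "Re z \<ge> 1 + d" if "z \<in> cball x d" for z
  proof -
    have "\<bar>Re (x - z)\<bar> \<le> d" using that abs_Re_le_cmod[of "x - z"] by (simp add: dist_norm)
    hence "Re z \<ge> Re x - d" by (simp add: abs_le_iff)
    thus ?thesis unfolding d_def by argo
  qed
  have "norm (complex_of_real (real n + w) powr (- z)) \<le> (real n + w) powr (- (1 + d))" if "z \<in> cball x d" for n z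
    using re[OF that] w by (subst norm_of_real_powr) (auto intro!: powr_mono)
  moreover have "cball x d \<subseteq> {s. Re s > 1}" using re d by force
  moreover have "summable (\<lambda>n. (real n + w) powr (- (1 + d)))" using hurwitz_majorant(1)[of w "1 + d"] w d by simp
  ultimately show "\<exists>d>0. \<exists>M. cball x d \<subseteq> {s. Re s > 1} \<and> summable M \<and>
       (\<forall>\<^sub>F n in sequentially. \<forall>z\<in>cball x d. norm (complex_of_real (real n + w) powr (- z)) \<le> M n)"
    using d by (intro exI[of _ d] conjI exI[of _ "\<lambda>n. (real n + w) powr (- (1 + d))"]) auto
qed

section \<open>Continuation by recursion\<close>

text \<open>Multiplying by \<open>s - 1\<close> removes the pole.  Telescoping \<open>(n + w) powr (1 - s)\<close> and expanding
  each difference by the binomial series expresses \<open>(s - 1) * hurwitz_tail w s\<close> through its values at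
  \<open>s + 1, s + 2, \<dots>\<close>; this recursion provides the continuation to the left, one unit strip at a time.\<close>

definition recursion_term :: "(complex \<Rightarrow> complex) \<Rightarrow> complex \<Rightarrow> nat \<Rightarrow> complex" where
  "recursion_term f s j = ((1 - s) gchoose Suc j) / of_nat (j + 2) * f (s + of_nat (Suc j))"

text \<open>Stage \<open>m\<close> has the intended value only for \<open>Re s > 1 - real m\<close>.
  Every term of the recursion looks at least one unit to the right, so each stage gains one unit
  strip; further left the stages are total functions without meaning.\<close>

primrec hurwitz_strip :: "real \<Rightarrow> nat \<Rightarrow> complex \<Rightarrow> complex" where
  "hurwitz_strip w 0 = (\<lambda>s. (s - 1) * hurwitz_tail w s)"
| "hurwitz_strip w (Suc m) = (\<lambda>s. of_real w powr (1 - s) - (\<Sum>j. recursion_term (hurwitz_strip w m) s j))"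

text \<open>One double series \<open>a n j\<close>, summed in both orders. Summing over
  \<open>j\<close> first yields differences of consecutive powers, which telescope in
  \<open>n\<close> to \<open>- (of_real w powr (1 - s))\<close>. Summing over \<open>n\<close> first
  yields multiples of \<open>hurwitz_tail w (s + of_nat j)\<close>, and the term
  \<open>j = 0\<close> is the one to be solved for.\<close>

lemma hurwitz_recursion:
  assumes w: "w \<ge> 2" and s: "Re s > 1"
  shows "(s - 1) * hurwitz_tail w s =
    of_real w powr (1 - s) - (\<Sum>j. recursion_term (\<lambda>s. (s - 1) * hurwitz_tail w s) s j)"
proof -
  define a where "a = (\<lambda>n j. ((1 - s) gchoose Suc j) * complex_of_real (real n + w) powr (- s - of_nat j))"
  define x where "x = (\<lambda>n. real n + w)"
  have x: "x n \<ge> 2" "x n > 0" for n using w by (auto simp: x_def)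
  have diff: "(\<lambda>j. a n j) sums (of_real (x (Suc n)) powr (1 - s) - of_real (x n) powr (1 - s))" for n
  proof -
    \<comment> \<open>The binomial series in \<open>1 / x n\<close>; \<open>w \<ge> 2\<close> keeps
      this ratio at most \<open>1 / 2\<close> even for \<open>n = 0\<close>.\<close>
    have "(\<lambda>j. ((1 - s) gchoose j) * of_real (x n) powr (1 - s - of_nat j) * of_real 1 ^ j) sums
        of_real (x n + 1) powr (1 - s)"
      by (rule gen_binomial_complex'') (use x[of n] in auto)
    hence "(\<lambda>j. ((1 - s) gchoose Suc j) * of_real (x n) powr (1 - s - of_nat (Suc j)) * of_real 1 ^ Suc j) sums
        (of_real (x n + 1) powr (1 - s) - ((1 - s) gchoose 0) * of_real (x n) powr (1 - s - of_nat 0) * of_real 1 ^ 0)"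
      by (subst sums_Suc_iff) simp
    thus ?thesis by (simp add: a_def x_def algebra_simps)
  qed
  have tele: "(\<Sum>n<N. \<Sum>j. a n j) = of_real (x N) powr (1 - s) - of_real w powr (1 - s)" for N
  proof -
    have "(\<Sum>n<N. \<Sum>j. a n j) = (\<Sum>n<N. of_real (x (Suc n)) powr (1 - s) - of_real (x n) powr (1 - s))"
      by (intro sum.cong refl sums_unique[symmetric] diff)
    also have "\<dots> = of_real (x N) powr (1 - s) - of_real (x 0) powr (1 - s)"
      by (rule sum_lessThan_telescope)
    finally show ?thesis by (simp add: x_def)
  qed
  define b where "b = (\<lambda>j N. \<Sum>n<N. a n j)"
  define c where "c = (\<lambda>j. ((1 - s) gchoose Suc j) * hurwitz_tail w (s + of_nat j))"
  have tl: "(\<lambda>n. complex_of_real (x n) powr (- s - of_nat j)) sums hurwitz_tail w (s + of_nat j)" for j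
    using summable_sums[OF summable_hurwitz_tail(2)[of w "s + of_nat j"]] w s
    by (simp add: hurwitz_tail_def x_def)
  have blim: "(\<lambda>N. b j N) \<longlonglongrightarrow> c j" for j
    using sums_mult[OF tl[of j], of "(1 - s) gchoose Suc j"]
    by (simp add: b_def c_def a_def sums_def x_def)
  define A where "A = norm (1 - s)"
  define Z where "Z = (\<Sum>n. (real n + w) powr (- Re s))"
  \<comment> \<open>A bound uniform in \<open>N\<close> and geometric in \<open>j\<close> with ratio
    \<open>1 / w\<close>, as the interchange of limit and sum by Tannery's theorem requires.\<close>
  have bbound: "norm (b j N) \<le> Z * (binomial_bound A (Suc j) * (1 / w) ^ j)" for j N
  proof -
    have "norm (a n j) \<le> binomial_bound A (Suc j) * (1 / w) ^ j * (real n + w) powr (- Re s)" for n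
    proof -
      have "norm (a n j) = norm ((1 - s) gchoose Suc j) * (x n) powr (- Re s - real j)"
        using norm_of_real_powr[OF x(2)[of n], of "- s - of_nat j"] by (simp add: a_def norm_mult x_def)
      also have "\<dots> \<le> binomial_bound A (Suc j) * (x n) powr (- Re s - real j)"
        by (intro mult_right_mono norm_gbinomial_le) (auto simp: A_def)
      also have "(x n) powr (- Re s - real j) = x n powr (- Re s) * (1 / x n) ^ j"
        using x[of n] by (simp add: powr_diff powr_realpow field_simps power_one_over)
      also have "binomial_bound A (Suc j) * (x n powr (- Re s) * (1 / x n) ^ j) \<le>
         binomial_bound A (Suc j) * (x n powr (- Re s) * (1 / w) ^ j)"
        using w by (intro mult_left_mono power_mono divide_left_mono binomial_bound_nonneg) (auto simp: A_def x_def)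
      finally show ?thesis by (simp add: x_def mult_ac)
    qed
    hence "norm (b j N) \<le> (\<Sum>n<N. binomial_bound A (Suc j) * (1 / w) ^ j * (real n + w) powr (- Re s))"
      unfolding b_def by (intro sum_norm_le) auto
    also have "\<dots> = binomial_bound A (Suc j) * (1 / w) ^ j * (\<Sum>n<N. (real n + w) powr (- Re s))"
      by (simp add: sum_distrib_left)
    also have "\<dots> \<le> binomial_bound A (Suc j) * (1 / w) ^ j * Z"
      unfolding Z_def using w s by (intro mult_left_mono sum_le_suminf hurwitz_majorant) (auto intro!: mult_nonneg_nonneg binomial_bound_nonneg simp: A_def)
    finally show ?thesis by (simp add: mult_ac)
  qed
  have sM: "summable (\<lambda>j. binomial_bound A (Suc j) * (1 / w) ^ j)"
    by (rule summable_binomial_bound_Suc) (use w in simp)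
  have ev: "\<forall>\<^sub>F (j, N) in sequentially \<times>\<^sub>F sequentially. norm (b j N) \<le> Z * (binomial_bound A (Suc j) * (1 / w) ^ j)"
    using bbound by (intro always_eventually) auto
  have "(\<lambda>N. \<Sum>j. b j N) \<longlonglongrightarrow> (\<Sum>j. c j)" and csum: "summable (\<lambda>j. norm (c j))"
    using tannerys_theorem[OF blim ev summable_mult[OF sM]] by auto
  moreover have "(\<Sum>j. b j N) = of_real (x N) powr (1 - s) - of_real w powr (1 - s)" for N
    unfolding b_def tele[symmetric] by (rule suminf_sum) (use diff in \<open>auto simp: sums_iff\<close>)
  moreover have "(\<lambda>N. of_real (x N) powr (1 - s) - of_real w powr (1 - s)) \<longlonglongrightarrow> 0 - of_real w powr (1 - s)"
  proof (intro tendsto_diff tendsto_const)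
    have "filterlim x at_top sequentially" unfolding x_def
      by (rule filterlim_tendsto_add_at_top[OF tendsto_const filterlim_real_sequentially, of w, unfolded add.commute[of w]])
    hence "(\<lambda>n. (x n) powr (1 - Re s)) \<longlonglongrightarrow> 0"
      by (rule tendsto_neg_powr[rotated]) (use s in simp)
    moreover have "norm (complex_of_real (x n) powr (1 - s)) = x n powr (1 - Re s)" for n
      using x[of n] by (subst norm_of_real_powr) auto
    ultimately show "(\<lambda>N. complex_of_real (x N) powr (1 - s)) \<longlonglongrightarrow> 0"
      by (subst tendsto_norm_zero_iff[symmetric]) simp
  qed
  ultimately have "(\<Sum>j. c j) = - (of_real w powr (1 - s))" using LIMSEQ_unique by fastforce
  moreover have "(\<Sum>j. c j) = c 0 + (\<Sum>j. c (Suc j))"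
    using suminf_split_head[OF summable_norm_cancel[OF csum]] by simp
  \<comment> \<open>Lowering the binomial coefficient by one index produces the factor
    \<open>s + of_nat j\<close>. At the shifted point \<open>s + of_nat (Suc j)\<close> this is
    exactly the factor \<open>s - 1\<close> that removes the pole, so the recursion closes on the
    multiplied function.\<close>
  moreover have "recursion_term (\<lambda>s. (s - 1) * hurwitz_tail w s) s j = - c (Suc j)" for j
  proof -
    have "(z gchoose Suc i) * of_nat (Suc i) = (z gchoose i) * (z - of_nat i)" for z :: complex and i
      using gbinomial_mult_1[of z i] by (simp add: algebra_simps)
    hence "((1 - s) gchoose Suc (Suc j)) * of_nat (j + 2) = ((1 - s) gchoose Suc j) * (1 - s - of_nat (Suc j))"
      by (metis add_2_eq_Suc')
    hence "((1 - s) gchoose Suc (Suc j)) = ((1 - s) gchoose Suc j) * (1 - s - of_nat (Suc j)) / of_nat (j + 2)"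
      by (subst nonzero_eq_divide_eq) (simp_all only: of_nat_eq_0_iff)
    also have "1 - s - of_nat (Suc j) = - (s + of_nat j)" by simp
    finally have "((1 - s) gchoose Suc (Suc j)) = - (((1 - s) gchoose Suc j) * (s + of_nat j) / of_nat (j + 2))"
      by (simp only: mult_minus_right minus_divide_left)
    thus ?thesis by (simp add: c_def recursion_term_def)
  qed
  moreover have "(\<Sum>j. - c (Suc j)) = - (\<Sum>j. c (Suc j))"
    by (rule suminf_minus) (simp only: summable_Suc_iff[of c] summable_norm_cancel[OF csum])
  moreover have "c 0 = (1 - s) * hurwitz_tail w s" by (simp add: c_def)
  ultimately show ?thesis by (simp add: algebra_simps)
qed

text \<open>Of \<open>f\<close> only agreement with the convergent series is asked: from
  \<open>j \<ge> R + 2\<close> on, the point \<open>s + of_nat (Suc j)\<close> lies where the series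
  converges. So one bound, uniform on discs, serves every stage of the continuation and its
  limit.\<close>

lemma recursion_term_bound:
  assumes w: "w \<ge> 1" and f: "\<And>s. Re s > 1 \<Longrightarrow> f s = (s - 1) * hurwitz_tail w s"
    and R: "norm s \<le> R" and j: "real j \<ge> R + 2"
  shows "norm (recursion_term f s j) \<le> 2 * (R + 1) * w powr R * (binomial_bound (R + 1) (Suc j) * (1 / w) ^ j)"
proof -
  have R0: "R \<ge> 0" using R norm_ge_zero[of s] by linarith
  have re: "\<bar>Re s\<bar> \<le> R" using R abs_Re_le_cmod[of s] by linarith
  define \<sigma> where "\<sigma> = Re s + real j"
  have \<sigma>: "\<sigma> \<ge> 1" using re j by (simp add: \<sigma>_def)
  have "norm (hurwitz_tail w (s + of_nat (Suc j))) \<le> w powr (- (\<sigma> + 1)) + w powr (- \<sigma>) / \<sigma>"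
    using norm_hurwitz_tail_le[of w "s + of_nat (Suc j)"] w \<sigma> by (simp add: \<sigma>_def algebra_simps)
  also have "\<dots> \<le> w powr (- \<sigma>) + w powr (- \<sigma>)"
  proof (rule add_mono)
    show "w powr (- (\<sigma> + 1)) \<le> w powr (- \<sigma>)" using w by (intro powr_mono) auto
    show "w powr (- \<sigma>) / \<sigma> \<le> w powr (- \<sigma>)" using \<sigma> by (simp add: divide_le_eq mult_le_cancel_left1)
  qed
  also have "w powr (- \<sigma>) = w powr (- Re s) * (1 / w) ^ j"
    using w by (simp add: \<sigma>_def powr_diff powr_realpow power_one_over field_simps)
  also have "w powr (- Re s) \<le> w powr R" using w re by (intro powr_mono) auto
  finally have T: "norm (hurwitz_tail w (s + of_nat (Suc j))) \<le> 2 * (w powr R * (1 / w) ^ j)"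
    using w by (simp add: mult_right_mono)
  have "norm (s + of_nat j) \<le> norm s + norm (of_nat j :: complex)" by (rule norm_triangle_ineq)
  also have "\<dots> \<le> (R + 1) * real (j + 2)"
  proof -
    have "0 \<le> R * real j" using R0 by simp
    moreover have "(R + 1) * real (j + 2) = R * real j + 2 * R + real j + 2" by (simp add: algebra_simps)
    ultimately show ?thesis using R R0 by (simp only: norm_of_nat)
  qed
  finally have N: "norm (s + of_nat j) / real (j + 2) \<le> R + 1" by (simp add: divide_le_eq)
  have f': "f (s + of_nat (Suc j)) = (s + of_nat j) * hurwitz_tail w (s + of_nat (Suc j))"
    using f[of "s + of_nat (Suc j)"] \<sigma> by (simp add: \<sigma>_def algebra_simps)
  have "norm (1 - s) \<le> R + 1" using norm_triangle_ineq4[of 1 s] R by simp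
  hence B: "norm ((1 - s) gchoose Suc j) \<le> binomial_bound (R + 1) (Suc j)" by (rule norm_gbinomial_le)
  have "norm (recursion_term f s j) = norm ((1 - s) gchoose Suc j) * (norm (s + of_nat j) / real (j + 2)) * norm (hurwitz_tail w (s + of_nat (Suc j)))"
    unfolding recursion_term_def f' norm_mult norm_divide norm_of_nat by simp
  also have "\<dots> \<le> binomial_bound (R + 1) (Suc j) * (R + 1) * (2 * (w powr R * (1 / w) ^ j))"
    using R0 by (intro mult_mono T N B mult_nonneg_nonneg binomial_bound_nonneg) auto
  finally show ?thesis by (simp only: mult_ac)
qed

lemma summable_recursion_term:
  assumes w: "w > 1" and f: "\<And>s. Re s > 1 \<Longrightarrow> f s = (s - 1) * hurwitz_tail w s"
  shows "summable (\<lambda>j. norm (recursion_term f s j))"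
proof (rule summable_comparison_test_ev)
  define R where "R = norm s"
  have "\<forall>\<^sub>F j in sequentially. real j \<ge> R + 2"
    using filterlim_real_sequentially unfolding filterlim_at_top by blast
  thus "\<forall>\<^sub>F j in sequentially. norm (norm (recursion_term f s j)) \<le>
      2 * (R + 1) * w powr R * (binomial_bound (R + 1) (Suc j) * (1 / w) ^ j)"
    by eventually_elim (use recursion_term_bound[OF _ f, where R = R] w in \<open>simp add: R_def\<close>)
  show "summable (\<lambda>j. 2 * (R + 1) * w powr R * (binomial_bound (R + 1) (Suc j) * (1 / w) ^ j))"
    by (intro summable_mult summable_binomial_bound_Suc w)
qed

lemma holomorphic_recursion:
  assumes w: "w > 1" and f: "\<And>s. Re s > 1 \<Longrightarrow> f s = (s - 1) * hurwitz_tail w s"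
    and hol: "f holomorphic_on {s. Re s > c}"
  shows "(\<lambda>s. of_real w powr (1 - s) - (\<Sum>j. recursion_term f s j)) holomorphic_on {s. Re s > c - 1}"
proof -
  have "(\<lambda>s. \<Sum>j. recursion_term f s j) holomorphic_on {s. Re s > c - 1}"
  proof (rule holomorphic_on_suminf_locally)
    show op: "open {s. Re s > c - 1}" by (rule open_halfspace_Re_gt)
    have "(\<lambda>s. f (s + of_nat (Suc j))) holomorphic_on {s. Re s > c - 1}" for j
      by (rule holomorphic_on_compose_gen[OF _ hol, of "\<lambda>s. s + of_nat (Suc j)", unfolded o_def])
         (auto intro!: holomorphic_intros)
    moreover have "(\<lambda>s. (1 - s) gchoose Suc j) holomorphic_on A" for j A
      unfolding gbinomial_prod_rev by (intro holomorphic_intros) auto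
    ultimately show "(\<lambda>s. recursion_term f s j) holomorphic_on {s. Re s > c - 1}" for j
      unfolding recursion_term_def by (intro holomorphic_intros) auto
    fix x assume "x \<in> {s. Re s > c - 1}"
    then obtain d where d: "d > 0" "cball x d \<subseteq> {s. Re s > c - 1}"
      using op open_contains_cball by blast
    define R where "R = norm x + d"
    have R: "norm z \<le> R" if "z \<in> cball x d" for z
      using that norm_triangle_ineq2[of z x] by (auto simp: R_def dist_norm norm_minus_commute)
    define M where "M = (\<lambda>j. 2 * (R + 1) * w powr R * (binomial_bound (R + 1) (Suc j) * (1 / w) ^ j))"
    have "\<forall>\<^sub>F j in sequentially. real j \<ge> R + 2"
      using filterlim_real_sequentially unfolding filterlim_at_top by blast
    hence "\<forall>\<^sub>F j in sequentially. \<forall>z\<in>cball x d. norm (recursion_term f z j) \<le> M j"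
      unfolding M_def by eventually_elim (intro ballI recursion_term_bound[OF _ f]; use w R in simp)
    moreover have "summable M" unfolding M_def by (intro summable_mult summable_binomial_bound_Suc w)
    ultimately show "\<exists>d>0. \<exists>M. cball x d \<subseteq> {s. Re s > c - 1} \<and> summable M \<and>
      (\<forall>\<^sub>F j in sequentially. \<forall>z\<in>cball x d. norm (recursion_term f z j) \<le> M j)"
      using d by blast
  qed
  thus ?thesis using w by (intro holomorphic_intros) auto
qed

lemma hurwitz_strip_step:
  assumes w: "w \<ge> 2"
  shows "Re s > 1 - real m \<Longrightarrow> hurwitz_strip w (Suc m) s = hurwitz_strip w m s"
proof (induction m arbitrary: s)
  case 0
  thus ?case using hurwitz_recursion[OF w, of s] by simp
next
  case (Suc m)
  have "recursion_term (hurwitz_strip w (Suc m)) s j = recursion_term (hurwitz_strip w m) s j" for j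
    unfolding recursion_term_def using Suc.IH[of "s + of_nat (Suc j)"] Suc.prems by simp
  hence "recursion_term (hurwitz_strip w (Suc m)) s = recursion_term (hurwitz_strip w m) s" by blast
  thus ?case by (simp only: hurwitz_strip.simps(2))
qed

lemma hurwitz_strip_stable:
  assumes w: "w \<ge> 2" and m: "m \<le> m'" and s: "Re s > 1 - real m"
  shows "hurwitz_strip w m' s = hurwitz_strip w m s"
  using m s
proof (induction m' rule: dec_induct)
  case (step i)
  thus ?case using hurwitz_strip_step[OF w, of i s] by simp
qed simp

lemma holomorphic_hurwitz_strip:
  assumes w: "w \<ge> 2"
  shows "hurwitz_strip w m holomorphic_on {s. Re s > 1 - real m}"
proof (induction m)
  case 0
  show ?case using holomorphic_hurwitz_tail[of w] w by (auto intro!: holomorphic_intros)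
next
  case (Suc m)
  have "hurwitz_strip w m s = (s - 1) * hurwitz_tail w s" if "Re s > 1" for s
    using hurwitz_strip_stable[OF w, of 0 m s] that by simp
  from holomorphic_recursion[OF _ this Suc] w show ?case by (simp add: algebra_simps)
qed

text \<open>By stability every stage with \<open>real m > 1 - Re s\<close> gives the same value;
  choosing one by \<open>Re s\<close> glues the stages into a single function. It is
  \<open>s - 1\<close> times the continued Hurwitz zeta function of parameter
  \<open>w\<close>.\<close>

definition hurwitz_entire :: "real \<Rightarrow> complex \<Rightarrow> complex" where
  "hurwitz_entire w s = hurwitz_strip w (nat \<lceil>2 + \<bar>Re s\<bar>\<rceil>) s"

lemma hurwitz_entire_eq_strip:
  assumes w: "w \<ge> 2" and s: "Re s > 1 - real m"
  shows "hurwitz_entire w s = hurwitz_strip w m s"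
proof -
  define m' where "m' = nat \<lceil>2 + \<bar>Re s\<bar>\<rceil>"
  have "real m' \<ge> 2 + \<bar>Re s\<bar>" unfolding m'_def by linarith
  hence s': "Re s > 1 - real m'" by linarith
  show ?thesis unfolding hurwitz_entire_def m'_def[symmetric]
    using hurwitz_strip_stable[OF w _ s, of m'] hurwitz_strip_stable[OF w _ s', of m] by (cases "m \<le> m'") auto
qed

lemma hurwitz_entire_eq_tail:
  assumes "w \<ge> 2" "Re s > 1"
  shows "hurwitz_entire w s = (s - 1) * hurwitz_tail w s"
  using hurwitz_entire_eq_strip[of w 0 s] assms by simp

lemma holomorphic_hurwitz_entire:
  assumes w: "w \<ge> 2"
  shows "hurwitz_entire w holomorphic_on A"
proof -
  have "hurwitz_entire w holomorphic_on (\<Union>m. {s. Re s > 1 - real m})"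
  proof (rule holomorphic_on_UN_open)
    fix m
    show "hurwitz_entire w holomorphic_on {s. Re s > 1 - real m}"
      by (rule holomorphic_transform[OF holomorphic_hurwitz_strip[OF w, of m]])
         (use hurwitz_entire_eq_strip[OF w] in auto)
  qed (rule open_halfspace_Re_gt)
  moreover have "\<exists>m. Re s > 1 - real m" for s
    using reals_Archimedean2[of "1 - Re s"] by (auto simp: algebra_simps)
  ultimately show ?thesis by (rule_tac holomorphic_on_subset) auto
qed

lemma hurwitz_entire_recursion:
  assumes w: "w \<ge> 2"
  shows "hurwitz_entire w s = of_real w powr (1 - s) - (\<Sum>j. recursion_term (hurwitz_entire w) s j)"
proof -
  define m where "m = nat \<lceil>2 + \<bar>Re s\<bar>\<rceil>"
  have "real m \<ge> 2 + \<bar>Re s\<bar>" unfolding m_def by linarith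
  hence s: "Re s > 1 - real m" by linarith
  have "hurwitz_entire w s = hurwitz_strip w (Suc m) s"
    by (rule hurwitz_entire_eq_strip[OF w]) (use s in simp)
  also have "recursion_term (hurwitz_strip w m) s j = recursion_term (hurwitz_entire w) s j" for j
    using hurwitz_entire_eq_strip[OF w, of m "s + of_nat (Suc j)"] s by (simp add: recursion_term_def)
  hence "recursion_term (hurwitz_strip w m) s = recursion_term (hurwitz_entire w) s" by blast
  hence "hurwitz_strip w (Suc m) s = of_real w powr (1 - s) - (\<Sum>j. recursion_term (hurwitz_entire w) s j)"
    by simp
  finally show ?thesis .
qed

text \<open>The recursion contracts in the region \<open>\<bar>Im s\<bar> \<le> w / 10\<close>: its binomial coefficients sum up to at
  most \<open>(1 - 1 / w) powr (- norm (s - 1)) - 1 \<le> 1 / 2\<close>.  Far to the right the trivial bound starts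
  the induction.\<close>

lemma norm_hurwitz_entire_le:
  assumes w: "w \<ge> 20" and im: "\<bar>Im s\<bar> \<le> w / 10" and re: "Re s \<ge> -1"
  shows "norm (hurwitz_entire w s) \<le> 2 * (1 + norm (s - 1) / w) * w powr (1 - Re s)"
proof -
  \<comment> \<open>The factor \<open>1 + norm (s - 1) / w\<close> of the claim is there for this
    region, where \<open>norm (s - 1)\<close> is not bounded in terms of \<open>w\<close>.\<close>
  have base: "norm (hurwitz_entire w s) \<le> 2 * (1 + norm (s - 1) / w) * w powr (1 - Re s)"
    if re: "Re s \<ge> 1 + w / 10" and im: "\<bar>Im s\<bar> \<le> w / 10" for s
  proof -
    define A \<sigma> where "A = norm (s - 1)" and "\<sigma> = Re s"
    have \<sigma>: "\<sigma> - 1 \<ge> w / 10" "\<sigma> - 1 > 0" "\<sigma> > 1" using re w by (auto simp: \<sigma>_def)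
    have "A \<le> \<bar>\<sigma> - 1\<bar> + \<bar>Im s\<bar>" using cmod_le[of "s - 1"] by (simp add: A_def \<sigma>_def)
    also have "\<bar>\<sigma> - 1\<bar> = \<sigma> - 1" using \<sigma> by simp
    also have "\<bar>Im s\<bar> \<le> \<sigma> - 1" using im \<sigma>(1) by (rule order_trans)
    finally have "A \<le> 2 * (\<sigma> - 1)" by simp
    hence A2: "A / (\<sigma> - 1) \<le> 2" using \<sigma> by (simp add: divide_le_eq)
    have "norm (hurwitz_entire w s) = A * norm (hurwitz_tail w s)"
      using hurwitz_entire_eq_tail[of w s] w \<sigma> by (simp add: A_def norm_mult \<sigma>_def)
    also have "\<dots> \<le> A * (w powr (- \<sigma>) + w powr (1 - \<sigma>) / (\<sigma> - 1))"
      using norm_hurwitz_tail_le[of w s] w \<sigma> by (intro mult_left_mono) (auto simp: A_def \<sigma>_def)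
    also have "w powr (- \<sigma>) = w powr (1 - \<sigma>) / w" using w by (simp add: powr_diff powr_minus divide_simps)
    also have "A * (w powr (1 - \<sigma>) / w + w powr (1 - \<sigma>) / (\<sigma> - 1)) = (A / w + A / (\<sigma> - 1)) * w powr (1 - \<sigma>)"
      by (simp add: algebra_simps)
    also have "\<dots> \<le> (2 * (1 + A / w)) * w powr (1 - \<sigma>)"
    proof (rule mult_right_mono)
      have "A / w \<ge> 0" using w by (simp add: A_def)
      thus "A / w + A / (\<sigma> - 1) \<le> 2 * (1 + A / w)" using A2 by argo
    qed simp
    finally show ?thesis by (simp add: A_def \<sigma>_def)
  qed
  \<comment> \<open>Induction on the number of unit steps to the left. The recursion reaches only
    points at least one unit further right, at the same height.\<close>
  have "norm (hurwitz_entire w s) \<le> 2 * (1 + norm (s - 1) / w) * w powr (1 - Re s)"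
    if "Re s \<ge> 1 + w / 10 - real m" "\<bar>Im s\<bar> \<le> w / 10" "Re s \<ge> -1" for m s
    using that
  proof (induction m arbitrary: s)
    case 0
    thus ?case by (intro base) auto
  next
    case (Suc m)
    show ?case
    proof (cases "Re s \<ge> 1 + w / 10")
      case True
      thus ?thesis using Suc.prems by (intro base) auto
    next
      case False
      define A \<sigma> where "A = norm (s - 1)" and "\<sigma> = Re s"
      have A0: "A \<ge> 0" by (simp add: A_def)
      have "A \<le> \<bar>\<sigma> - 1\<bar> + \<bar>Im s\<bar>" using cmod_le[of "s - 1"] by (simp add: A_def \<sigma>_def)
      \<comment> \<open>To the left of \<open>1\<close> this needs \<open>2 \<le> w / 10\<close>,
        which is the origin of \<open>w \<ge> 20\<close>.\<close>
      also have "\<bar>\<sigma> - 1\<bar> \<le> w / 10" unfolding abs_le_iff using False Suc.prems(3) w by (auto simp: \<sigma>_def)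
      finally have A: "A \<le> w / 5" using Suc.prems(2) by linarith
      define B where "B = (\<lambda>j. binomial_bound A j * (1 / w) ^ j)"
      have sB: "B sums ((1 - 1 / w) powr (- A))" unfolding B_def by (rule binomial_bound_sums) (use w in auto)
      have "(1 - 1 / w) powr (- A) = (1 / (1 - 1 / w)) powr A"
        using w by (simp add: powr_minus powr_divide inverse_eq_divide)
      also have "1 / (1 - 1 / w) = 1 + 1 / (w - 1)" using w by (simp add: field_simps)
      also have "(1 + 1 / (w - 1)) powr A \<le> exp (1 / (w - 1)) powr A"
        using w A0 exp_ge_add_one_self[of "1 / (w - 1)"] by (intro powr_mono2) auto
      also have "\<dots> = exp (A / (w - 1))" by (simp add: powr_def)
      also have "A / (w - 1) \<le> 1 / 4" using A w by (simp add: divide_le_eq)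
      hence "exp (A / (w - 1)) \<le> exp (1 / 4)" by simp
      also have "exp (1 / 4 :: real) \<le> 3 / 2" using exp_bound[of "1/4"] by (simp add: power2_eq_square)
      finally have S: "(1 - 1 / w) powr (- A) \<le> 3 / 2" .
      have tm: "norm (recursion_term (hurwitz_entire w) s j) \<le> 2 * w powr (1 - \<sigma>) * B (Suc j)" for j
      proof -
        have IH: "norm (hurwitz_entire w (s + of_nat (Suc j))) \<le>
          2 * (1 + norm (s + of_nat (Suc j) - 1) / w) * w powr (1 - Re (s + of_nat (Suc j)))"
          by (rule Suc.IH) (use Suc.prems in auto)
        have "norm ((s - 1) + of_nat (Suc j)) \<le> A + norm (of_nat (Suc j) :: complex)"
          unfolding A_def by (rule norm_triangle_ineq)
        hence N: "norm (s + of_nat (Suc j) - 1) \<le> A + real (Suc j)"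
          by (simp only: norm_of_nat add_diff_eq diff_add_eq)
        \<comment> \<open>The denominator \<open>j + 2\<close> of the recursion absorbs the growth
          in \<open>j\<close> of the bound supplied by the induction hypothesis.\<close>
        have "(1 + (A + real (Suc j)) / w) / real (j + 2) \<le> 1"
        proof -
          have "(A + real (Suc j)) / w \<le> (w / 5 + real (Suc j)) / w" using A w by (intro divide_right_mono) auto
          also have "\<dots> = 1 / 5 + real (Suc j) / w" using w by (simp add: add_divide_distrib)
          also have "real (Suc j) / w \<le> real (Suc j) / 20" using w by (intro divide_left_mono) auto
          finally have "(A + real (Suc j)) / w \<le> 1 / 5 + real (Suc j) / 20" by simp
          moreover have "real (j + 2) = real (Suc j) + 1" "real (Suc j) \<ge> 1" by auto
          ultimately have "1 + (A + real (Suc j)) / w \<le> real (j + 2)" by argo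
          thus ?thesis by simp
        qed
        note X = this
        have "norm (recursion_term (hurwitz_entire w) s j) =
          norm ((1 - s) gchoose Suc j) / real (j + 2) * norm (hurwitz_entire w (s + of_nat (Suc j)))"
          unfolding recursion_term_def norm_mult norm_divide norm_of_nat ..
        also have "\<dots> \<le> binomial_bound A (Suc j) / real (j + 2) *
          (2 * (1 + (A + real (Suc j)) / w) * w powr (1 - Re (s + of_nat (Suc j))))"
          using w N A0 by (intro mult_mono divide_right_mono norm_gbinomial_le order_trans[OF IH] mult_right_mono mult_left_mono add_left_mono)
             (auto simp: A_def norm_minus_commute intro!: divide_nonneg_nonneg binomial_bound_nonneg)
        also have "w powr (1 - Re (s + of_nat (Suc j))) = w powr (1 - \<sigma>) * (1 / w) ^ Suc j"
        proof -
          have "w powr (1 - Re (s + of_nat (Suc j))) = w powr ((1 - \<sigma>) - real (Suc j))" by (simp add: \<sigma>_def)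
          also have "\<dots> = w powr (1 - \<sigma>) / w ^ Suc j" using w by (simp add: powr_diff powr_realpow del: of_nat_Suc power_Suc)
          finally show ?thesis by (simp add: power_one_over del: power_Suc)
        qed
        also have "binomial_bound A (Suc j) / real (j + 2) * (2 * (1 + (A + real (Suc j)) / w) * (w powr (1 - \<sigma>) * (1 / w) ^ Suc j))
           = 2 * w powr (1 - \<sigma>) * B (Suc j) * ((1 + (A + real (Suc j)) / w) / real (j + 2))"
          unfolding B_def by (simp only: times_divide_eq_left times_divide_eq_right mult_ac)
        also have "\<dots> \<le> 2 * w powr (1 - \<sigma>) * B (Suc j) * 1"
          using w A0 by (intro mult_left_mono X mult_nonneg_nonneg) (auto simp: B_def intro!: divide_nonneg_nonneg mult_nonneg_nonneg binomial_bound_nonneg)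
        finally show ?thesis by simp
      qed
      have sum: "summable (\<lambda>j. norm (recursion_term (hurwitz_entire w) s j))"
        by (rule summable_recursion_term[OF _ hurwitz_entire_eq_tail]) (use w in auto)
      have sB': "(\<lambda>j. B (Suc j)) sums ((1 - 1 / w) powr (- A) - 1)"
        using sB by (subst sums_Suc_iff) (simp add: B_def binomial_bound_def)
      have "norm (\<Sum>j. recursion_term (hurwitz_entire w) s j) \<le> (\<Sum>j. norm (recursion_term (hurwitz_entire w) s j))"
        by (rule summable_norm[OF sum])
      also have "\<dots> \<le> (\<Sum>j. 2 * w powr (1 - \<sigma>) * B (Suc j))"
        by (intro suminf_le tm sum summable_mult sums_summable[OF sB'])
      also have "\<dots> = 2 * w powr (1 - \<sigma>) * ((1 - 1 / w) powr (- A) - 1)"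
        using sums_unique[OF sums_mult[OF sB', of "2 * w powr (1 - \<sigma>)"]] by simp
      also have "\<dots> \<le> 2 * w powr (1 - \<sigma>) * (1 / 2)" using S by (intro mult_left_mono) auto
      finally have "norm (\<Sum>j. recursion_term (hurwitz_entire w) s j) \<le> w powr (1 - \<sigma>)" by simp
      moreover have "norm (hurwitz_entire w s) \<le> norm (complex_of_real w powr (1 - s)) + norm (\<Sum>j. recursion_term (hurwitz_entire w) s j)"
        using w by (subst hurwitz_entire_recursion) (auto intro: norm_triangle_ineq4)
      moreover have "norm (complex_of_real w powr (1 - s)) = w powr (1 - \<sigma>)"
        using w by (subst norm_of_real_powr) (auto simp: \<sigma>_def)
      \<comment> \<open>The constant reproduces itself: \<open>1\<close> from the leading power, and
        \<open>2\<close> times the coefficient sum \<open>1 / 2\<close> from the series.\<close>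
      ultimately have "norm (hurwitz_entire w s) \<le> 2 * 1 * w powr (1 - \<sigma>)" by simp
      also have "\<dots> \<le> 2 * (1 + A / w) * w powr (1 - \<sigma>)"
        using A0 w by (intro mult_right_mono mult_left_mono) auto
      finally show ?thesis by (simp add: A_def \<sigma>_def)
    qed
  qed
  moreover obtain m where "real m \<ge> 1 + w / 10 - Re s" using real_arch_simple by blast
  hence "Re s \<ge> 1 + w / 10 - real m" by argo
  ultimately show ?thesis using im re by blast
qed

section \<open>The pole and the split of the zeta function\<close>

lemma hurwitz_entire_1:
  assumes "w \<ge> 2" shows "hurwitz_entire w 1 = 1"
proof -
  have "recursion_term (hurwitz_entire w) 1 = (\<lambda>_. 0)"
    by (auto simp: recursion_term_def fun_eq_iff gbinomial_0)
  thus ?thesis using assms by (subst hurwitz_entire_recursion) auto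
qed

text \<open>The right-hand side satisfies the defining specification, and the identity theorem on
  the connected punctured plane makes it the only function that does. Since \<open>N\<close> is
  arbitrary, the splitting point can later follow the height. The pole is genuine because
  \<open>hurwitz_entire\<close> has the value \<open>1\<close> there.\<close>

lemma hurwitz_zeta_eq:
  assumes a: "a \<ge> 0" and N: "N \<ge> 1" and s: "s \<noteq> 1"
  shows "hurwitz_zeta s a = (\<Sum>n<N. of_real (real n + (1 + a)) powr (- s)) + hurwitz_entire (1 + a + real N) s / (s - 1)"
proof -
  define w where "w = 1 + a + real N"
  have w: "w \<ge> 2" using a N by (simp add: w_def)
  define spec where "spec = (\<lambda>f. f holomorphic_on (- {1}) \<and> is_pole f 1 \<and> f 1 = 0 \<and>
        (\<forall>z. Re z > 1 \<longrightarrow> f z = (\<Sum>n. 1 / (of_nat (Suc n) + complex_of_real a) powr z)))"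
  define P where "P = (\<lambda>s. \<Sum>n<N. complex_of_real (real n + (1 + a)) powr (- s))"
  define G where "G = (\<lambda>s. (s - 1) * P s + hurwitz_entire w s)"
  define F where "F = (\<lambda>s. G s / (s - 1))"
  have ne: "complex_of_real (real n + (1 + a)) \<noteq> 0" for n using a by (simp only: of_real_eq_0_iff)
  have Phol: "P holomorphic_on A" for A unfolding P_def
    by (intro holomorphic_intros)
  have Ghol: "G holomorphic_on A" for A unfolding G_def
    by (intro holomorphic_intros Phol holomorphic_hurwitz_entire w)
  have Fhol: "F holomorphic_on (- {1})" unfolding F_def by (intro holomorphic_intros Ghol) auto
  have "is_pole F 1" unfolding F_def
  proof (rule is_pole_divide)
    show "isCont G 1" using holomorphic_on_imp_continuous_on[OF Ghol[of UNIV]] by (simp add: continuous_on_eq_continuous_at)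
    show "filterlim (\<lambda>s. s - 1) (at 0) (at (1 :: complex))"
      by (auto simp: filterlim_at eventually_at_filter intro!: tendsto_eq_intros)
    show "G 1 \<noteq> 0" using hurwitz_entire_1[OF w] by (simp add: G_def)
  qed
  moreover have "F z = (\<Sum>n. 1 / (of_nat (Suc n) + complex_of_real a) powr z)" if "Re z > 1" for z
  proof -
    have "z - 1 \<noteq> 0" using that by auto
    hence "F z = P z + hurwitz_tail w z"
      using hurwitz_entire_eq_tail[OF w that] by (simp add: F_def G_def add_divide_distrib)
    also have "\<dots> = hurwitz_tail (1 + a) z"
      using hurwitz_tail_shift[of "1 + a" z N] a that by (simp add: P_def w_def)
    also have "\<dots> = (\<Sum>n. 1 / (of_nat (Suc n) + complex_of_real a) powr z)"
      unfolding hurwitz_tail_def by (simp add: powr_minus inverse_eq_divide add_ac)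
    finally show ?thesis .
  qed
  \<comment> \<open>The prescribed value \<open>0\<close> at the pole holds because
    \<open>F 1\<close> is a division by zero.\<close>
  ultimately have specF: "spec F" using Fhol by (simp add: spec_def) (simp add: F_def)
  have uniq: "g = F" if g: "spec g" for g
  proof
    fix z
    show "g z = F z"
    proof (cases "z = 1")
      case True thus ?thesis using g specF by (simp add: spec_def)
    next
      case False
      show ?thesis
      proof (rule analytic_continuation_open[of "{s. Re s > 1}" "- {1 :: complex}" g F z])
        show "{s. Re s > 1} \<noteq> {}" by (auto intro!: exI[of _ 2])
        show "connected (- {1 :: complex})" by (intro connected_punctured_universe) simp
        show "\<And>y. y \<in> {s. Re s > 1} \<Longrightarrow> g y = F y" using g specF by (simp add: spec_def)
      qed (use g Fhol False in \<open>auto simp: spec_def open_halfspace_Re_gt\<close>)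
    qed
  qed
  have "hurwitz_zeta s a = (THE f. spec f) s" unfolding hurwitz_zeta_def spec_def ..
  also have "(THE f. spec f) = F" using specF uniq by (rule the_equality)
  also have "F s = P s + hurwitz_entire w s / (s - 1)" using s by (simp add: F_def G_def add_divide_distrib)
  finally show ?thesis by (simp add: P_def w_def)
qed

section \<open>Growth on vertical lines\<close>

definition cos_primitive :: "real \<Rightarrow> real \<Rightarrow> real" where
  "cos_primitive l t = (if l = 0 then t else sin (l * t) / l)"

text \<open>The frequency \<open>0\<close> occurs on the diagonal of the squared sum. There
  \<open>sin (l * t) / l\<close> would be constantly \<open>0\<close> by division by zero, whereas
  the primitive has to be \<open>t\<close>.\<close>

lemma DERIV_cos_primitive: "DERIV (cos_primitive l) t :> cos (l * t)"
proof (cases "l = 0")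
  case True
  hence "cos_primitive l = (\<lambda>t. t)" by (auto simp: cos_primitive_def)
  thus ?thesis using True by simp
next
  case False
  have "DERIV (\<lambda>t. sin (l * t) / l) t :> cos (l * t) * l / l"
    by (auto intro!: derivative_eq_intros)
  moreover have "cos_primitive l = (\<lambda>t. sin (l * t) / l)" using False by (auto simp: cos_primitive_def)
  ultimately show ?thesis using False by simp
qed

lemma norm_exponential_sum_squared:
  fixes c L :: "nat \<Rightarrow> real"
  shows "(norm (\<Sum>n<N. complex_of_real (c n) * cis (- (t * L n))))\<^sup>2 =
    (\<Sum>n<N. \<Sum>m<N. c n * c m * cos ((L n - L m) * t))"
proof -
  have "complex_of_real ((norm (\<Sum>n<N. complex_of_real (c n) * cis (- (t * L n))))\<^sup>2) =
    (\<Sum>n<N. complex_of_real (c n) * cis (- (t * L n))) * (\<Sum>m<N. complex_of_real (c m) * cis (t * L m))"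
    unfolding complex_norm_square by (simp add: cis_cnj)
  also have "\<dots> = (\<Sum>n<N. \<Sum>m<N. complex_of_real (c n * c m) * cis (- ((L n - L m) * t)))"
    unfolding sum_product
  proof (intro sum.cong refl)
    fix n m
    have "complex_of_real (c n) * cis (- (t * L n)) * (complex_of_real (c m) * cis (t * L m)) =
      complex_of_real (c n * c m) * (cis (- (t * L n)) * cis (t * L m))" by simp
    also have "cis (- (t * L n)) * cis (t * L m) = cis (- ((L n - L m) * t))"
      by (simp add: cis_mult algebra_simps)
    finally show "complex_of_real (c n) * cis (- (t * L n)) * (complex_of_real (c m) * cis (t * L m)) =
      complex_of_real (c n * c m) * cis (- ((L n - L m) * t))" .
  qed
  finally have "(norm (\<Sum>n<N. complex_of_real (c n) * cis (- (t * L n))))\<^sup>2 =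
    Re (\<Sum>n<N. \<Sum>m<N. complex_of_real (c n * c m) * cis (- ((L n - L m) * t)))"
    by (metis Re_complex_of_real)
  thus ?thesis by simp
qed

lemma sum_inverse_distance_le:
  assumes n: "n < N"
  shows "(\<Sum>m\<in>{..<N}-{n}. 1 / \<bar>real n - real m\<bar>) \<le> 2 * (\<Sum>j=1..N. 1 / real j)"
proof -
  have "(\<Sum>m\<in>{..<N}-{n}. 1 / \<bar>real n - real m\<bar>) = (\<Sum>m\<in>{..<n} \<union> {n<..<N}. 1 / \<bar>real n - real m\<bar>)"
    using n by (intro sum.cong) auto
  also have "\<dots> = (\<Sum>m<n. 1 / \<bar>real n - real m\<bar>) + (\<Sum>m\<in>{n<..<N}. 1 / \<bar>real n - real m\<bar>)"
    by (rule sum.union_disjoint) auto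
  also have "(\<Sum>m<n. 1 / \<bar>real n - real m\<bar>) = (\<Sum>j=1..n. 1 / real j)"
    by (rule sum.reindex_bij_witness[of _ "\<lambda>j. n - j" "\<lambda>m. n - m"]) (auto simp: of_nat_diff)
  also have "(\<Sum>m\<in>{n<..<N}. 1 / \<bar>real n - real m\<bar>) = (\<Sum>j\<in>{1..<N - n}. 1 / real j)"
    by (rule sum.reindex_bij_witness[of _ "\<lambda>j. n + j" "\<lambda>m. m - n"]) (auto simp: of_nat_diff)
  also have "(\<Sum>j=1..n. 1 / real j) \<le> (\<Sum>j=1..N. 1 / real j)" using n by (intro sum_mono2) auto
  also have "(\<Sum>j\<in>{1..<N - n}. 1 / real j) \<le> (\<Sum>j=1..N. 1 / real j)" by (intro sum_mono2) auto
  finally show ?thesis by simp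
qed

text \<open>After expansion of the square the diagonal contributes the length of the interval. Off
  the diagonal oscillation bounds each integral by \<open>2 / \<bar>L n - L m\<bar>\<close>, which
  the separation turns into \<open>2 * D / \<bar>real n - real m\<bar>\<close>, so each row costs a
  harmonic sum. \<open>A\<close> and \<open>B\<close> are carried along because the integrand to be
  dominated later is affine in the squared norm.\<close>

lemma mean_square_exponential_sum:
  fixes c L :: "nat \<Rightarrow> real"
  assumes c: "\<And>n. n < N \<Longrightarrow> \<bar>c n\<bar> \<le> V" and D: "D > 0"
    and sep: "\<And>n m. n < N \<Longrightarrow> m < n \<Longrightarrow> \<bar>L n - L m\<bar> \<ge> (real n - real m) / D"
    and ab: "a \<le> b" and A: "A \<ge> 0" and B: "B \<ge> 0"
  shows "(\<integral>\<^sup>+t. ennreal (A * (norm (\<Sum>n<N. complex_of_real (c n) * cis (- (t * L n))))\<^sup>2 + B) * indicator {a..b} t \<partial>lborel)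
    \<le> ennreal (A * (V\<^sup>2 * (real N * (b - a) + 4 * D * real N * (\<Sum>j=1..N. 1 / real j))) + B * (b - a))"
proof -
  define F where "F = (\<lambda>t. A * (\<Sum>n<N. \<Sum>m<N. c n * c m * cos_primitive (L n - L m) t) + B * t)"
  define f where "f = (\<lambda>t. A * (norm (\<Sum>n<N. complex_of_real (c n) * cis (- (t * L n))))\<^sup>2 + B)"
  have V: "V \<ge> 0" if "N > 0" using c[of 0] that abs_ge_zero[of "c 0"] by linarith
  have f: "f t = A * (\<Sum>n<N. \<Sum>m<N. c n * c m * cos ((L n - L m) * t)) + B" for t
    unfolding f_def norm_exponential_sum_squared ..
  have "(\<integral>\<^sup>+t. ennreal (f t) * indicator {a..b} t \<partial>lborel) = ennreal (F b - F a)"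
  proof (rule nn_integral_FTC_Icc[OF _ _ _ ab])
    show "f \<in> borel_measurable borel" unfolding f[abs_def] by measurable
    show "DERIV F t :> f t" for t
      unfolding F_def f by (auto intro!: derivative_eq_intros DERIV_cos_primitive simp: mult.commute)
    show "f t \<ge> 0" for t unfolding f_def using A B by simp
  qed
  also have "F b - F a \<le> A * (V\<^sup>2 * (real N * (b - a) + 4 * D * real N * (\<Sum>j=1..N. 1 / real j))) + B * (b - a)"
  proof -
    have s: "\<bar>cos_primitive (L n - L m) b - cos_primitive (L n - L m) a\<bar> \<le> (if n = m then b - a else 2 * D * (1 / \<bar>real n - real m\<bar>))"
      if "n < N" "m < N" for n m
    proof (cases "n = m")
      case True thus ?thesis using ab by (simp add: cos_primitive_def)
    next
      case False
      have l: "\<bar>L n - L m\<bar> \<ge> \<bar>real n - real m\<bar> / D"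
        using sep[of n m] sep[of m n] that False by (cases "m < n") (auto simp: abs_minus_commute)
      have p: "\<bar>real n - real m\<bar> / D > 0" using False D by simp
      hence nz: "L n - L m \<noteq> 0" using l by auto
      have "\<bar>sin ((L n - L m) * b) - sin ((L n - L m) * a)\<bar> \<le> 2"
        using abs_sin_le_one[of "(L n - L m) * b"] abs_sin_le_one[of "(L n - L m) * a"] by argo
      hence "\<bar>cos_primitive (L n - L m) b - cos_primitive (L n - L m) a\<bar> \<le> 2 / \<bar>L n - L m\<bar>"
        using nz by (simp add: cos_primitive_def diff_divide_distrib[symmetric] divide_right_mono)
      also have "\<dots> \<le> 2 / (\<bar>real n - real m\<bar> / D)" using l p by (intro divide_left_mono mult_pos_pos) auto
      finally show ?thesis using False by (simp add: mult_ac)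
    qed
    have "(\<Sum>n<N. \<Sum>m<N. c n * c m * cos_primitive (L n - L m) b) - (\<Sum>n<N. \<Sum>m<N. c n * c m * cos_primitive (L n - L m) a)
       = (\<Sum>n<N. \<Sum>m<N. c n * c m * (cos_primitive (L n - L m) b - cos_primitive (L n - L m) a))"
      by (simp add: sum_subtractf right_diff_distrib)
    also have "\<dots> \<le> (\<Sum>n<N. \<Sum>m<N. V\<^sup>2 * (if n = m then b - a else 2 * D * (1 / \<bar>real n - real m\<bar>)))"
    proof (intro sum_mono)
      fix n m assume nm: "n \<in> {..<N}" "m \<in> {..<N}"
      have "\<bar>c n * c m * (cos_primitive (L n - L m) b - cos_primitive (L n - L m) a)\<bar> \<le>
         V * V * (if n = m then b - a else 2 * D * (1 / \<bar>real n - real m\<bar>))"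
        unfolding abs_mult using nm c V by (intro mult_mono s) auto
      thus "c n * c m * (cos_primitive (L n - L m) b - cos_primitive (L n - L m) a) \<le>
         V\<^sup>2 * (if n = m then b - a else 2 * D * (1 / \<bar>real n - real m\<bar>))"
        unfolding power2_eq_square by (rule order_trans[OF abs_ge_self])
    qed
    also have "\<dots> = V\<^sup>2 * (\<Sum>n<N. (b - a) + 2 * D * (\<Sum>m\<in>{..<N}-{n}. 1 / \<bar>real n - real m\<bar>))"
      unfolding sum_distrib_left[symmetric]
    proof (intro arg_cong[where f = "\<lambda>y. V\<^sup>2 * y"] sum.cong refl)
      fix n assume n: "n \<in> {..<N}"
      have "(\<Sum>m<N. if n = m then b - a else 2 * D * (1 / \<bar>real n - real m\<bar>)) =
        (b - a) + (\<Sum>m\<in>{..<N}-{n}. if n = m then b - a else 2 * D * (1 / \<bar>real n - real m\<bar>))"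
        using n by (subst sum.remove[of _ n]) auto
      also have "(\<Sum>m\<in>{..<N}-{n}. if n = m then b - a else 2 * D * (1 / \<bar>real n - real m\<bar>)) =
        (\<Sum>m\<in>{..<N}-{n}. 2 * D * (1 / \<bar>real n - real m\<bar>))" by (intro sum.cong) auto
      also have "\<dots> = 2 * D * (\<Sum>m\<in>{..<N}-{n}. 1 / \<bar>real n - real m\<bar>)" by (rule sum_distrib_left[symmetric])
      finally show "(\<Sum>m<N. if n = m then b - a else 2 * D * (1 / \<bar>real n - real m\<bar>)) =
        (b - a) + 2 * D * (\<Sum>m\<in>{..<N}-{n}. 1 / \<bar>real n - real m\<bar>)" .
    qed
    also have "\<dots> \<le> V\<^sup>2 * (\<Sum>n<N. (b - a) + 2 * D * (2 * (\<Sum>j=1..N. 1 / real j)))"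
      using D by (intro mult_left_mono sum_mono add_left_mono sum_inverse_distance_le) auto
    also have "\<dots> = V\<^sup>2 * (real N * (b - a) + 4 * D * real N * (\<Sum>j=1..N. 1 / real j))"
      by (simp add: algebra_simps)
    finally have "A * ((\<Sum>n<N. \<Sum>m<N. c n * c m * cos_primitive (L n - L m) b) - (\<Sum>n<N. \<Sum>m<N. c n * c m * cos_primitive (L n - L m) a))
      \<le> A * (V\<^sup>2 * (real N * (b - a) + 4 * D * real N * (\<Sum>j=1..N. 1 / real j)))"
      by (rule mult_left_mono[OF _ A])
    thus ?thesis unfolding F_def by (simp add: right_diff_distrib)
  qed
  finally show ?thesis unfolding f_def by (simp add: ennreal_leI)
qed

section \<open>Derivatives: Dirichlet polynomial and remainder\<close>

lemma higher_deriv_dirichlet_polynomial: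
  assumes "\<And>n. n < N \<Longrightarrow> x n > (0 :: real)"
  shows "(deriv ^^ k) (\<lambda>s. \<Sum>n<N. complex_of_real (x n) powr (- s)) =
    (\<lambda>s. \<Sum>n<N. of_real ((- ln (x n)) ^ k) * complex_of_real (x n) powr (- s))"
proof (induction k)
  case (Suc k)
  have "deriv (\<lambda>s. \<Sum>n<N. of_real ((- ln (x n)) ^ k) * complex_of_real (x n) powr (- s)) s =
     (\<Sum>n<N. of_real ((- ln (x n)) ^ Suc k) * complex_of_real (x n) powr (- s))" for s
  proof (rule DERIV_imp_deriv, rule DERIV_sum)
    fix n assume "n \<in> {..<N}"
    hence x: "x n > 0" using assms by auto
    have "((\<lambda>s. complex_of_real (x n) powr (- s)) has_field_derivative (- of_real (ln (x n)) * complex_of_real (x n) powr (- s))) (at s)"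
      using DERIV_chain2[OF has_field_derivative_powr_right[of "complex_of_real (x n)"] DERIV_minus[OF DERIV_ident], of s UNIV] x
      by (simp add: Ln_of_real)
    from DERIV_cmult[OF this, of "of_real ((- ln (x n)) ^ k)"]
    show "((\<lambda>s. of_real ((- ln (x n)) ^ k) * complex_of_real (x n) powr (- s)) has_field_derivative
        of_real ((- ln (x n)) ^ Suc k) * complex_of_real (x n) powr (- s)) (at s)" by (simp add: mult_ac)
  qed
  thus ?case unfolding funpow.simps comp_def Suc by (intro ext)
qed simp

lemma holomorphic_hurwitz_zeta:
  assumes "a \<ge> 0" shows "(\<lambda>s. hurwitz_zeta s a) holomorphic_on (- {1})"
proof (rule holomorphic_transform)
  show "(\<lambda>s. (\<Sum>n<1. of_real (real n + (1 + a)) powr (- s)) + hurwitz_entire (1 + a + real 1) s / (s - 1)) holomorphic_on - {1}"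
    using assms by (intro holomorphic_intros holomorphic_hurwitz_entire) auto
qed (use hurwitz_zeta_eq[OF assms, of 1] in auto)

lemma hurwitz_zeta_deriv_eq:
  assumes a: "a \<ge> 0" and N: "N \<ge> 1" and s: "s \<noteq> 1"
  shows "hurwitz_zeta_deriv k s a =
    (\<Sum>n<N. of_real ((- ln (real n + (1 + a))) ^ k) * complex_of_real (real n + (1 + a)) powr (- s)) +
    (deriv ^^ k) (\<lambda>s. hurwitz_entire (1 + a + real N) s / (s - 1)) s"
proof -
  have w: "1 + a + real N \<ge> 2" using a N by simp
  define P where "P = (\<lambda>s. \<Sum>n<N. complex_of_real (real n + (1 + a)) powr (- s))"
  define R where "R = (\<lambda>s. hurwitz_entire (1 + a + real N) s / (s - 1))"
  have P: "P holomorphic_on (- {1})" unfolding P_def by (intro holomorphic_intros)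
  have R: "R holomorphic_on (- {1})" unfolding R_def by (intro holomorphic_intros holomorphic_hurwitz_entire w) auto
  have "hurwitz_zeta_deriv k s a = (deriv ^^ k) (\<lambda>s. P s + R s) s"
    unfolding hurwitz_zeta_deriv_def
  proof (rule higher_deriv_transform_within_open[where S = "- {1}"])
    show "(\<lambda>s. P s + R s) holomorphic_on - {1}" by (intro holomorphic_intros P R)
  qed (use s hurwitz_zeta_eq[OF a N] holomorphic_hurwitz_zeta[OF a] in \<open>auto simp: P_def R_def\<close>)
  also have "\<dots> = (deriv ^^ k) P s + (deriv ^^ k) R s"
    by (rule higher_deriv_add[OF P R]) (use s in auto)
  also have "(deriv ^^ k) P = (\<lambda>s. \<Sum>n<N. of_real ((- ln (real n + (1 + a))) ^ k) * complex_of_real (real n + (1 + a)) powr (- s))"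
    unfolding P_def by (rule higher_deriv_dirichlet_polynomial) (use a in auto)
  finally show ?thesis by (simp add: R_def)
qed

lemma norm_higher_deriv_le:
  assumes hol: "f holomorphic_on S" and S: "open S" "cball z r \<subseteq> S" and r: "r > 0"
    and bound: "\<And>y. y \<in> cball z r \<Longrightarrow> norm (f y) < B"
  shows "norm ((deriv ^^ k) f z) \<le> fact k * B / r ^ k"
proof (cases "k = 0")
  case True
  thus ?thesis using bound[of z] r by simp
next
  case False
  show ?thesis
    by (rule Cauchy_higher_deriv_bound[where y = 0])
       (use assms False in \<open>auto intro: holomorphic_on_subset[OF hol subset_trans[OF ball_subset_cball]] continuous_on_subset[OF holomorphic_on_imp_continuous_on[OF hol]]\<close>)
qed

text \<open>Cauchy's estimate on a disc that stays in \<open>Re z \<ge> - 1 / 2\<close>. There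
  \<open>hurwitz_entire\<close> is at most of order \<open>T powr (3 / 2)\<close>, and dividing by
  \<open>z - 1\<close>, of norm at least \<open>T / 2\<close>, leaves
  \<open>T powr (1 / 2)\<close>.\<close>

lemma remainder_deriv_bound:
  assumes a: "0 \<le> a" "a < 1" and \<sigma>: "\<sigma> > - 1 / 2"
  shows "\<exists>C. \<forall>i t. 2 ^ i \<le> \<bar>t\<bar> \<longrightarrow> \<bar>t\<bar> \<le> 2 * 2 ^ i \<longrightarrow>
    norm ((deriv ^^ k) (\<lambda>s. hurwitz_entire (1 + a + real (40 * 2 ^ i)) s / (s - 1)) (Complex \<sigma> t)) \<le> C * (2 ^ i) powr (1 / 2)"
proof -
  define r where "r = min (1 / 2) (\<sigma> + 1 / 2)"
  have r: "r > 0" "r \<le> 1 / 2" "\<sigma> - r \<ge> - 1 / 2" using \<sigma> by (auto simp: r_def min_def)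
  \<comment> \<open>\<open>42 powr (3 / 2)\<close> comes from \<open>w \<le> 42 * T\<close>; the
    summand \<open>1\<close> makes the bound strict, as Cauchy's estimate is applied with a strict
    bound.\<close>
  define C where "C = 4 * (\<bar>\<sigma>\<bar> + 5) * 42 powr (3 / 2) + 1"
  have "norm ((deriv ^^ k) (\<lambda>s. hurwitz_entire (1 + a + real (40 * 2 ^ i)) s / (s - 1)) (Complex \<sigma> t)) \<le> (fact k * C / r ^ k) * (2 ^ i) powr (1 / 2)"
    if t: "2 ^ i \<le> \<bar>t\<bar>" "\<bar>t\<bar> \<le> 2 * 2 ^ i" for i t
  proof -
    define T :: real where "T = 2 ^ i"
    have T: "T \<ge> 1" by (simp add: T_def)
    define w where "w = 1 + a + real (40 * 2 ^ i)"
    have w: "w \<ge> 40 * T" "w \<le> 42 * T" "w \<ge> 40"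
    proof -
      have "w = 1 + a + 40 * T" by (simp add: w_def T_def)
      thus "w \<ge> 40 * T" "w \<le> 42 * T" "w \<ge> 40" using a T by auto
    qed
    have geom: "\<bar>Im z\<bar> \<ge> T / 2" "\<bar>Im z\<bar> \<le> w / 10" "Re z \<ge> - 1 / 2" "norm (z - 1) \<le> \<bar>\<sigma>\<bar> + 2 + 2 * T"
      if "z \<in> cball (Complex \<sigma> t) r" for z
    proof -
      have "norm (z - Complex \<sigma> t) \<le> r" using that by (simp add: dist_norm norm_minus_commute)
      hence "\<bar>Re z - \<sigma>\<bar> \<le> r" "\<bar>Im z - t\<bar> \<le> r"
        using abs_Re_le_cmod[of "z - Complex \<sigma> t"] abs_Im_le_cmod[of "z - Complex \<sigma> t"] by auto
      hence *: "\<sigma> - r \<le> Re z" "Re z \<le> \<sigma> + r" "t - r \<le> Im z" "Im z \<le> t + r" by (simp_all add: abs_le_iff)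
      show 1: "\<bar>Im z\<bar> \<ge> T / 2" using * t(1) r(2) T unfolding T_def[symmetric] by argo
      have 2: "\<bar>Im z\<bar> \<le> 2 * T + 1 / 2" using * t(2) r(2) unfolding T_def[symmetric] by argo
      \<comment> \<open>The origin of the factor 40: the disc reaches height
        \<open>2 * T + 1 / 2\<close>, which is at most \<open>4 * T\<close>, and this must not
        exceed \<open>w / 10\<close>.\<close>
      thus "\<bar>Im z\<bar> \<le> w / 10" using w T by argo
      show "Re z \<ge> - 1 / 2" using * r by argo
      have "\<bar>Re z - 1\<bar> \<le> \<bar>\<sigma>\<bar> + 3 / 2" using * r(2) by argo
      thus "norm (z - 1) \<le> \<bar>\<sigma>\<bar> + 2 + 2 * T" using cmod_le[of "z - 1"] 2 by simp
    qed
    have "norm (hurwitz_entire w z / (z - 1)) < C * T powr (1 / 2)" if z: "z \<in> cball (Complex \<sigma> t) r" for z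
    proof -
      have "norm (z - 1) \<ge> T / 2" using abs_Im_le_cmod[of "z - 1"] geom(1)[OF z] by simp
      moreover have "norm (hurwitz_entire w z) \<le> 2 * (\<bar>\<sigma>\<bar> + 5) * (42 * T) powr (3 / 2)"
      proof -
        have "norm (z - 1) / w \<le> (\<bar>\<sigma>\<bar> + 2 + 2 * T) / T"
          using w T geom(4)[OF z] by (intro frac_le) auto
        also have "\<dots> = (\<bar>\<sigma>\<bar> + 2) / T + 2" using T by (simp add: field_simps)
        finally have "norm (z - 1) / w \<le> (\<bar>\<sigma>\<bar> + 2) / T + 2" .
        moreover have "(\<bar>\<sigma>\<bar> + 2) / T \<le> (\<bar>\<sigma>\<bar> + 2) / 1" using T by (intro divide_left_mono) auto
        ultimately have 1: "1 + norm (z - 1) / w \<le> \<bar>\<sigma>\<bar> + 5" by argo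
        have "w powr (1 - Re z) \<le> w powr (3 / 2)" using w geom(3)[OF z] by (intro powr_mono) auto
        also have "w powr (3 / 2) \<le> (42 * T) powr (3 / 2)" using w by (intro powr_mono2) auto
        finally have 2: "w powr (1 - Re z) \<le> (42 * T) powr (3 / 2)" .
        have "norm (hurwitz_entire w z) \<le> 2 * (1 + norm (z - 1) / w) * w powr (1 - Re z)"
          by (rule norm_hurwitz_entire_le) (use w geom[OF z] in auto)
        also have "\<dots> \<le> 2 * (\<bar>\<sigma>\<bar> + 5) * (42 * T) powr (3 / 2)"
          using w by (intro mult_mono 1 2) auto
        finally show ?thesis .
      qed
      ultimately have "norm (hurwitz_entire w z / (z - 1)) \<le> 2 * (\<bar>\<sigma>\<bar> + 5) * (42 * T) powr (3 / 2) / (T / 2)"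
        unfolding norm_divide using T by (intro frac_le) auto
      also have "\<dots> = 4 * (\<bar>\<sigma>\<bar> + 5) * 42 powr (3 / 2) * (T powr (3 / 2) / T)"
        using T by (simp add: powr_mult)
      also have "T powr (3 / 2) / T = T powr (1 / 2)"
        using T powr_diff[of T "3/2" 1] by simp
      also have "4 * (\<bar>\<sigma>\<bar> + 5) * 42 powr (3 / 2) * T powr (1 / 2) < C * T powr (1 / 2)"
        unfolding C_def using T by (intro mult_strict_right_mono) auto
      finally show ?thesis .
    qed
    hence "norm ((deriv ^^ k) (\<lambda>s. hurwitz_entire w s / (s - 1)) (Complex \<sigma> t)) \<le> fact k * (C * T powr (1 / 2)) / r ^ k"
    proof (rule norm_higher_deriv_le[where S = "- {1}", rotated 4])
      show "(\<lambda>s. hurwitz_entire w s / (s - 1)) holomorphic_on - {1}"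
        using w by (intro holomorphic_intros holomorphic_hurwitz_entire) auto
      show "cball (Complex \<sigma> t) r \<subseteq> - {1}" using geom(1) T by force
    qed (use r in auto)
    thus ?thesis by (simp add: w_def T_def)
  qed
  thus ?thesis by blast
qed

section \<open>Dyadic blocks on a vertical line\<close>

lemma power_ln_le_powr:
  assumes e: "e > (0 :: real)"
  shows "\<exists>C>0. \<forall>x\<ge>1. (ln x) ^ k \<le> C * x powr e"
proof (cases "k = 0")
  case True
  have "(ln x) ^ k \<le> 1 * x powr e" if "x \<ge> 1" for x :: real
    using True that e by (simp add: ge_one_powr_ge_zero)
  thus ?thesis by (intro exI[of _ 1]) auto
next
  case False
  define d where "d = e / real k"
  have d: "d > 0" using False e by (simp add: d_def)
  have "(ln x) ^ k \<le> (1 / d) ^ k * x powr e" if x: "x \<ge> 1" for x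
  proof -
    have "ln x \<le> 1 / d * x powr d" using ln_powr_bound[OF x d] by simp
    hence "(ln x) ^ k \<le> (1 / d * x powr d) ^ k" using x by (intro power_mono) auto
    also have "\<dots> = (1 / d) ^ k * (x powr d) ^ k" by (rule power_mult_distrib)
    also have "(x powr d) ^ k = x powr (d * real k)"
      using x by (simp add: powr_powr[symmetric] powr_realpow)
    also have "d * real k = e" using False by (simp add: d_def)
    finally show ?thesis .
  qed
  thus ?thesis using d by (intro exI[of _ "(1 / d) ^ k"]) auto
qed

text \<open>The logarithm is given away to a small power \<open>d\<close>, so that the final
  estimate is mere addition of exponents; the constant bounds the convergent series of exponent
  \<open>1 + d\<close>.\<close>

lemma sum_inverse_le_powr:
  assumes d: "d > 0"
  shows "(\<Sum>j=1..N. 1 / real j) \<le> (1 + 1 / d) * real N powr d"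
proof -
  have "(\<Sum>j=1..N. 1 / real j) \<le> (\<Sum>j=1..N. real N powr d * real j powr (- (1 + d)))"
  proof (rule sum_mono)
    fix j assume j: "j \<in> {1..N}"
    have "1 / real j = real j powr d * real j powr (- (1 + d))"
      using j by (simp add: powr_add[symmetric] powr_minus_divide)
    also have "\<dots> \<le> real N powr d * real j powr (- (1 + d))" using j d by (intro mult_right_mono powr_mono2) auto
    finally show "1 / real j \<le> real N powr d * real j powr (- (1 + d))" .
  qed
  also have "\<dots> = real N powr d * (\<Sum>j<N. (real j + 1) powr (- (1 + d)))"
    unfolding sum_distrib_left
    by (rule sum.reindex_bij_witness[of _ Suc "\<lambda>j. j - 1"]) (auto simp: of_nat_diff)
  also have "(\<Sum>j<N. (real j + 1) powr (- (1 + d))) \<le> (\<Sum>j. (real j + 1) powr (- (1 + d)))"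
    using hurwitz_majorant(1)[of 1 "1 + d"] d by (intro sum_le_suminf) auto
  also have "\<dots> \<le> 1 + 1 / d" using hurwitz_majorant(2)[of 1 "1 + d"] d by simp
  finally have "(\<Sum>j=1..N. 1 / real j) \<le> real N powr d * (1 + 1 / d)" by (simp add: mult_left_mono)
  thus ?thesis by (simp only: mult.commute)
qed

lemma abs_diff_ln_ge:
  assumes "0 < x" "x < y" "y \<le> (D :: real)"
  shows "\<bar>ln y - ln x\<bar> \<ge> (y - x) / D"
proof -
  have "ln (x / y) \<le> x / y - 1" using assms by (intro ln_le_minus_one) auto
  moreover have "ln (x / y) = ln x - ln y" using assms by (simp add: ln_div)
  moreover have "x / y - 1 = - ((y - x) / y)" using assms by (simp add: field_simps)
  ultimately have "(y - x) / y \<le> ln y - ln x" by argo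
  moreover have "(y - x) / D \<le> (y - x) / y" using assms by (intro divide_left_mono) auto
  ultimately show ?thesis by argo
qed

text \<open>Coefficients of order \<open>T powr ((1 - \<eta>) / 2)\<close> give a mean square of
  order \<open>T powr (3 - \<eta> / 2)\<close>, and with the weight \<open>1 / T^2\<close> a block
  costs \<open>T powr (- \<eta> / 4)\<close>. The endpoints \<open>u\<close> and \<open>v\<close>
  are left free to treat both signs of \<open>t\<close> at once.\<close>

lemma dyadic_block_bound:
  assumes a: "0 \<le> a" "a < 1" and \<sigma>: "\<sigma> > - 1 / 2"
  shows "\<exists>C \<rho>. 0 < \<rho> \<and> \<rho> < 1 \<and> C \<ge> 0 \<and> (\<forall>i u v. v = u + 2 ^ i \<longrightarrow> (\<forall>t\<in>{u..v}. 2 ^ i \<le> \<bar>t\<bar> \<and> \<bar>t\<bar> \<le> 2 * 2 ^ i) \<longrightarrow>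
    (\<integral>\<^sup>+t. ennreal (norm (hurwitz_zeta_deriv k (Complex \<sigma> t) a) / (1 + t\<^sup>2)) * indicator {u..v} t \<partial>lborel) \<le> ennreal (C * \<rho> ^ i))"
proof -
  \<comment> \<open>The margin to the critical abscissa; the cap \<open>1 / 2\<close> keeps the
    exponent \<open>(1 - \<eta>) / 2\<close> nonnegative.\<close>
  define \<eta> where "\<eta> = min (\<sigma> + 1 / 2) (1 / 2)"
  have \<eta>: "\<eta> > 0" "\<eta> \<le> 1 / 2" "- \<sigma> \<le> 1 / 2 - \<eta>" using \<sigma> by (auto simp: \<eta>_def min_def)
  obtain C0 where C0: "\<And>i t. 2 ^ i \<le> \<bar>t\<bar> \<Longrightarrow> \<bar>t\<bar> \<le> 2 * 2 ^ i \<Longrightarrow>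
    norm ((deriv ^^ k) (\<lambda>s. hurwitz_entire (1 + a + real (40 * 2 ^ i)) s / (s - 1)) (Complex \<sigma> t)) \<le> C0 * (2 ^ i) powr (1 / 2)"
    using remainder_deriv_bound[OF a \<sigma>, of k] by blast
  define CR where "CR = max C0 0"
  obtain C1 where C1: "C1 > 0" "\<And>x. x \<ge> 1 \<Longrightarrow> (ln x) ^ k \<le> C1 * x powr (\<eta> / 2)"
    using power_ln_le_powr[of "\<eta> / 2" k] \<eta>(1) by auto
  \<comment> \<open>Here 40 is \<open>N / T\<close>, and 6560 is \<open>4 * 41 * 40\<close> with
    \<open>41 * T\<close> bounding all \<open>x n\<close>. The last factor is the constant of the
    harmonic sum with exponent \<open>\<eta> / 2\<close>.\<close>
  define K1 where "K1 = 40 + 6560 * ((1 + 2 / \<eta>) * 40 powr (\<eta> / 2))"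
  define K2 where "K2 = 1 / 2 * (C1\<^sup>2 * 41 powr (1 - \<eta>) * K1)"
  define \<rho> :: real where "\<rho> = 2 powr (- \<eta> / 4)"
  have \<rho>: "0 < \<rho>" "\<rho> < 1" using \<eta> by (auto simp: \<rho>_def powr_less_one)
  have K: "K1 \<ge> 0" "K2 \<ge> 0" "CR \<ge> 0" using \<eta> by (auto simp: K1_def K2_def CR_def)
  have blk: "(\<integral>\<^sup>+t. ennreal (norm (hurwitz_zeta_deriv k (Complex \<sigma> t) a) / (1 + t\<^sup>2)) * indicator {u..v} t \<partial>lborel) \<le> ennreal ((K2 + (1 / 2 + CR)) * \<rho> ^ i)"
    if uv: "v = u + 2 ^ i" and rng: "\<And>t. t \<in> {u..v} \<Longrightarrow> 2 ^ i \<le> \<bar>t\<bar> \<and> \<bar>t\<bar> \<le> 2 * 2 ^ i" for i u v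
  proof -
    define T :: real where "T = 2 ^ i"
    have T: "T \<ge> 1" "T > 0" by (simp_all add: T_def)
    define N :: nat where "N = 40 * 2 ^ i"
    have N: "real N = 40 * T" "N \<ge> 1" by (simp_all add: N_def T_def)
    define x where "x = (\<lambda>n. real n + (1 + a))"
    have x: "x n \<ge> 1" "x n > 0" for n using a by (auto simp: x_def)
    have xN: "x n \<le> 41 * T" if "n < N" for n
    proof -
      have "real n + 1 \<le> 40 * T" using that N by linarith
      thus ?thesis using a T by (simp add: x_def)
    qed
    define c where "c = (\<lambda>n. (- ln (x n)) ^ k * x n powr (- \<sigma>))"
    define L where "L = (\<lambda>n. ln (x n))"
    define V where "V = C1 * (41 * T) powr ((1 - \<eta>) / 2)"
    have V2: "V\<^sup>2 = C1\<^sup>2 * 41 powr (1 - \<eta>) * T powr (1 - \<eta>)"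
    proof -
      have "((41 * T) powr ((1 - \<eta>) / 2))\<^sup>2 = (41 * T) powr (1 - \<eta>)"
        by (simp add: power2_eq_square powr_add[symmetric])
      also have "\<dots> = 41 powr (1 - \<eta>) * T powr (1 - \<eta>)" using T by (simp add: powr_mult)
      finally show ?thesis by (simp add: V_def power_mult_distrib)
    qed
    have cV: "\<bar>c n\<bar> \<le> V" if "n < N" for n
    proof -
      have "\<bar>c n\<bar> = (ln (x n)) ^ k * x n powr (- \<sigma>)"
        using x[of n] by (simp add: c_def abs_mult power_abs)
      also have "\<dots> \<le> (C1 * x n powr (\<eta> / 2)) * x n powr (1 / 2 - \<eta>)"
        using x[of n] \<eta> C1 by (intro mult_mono powr_mono C1(2)) auto
      also have "\<dots> = C1 * x n powr ((1 - \<eta>) / 2)" using x[of n]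
        by (simp add: powr_add[symmetric] field_simps)
      also have "\<dots> \<le> V" unfolding V_def using x[of n] \<eta> C1 xN[OF that] by (intro mult_left_mono powr_mono2) auto
      finally show ?thesis .
    qed
    have sep: "\<bar>L n - L m\<bar> \<ge> (real n - real m) / (41 * T)" if "n < N" "m < n" for n m
      using abs_diff_ln_ge[of "x m" "x n" "41 * T"] x[of m] xN[of n] that by (simp add: L_def x_def)
    define S where "S = (\<lambda>t. \<Sum>n<N. complex_of_real (c n) * cis (- (t * L n)))"
    \<comment> \<open>The balancing exponent: \<open>T powr (- p)\<close> times the mean square and
      \<open>T powr (p - 4)\<close> times the length both come out as
      \<open>T powr (- \<eta> / 4)\<close>.\<close>
    define p where "p = 3 - \<eta> / 4"
    define A B where "A = 1 / 2 * T powr (- p)" and "B = 1 / 2 * T powr (p - 4) + CR * T powr (- 3 / 2)"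
    have AB: "A \<ge> 0" "B \<ge> 0" using K by (simp_all add: A_def B_def)
    have pw: "norm (hurwitz_zeta_deriv k (Complex \<sigma> t) a) / (1 + t\<^sup>2) \<le> A * (norm (S t))\<^sup>2 + B" if t: "t \<in> {u..v}" for t
    proof -
      have tT: "T \<le> \<bar>t\<bar>" "\<bar>t\<bar> \<le> 2 * T" using rng[OF t] by (simp_all add: T_def)
      have "Complex \<sigma> t \<noteq> 1" using tT T by (auto simp: complex_eq_iff)
      hence "hurwitz_zeta_deriv k (Complex \<sigma> t) a =
        (\<Sum>n<N. of_real ((- ln (x n)) ^ k) * complex_of_real (x n) powr (- Complex \<sigma> t)) +
        (deriv ^^ k) (\<lambda>s. hurwitz_entire (1 + a + real N) s / (s - 1)) (Complex \<sigma> t)"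
        unfolding x_def by (rule hurwitz_zeta_deriv_eq[OF a(1) N(2)])
      also have "(\<Sum>n<N. of_real ((- ln (x n)) ^ k) * complex_of_real (x n) powr (- Complex \<sigma> t)) = S t"
        unfolding S_def
      proof (intro sum.cong refl)
        fix n
        have "complex_of_real (x n) powr (- Complex \<sigma> t) = exp (Complex (- \<sigma> * L n) (- (t * L n)))"
          using x[of n] by (simp add: powr_def Ln_of_real L_def complex_eq_iff flip: exp_of_real)
            (simp add: complex_of_real_def exp_eq_polar mult.commute)
        also have "\<dots> = complex_of_real (x n powr (- \<sigma>)) * cis (- (t * L n))"
          using x[of n] by (simp add: exp_eq_polar powr_def L_def)
        finally show "of_real ((- ln (x n)) ^ k) * complex_of_real (x n) powr (- Complex \<sigma> t) =
          complex_of_real (c n) * cis (- (t * L n))" by (simp add: c_def)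
      qed
      finally have "norm (hurwitz_zeta_deriv k (Complex \<sigma> t) a) \<le> norm (S t) + CR * T powr (1 / 2)"
      proof -
        assume eq: "hurwitz_zeta_deriv k (Complex \<sigma> t) a = S t + (deriv ^^ k) (\<lambda>s. hurwitz_entire (1 + a + real N) s / (s - 1)) (Complex \<sigma> t)"
        have "norm ((deriv ^^ k) (\<lambda>s. hurwitz_entire (1 + a + real N) s / (s - 1)) (Complex \<sigma> t)) \<le> C0 * T powr (1 / 2)"
          using C0[of i t] rng[OF t] by (simp add: N_def T_def)
        also have "\<dots> \<le> CR * T powr (1 / 2)" by (intro mult_right_mono) (auto simp: CR_def)
        finally show ?thesis unfolding eq by (intro order_trans[OF norm_triangle_ineq] add_left_mono)
      qed
      moreover have "1 + t\<^sup>2 \<ge> T\<^sup>2" using power_mono[OF tT(1), of 2] T by simp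
      ultimately have "norm (hurwitz_zeta_deriv k (Complex \<sigma> t) a) / (1 + t\<^sup>2) \<le> (norm (S t) + CR * T powr (1 / 2)) / T\<^sup>2"
        using T K by (intro frac_le) (auto intro!: add_nonneg_nonneg)
      also have "\<dots> = norm (S t) / T\<^sup>2 + CR * (T powr (1 / 2) / T powr 2)"
        using T by (simp add: add_divide_distrib)
      also have "T powr (1 / 2) / T powr 2 = T powr (- 3 / 2)" by (simp add: powr_diff[symmetric])
      \<comment> \<open>Pointwise arithmetic-geometric mean in place of Cauchy-Schwarz on the block:
        it turns the first power of the norm into a square.\<close>
      also have "norm (S t) / T\<^sup>2 \<le> A * (norm (S t))\<^sup>2 + 1 / 2 * T powr (p - 4)"
      proof -
        define y z where "y = norm (S t) * T powr (- p / 2)" and "z = T powr (p / 2 - 2)"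
        have "2 * (y * z) \<le> y\<^sup>2 + z\<^sup>2" using sum_squares_bound[of y z] by simp
        moreover have "y * z = norm (S t) / T\<^sup>2"
        proof -
          have "y * z = norm (S t) * T powr (- 2)" by (simp add: y_def z_def powr_add[symmetric])
          thus ?thesis using T by (simp add: powr_minus divide_inverse)
        qed
        moreover have "y\<^sup>2 = (norm (S t))\<^sup>2 * T powr (- p)" "z\<^sup>2 = T powr (p - 4)"
          by (simp_all add: y_def z_def power_mult_distrib power2_eq_square powr_add[symmetric])
        ultimately show ?thesis by (simp add: A_def field_simps)
      qed
      finally show ?thesis by (simp add: B_def)
    qed
    have "(\<integral>\<^sup>+t. ennreal (norm (hurwitz_zeta_deriv k (Complex \<sigma> t) a) / (1 + t\<^sup>2)) * indicator {u..v} t \<partial>lborel)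
      \<le> (\<integral>\<^sup>+t. ennreal (A * (norm (S t))\<^sup>2 + B) * indicator {u..v} t \<partial>lborel)"
      by (intro nn_integral_mono) (auto simp: indicator_def intro!: ennreal_leI pw)
    also have "\<dots> \<le> ennreal (A * (V\<^sup>2 * (real N * (v - u) + 4 * (41 * T) * real N * (\<Sum>j=1..N. 1 / real j))) + B * (v - u))"
      unfolding S_def by (rule mean_square_exponential_sum) (use cV sep AB T uv in auto)
    also have "\<dots> \<le> ennreal ((K2 + (1 / 2 + CR)) * \<rho> ^ i)"
    proof (rule ennreal_leI)
      have vu: "v - u = T" using uv by (simp add: T_def)
      have H: "(\<Sum>j=1..N. 1 / real j) \<le> (1 + 2 / \<eta>) * 40 powr (\<eta> / 2) * T powr (\<eta> / 2)"
        using sum_inverse_le_powr[of "\<eta> / 2" N] \<eta> T unfolding N by (simp add: powr_mult)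
      have T1: "T powr (\<eta> / 2) \<ge> 1" using T \<eta> by (simp add: ge_one_powr_ge_zero)
      have "real N * (v - u) + 4 * (41 * T) * real N * (\<Sum>j=1..N. 1 / real j) =
         T * T * (40 + 6560 * (\<Sum>j=1..N. 1 / real j))" unfolding N vu by (simp add: algebra_simps)
      also have "\<dots> \<le> T * T * (40 * T powr (\<eta> / 2) + 6560 * ((1 + 2 / \<eta>) * 40 powr (\<eta> / 2) * T powr (\<eta> / 2)))"
        using T T1 H by (intro mult_left_mono add_mono) auto
      also have "\<dots> = K1 * (T powr 2 * T powr (\<eta> / 2))" using T by (simp add: K1_def algebra_simps power2_eq_square)
      also have "T powr 2 * T powr (\<eta> / 2) = T powr (2 + \<eta> / 2)" by (rule powr_add[symmetric])
      finally have "A * (V\<^sup>2 * (real N * (v - u) + 4 * (41 * T) * real N * (\<Sum>j=1..N. 1 / real j)))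
         \<le> A * (V\<^sup>2 * (K1 * T powr (2 + \<eta> / 2)))"
        using AB by (intro mult_left_mono) auto
      also have "\<dots> = K2 * (T powr (- p) * (T powr (1 - \<eta>) * T powr (2 + \<eta> / 2)))"
        unfolding V2 A_def K2_def by (simp add: mult_ac)
      also have "T powr (- p) * (T powr (1 - \<eta>) * T powr (2 + \<eta> / 2)) = T powr (- \<eta> / 4)"
        by (simp add: powr_add[symmetric] p_def field_simps)
      finally have 1: "A * (V\<^sup>2 * (real N * (v - u) + 4 * (41 * T) * real N * (\<Sum>j=1..N. 1 / real j))) \<le> K2 * T powr (- \<eta> / 4)" .
      have "B * (v - u) = 1 / 2 * (T powr (p - 4) * T powr 1) + CR * (T powr (- 3 / 2) * T powr 1)"
        unfolding vu B_def using T by (simp add: algebra_simps)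
      also have "T powr (p - 4) * T powr 1 = T powr (- \<eta> / 4)" by (subst powr_add[symmetric]) (simp add: p_def)
      also have "T powr (- 3 / 2) * T powr 1 = T powr (- 1 / 2)" by (subst powr_add[symmetric]) simp
      also have "1 / 2 * T powr (- \<eta> / 4) + CR * T powr (- 1 / 2) \<le> 1 / 2 * T powr (- \<eta> / 4) + CR * T powr (- \<eta> / 4)"
        using T \<eta> K by (intro add_left_mono mult_left_mono powr_mono) auto
      finally have 2: "B * (v - u) \<le> (1 / 2 + CR) * T powr (- \<eta> / 4)" by (simp add: algebra_simps)
      have "T powr (- \<eta> / 4) = \<rho> ^ i"
        by (simp add: T_def \<rho>_def powr_realpow[symmetric] powr_powr mult.commute)
      thus "A * (V\<^sup>2 * (real N * (v - u) + 4 * (41 * T) * real N * (\<Sum>j=1..N. 1 / real j))) + B * (v - u) \<le> (K2 + (1 / 2 + CR)) * \<rho> ^ i"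
        using 1 2 by (simp add: algebra_simps)
    qed
    finally show ?thesis .
  qed
  show ?thesis
  proof (rule exI[of _ "K2 + (1 / 2 + CR)"], rule exI[of _ \<rho>], intro conjI allI impI \<rho>)
    show "K2 + (1 / 2 + CR) \<ge> 0" using K by simp
  qed (rule blk; simp)
qed

lemma continuous_hurwitz_zeta_deriv_line:
  assumes "a \<ge> 0" "\<sigma> \<noteq> 1"
  shows "continuous_on UNIV (\<lambda>t. hurwitz_zeta_deriv k (Complex \<sigma> t) a)"
proof -
  have "(\<lambda>s. hurwitz_zeta_deriv k s a) holomorphic_on (- {1})"
    unfolding hurwitz_zeta_deriv_def by (intro holomorphic_intros holomorphic_hurwitz_zeta assms) auto
  hence "continuous_on (- {1}) (\<lambda>s. hurwitz_zeta_deriv k s a)" by (rule holomorphic_on_imp_continuous_on)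
  moreover have "continuous_on UNIV (\<lambda>t. Complex \<sigma> t)" unfolding Complex_eq by (intro continuous_intros)
  ultimately show ?thesis
    by (rule continuous_on_compose2) (use assms(2) in \<open>auto simp: complex_eq_iff\<close>)
qed

lemma integrable_hurwitz_zeta_deriv_line:
  assumes a: "0 \<le> a" "a < 1" and \<sigma>: "\<sigma> > - 1 / 2" "\<sigma> \<noteq> 1"
  shows "integrable lborel (\<lambda>t. hurwitz_zeta_deriv k (Complex \<sigma> t) a / of_real (1 + t\<^sup>2))"
proof (rule integrableI_bounded)
  define g where "g = (\<lambda>t. hurwitz_zeta_deriv k (Complex \<sigma> t) a)"
  have gc: "continuous_on UNIV g" unfolding g_def by (rule continuous_hurwitz_zeta_deriv_line[OF a(1) \<sigma>(2)])
  have gm [measurable]: "g \<in> borel_measurable borel" using gc by (rule borel_measurable_continuous_onI)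
  show "(\<lambda>t. hurwitz_zeta_deriv k (Complex \<sigma> t) a / of_real (1 + t\<^sup>2)) \<in> borel_measurable lborel"
  proof -
    have nz: "complex_of_real (1 + t\<^sup>2) \<noteq> 0" for t
      using add_pos_nonneg[of 1 "t\<^sup>2"] by (simp only: of_real_eq_0_iff) auto
    have "continuous_on UNIV (\<lambda>t. g t / complex_of_real (1 + t\<^sup>2))"
      by (intro continuous_intros gc) (use nz in auto)
    hence "(\<lambda>t. g t / complex_of_real (1 + t\<^sup>2)) \<in> borel_measurable borel" by (rule borel_measurable_continuous_onI)
    thus ?thesis by (simp add: g_def)
  qed
  define f where "f = (\<lambda>t. ennreal (norm (g t) / (1 + t\<^sup>2)))"
  have fm [measurable]: "f \<in> borel_measurable borel" unfolding f_def by measurable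
  obtain C \<rho> where \<rho>: "0 < \<rho>" "\<rho> < 1" "C \<ge> 0"
    and block: "\<And>i u v. v = u + 2 ^ i \<Longrightarrow> (\<And>t. t \<in> {u..v} \<Longrightarrow> 2 ^ i \<le> \<bar>t\<bar> \<and> \<bar>t\<bar> \<le> 2 * 2 ^ i) \<Longrightarrow>
      (\<integral>\<^sup>+t. f t * indicator {u..v} t \<partial>lborel) \<le> ennreal (C * \<rho> ^ i)"
  proof -
    from dyadic_block_bound[OF a \<sigma>(1), of k] obtain C \<rho> where "0 < \<rho>" "\<rho> < 1" "C \<ge> 0"
      and blk: "\<forall>i u v. v = u + 2 ^ i \<longrightarrow> (\<forall>t\<in>{u..v}. 2 ^ i \<le> \<bar>t\<bar> \<and> \<bar>t\<bar> \<le> 2 * 2 ^ i) \<longrightarrow>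
        (\<integral>\<^sup>+t. f t * indicator {u..v} t \<partial>lborel) \<le> ennreal (C * \<rho> ^ i)"
      unfolding f_def g_def by (elim exE conjE)
    show ?thesis
      by (rule that[of \<rho> C]) (fact+, rule blk[rule_format])
  qed
  have b1: "(\<integral>\<^sup>+t. f t * indicator {2 ^ i..2 * 2 ^ i} t \<partial>lborel) \<le> ennreal (C * \<rho> ^ i)" for i
    by (rule block) auto
  have b2: "(\<integral>\<^sup>+t. f t * indicator {- (2 * 2 ^ i)..- (2 ^ i)} t \<partial>lborel) \<le> ennreal (C * \<rho> ^ i)" for i
    by (rule block) auto
  define J :: "nat \<Rightarrow> real set" where "J = (\<lambda>i. {2 ^ i..2 * 2 ^ i})"
  define J' :: "nat \<Rightarrow> real set" where "J' = (\<lambda>i. {- (2 * 2 ^ i)..- (2 ^ i)})"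
  have dyadic: "\<exists>i. 2 ^ i \<le> y \<and> y \<le> 2 * 2 ^ i" if "y \<ge> (1 :: real)" for y
  proof -
    define i where "i = nat \<lfloor>log 2 y\<rfloor>"
    have "log 2 y \<ge> 0" using that by simp
    hence i: "real i \<le> log 2 y" "log 2 y \<le> 1 + real i" unfolding i_def by linarith+
    have "2 powr (real i) \<le> 2 powr (log 2 y)" "2 powr (log 2 y) \<le> 2 powr (1 + real i)"
      using i by (simp_all only: powr_le_cancel_iff one_less_numeral_iff semiring_norm)
    thus ?thesis using that by (intro exI[of _ i]) (simp add: powr_realpow powr_add)
  qed
  \<comment> \<open>Neighbouring closed blocks share endpoints, so this is an inequality only, and
    an upper bound is all that is required.\<close>
  have cover: "f t \<le> f t * indicator {-1..1} t + (\<Sum>i. f t * indicator (J i) t + f t * indicator (J' i) t)" for t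
  proof (cases "\<bar>t\<bar> \<le> 1")
    case True
    thus ?thesis by (auto simp: indicator_def)
  next
    case False
    then obtain i where "2 ^ i \<le> \<bar>t\<bar>" "\<bar>t\<bar> \<le> 2 * 2 ^ i" using dyadic[of "\<bar>t\<bar>"] by auto
    hence "t \<in> J i \<or> t \<in> J' i" by (cases "t \<ge> 0") (auto simp: J_def J'_def)
    hence "f t \<le> f t * indicator (J i) t + f t * indicator (J' i) t" by (auto simp: indicator_def)
    also have "\<dots> \<le> (\<Sum>i. f t * indicator (J i) t + f t * indicator (J' i) t)"
      using sum_le_suminf[of "\<lambda>i. f t * indicator (J i) t + f t * indicator (J' i) t" "{i}"] by simp
    finally show ?thesis by (simp add: add_increasing)
  qed
  have "(\<integral>\<^sup>+t. f t \<partial>lborel) \<le> (\<integral>\<^sup>+t. f t * indicator {-1..1} t + (\<Sum>i. f t * indicator (J i) t + f t * indicator (J' i) t) \<partial>lborel)"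
    by (intro nn_integral_mono cover)
  also have "\<dots> = (\<integral>\<^sup>+t. f t * indicator {-1..1} t \<partial>lborel) +
     (\<Sum>i. (\<integral>\<^sup>+t. f t * indicator (J i) t \<partial>lborel) + (\<integral>\<^sup>+t. f t * indicator (J' i) t \<partial>lborel))"
    unfolding J_def J'_def by (subst nn_integral_add) (auto simp: nn_integral_suminf nn_integral_add)
  also have "\<dots> < \<infinity>"
  proof -
    have "(\<Sum>i. (\<integral>\<^sup>+t. f t * indicator (J i) t \<partial>lborel) + (\<integral>\<^sup>+t. f t * indicator (J' i) t \<partial>lborel)) \<le>
      (\<Sum>i. ennreal (2 * C * \<rho> ^ i))"
    proof (rule suminf_le)
      fix i
      have "(\<integral>\<^sup>+t. f t * indicator (J i) t \<partial>lborel) + (\<integral>\<^sup>+t. f t * indicator (J' i) t \<partial>lborel) \<le> ennreal (C * \<rho> ^ i) + ennreal (C * \<rho> ^ i)"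
        unfolding J_def J'_def by (intro add_mono b1 b2)
      also have "\<dots> = ennreal (2 * C * \<rho> ^ i)" using \<rho> by (subst ennreal_plus[symmetric]) auto
      finally show "(\<integral>\<^sup>+t. f t * indicator (J i) t \<partial>lborel) + (\<integral>\<^sup>+t. f t * indicator (J' i) t \<partial>lborel) \<le> ennreal (2 * C * \<rho> ^ i)" .
    qed auto
    also have "\<dots> < \<infinity>"
    proof -
      have "summable (\<lambda>i. 2 * C * \<rho> ^ i)" using \<rho> by (intro summable_mult summable_geometric) auto
      hence "(\<Sum>i. ennreal (2 * C * \<rho> ^ i)) \<noteq> top" using \<rho> by (intro ennreal_suminf_neq_top) auto
      thus ?thesis by (simp add: less_top)
    qed
    finally have 1: "(\<Sum>i. (\<integral>\<^sup>+t. f t * indicator (J i) t \<partial>lborel) + (\<integral>\<^sup>+t. f t * indicator (J' i) t \<partial>lborel)) < \<infinity>" .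
    have "compact (g ` {-1..1})" using gc by (intro compact_continuous_image) (auto intro: continuous_on_subset)
    then obtain B where B: "\<And>t. t \<in> {-1..1} \<Longrightarrow> norm (g t) \<le> B" using compact_imp_bounded bounded_iff by (metis imageI)
    have "(\<integral>\<^sup>+t. f t * indicator {-1..1} t \<partial>lborel) \<le> (\<integral>\<^sup>+(t :: real). ennreal B * indicator {-1..1} t \<partial>lborel)"
    proof (intro nn_integral_mono)
      fix t :: real
      have "norm (g t) / (1 + t\<^sup>2) \<le> norm (g t) / 1" by (intro divide_left_mono) (auto intro: add_pos_nonneg)
      thus "f t * indicator {-1..1} t \<le> ennreal B * indicator {-1..1} t"
        using B[of t] by (auto simp: indicator_def f_def intro!: ennreal_leI)
    qed
    also have "\<dots> = ennreal B * 2" by (subst nn_integral_cmult_indicator) auto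
    also have "\<dots> < \<infinity>" by (simp add: ennreal_mult_less_top)
    finally show ?thesis using 1 by simp
  qed
  finally have "(\<integral>\<^sup>+t. f t \<partial>lborel) < \<infinity>" .
  moreover have "ennreal (norm (hurwitz_zeta_deriv k (Complex \<sigma> t) a / of_real (1 + t\<^sup>2))) = f t" for t
  proof -
    have "norm (complex_of_real (1 + t\<^sup>2)) = 1 + t\<^sup>2" by (subst norm_of_real) (simp add: add_nonneg_nonneg)
    thus ?thesis unfolding f_def g_def norm_divide by simp
  qed
  ultimately show "(\<integral>\<^sup>+t. ennreal (norm (hurwitz_zeta_deriv k (Complex \<sigma> t) a / of_real (1 + t\<^sup>2))) \<partial>lborel) < \<infinity>"
    by simp
qed

section \<open>The Boole map and the Cauchy measure\<close>

text \<open>Since \<open>1 / 0 = 0\<close>, the point \<open>0\<close> is fixed, in agreement with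
  the value that \<open>boole_map\<close> prescribes at its singularity.\<close>

definition boole :: "real \<Rightarrow> real" where
  "boole x = (x - 1 / x) / 2"

definition cauchy_measure :: "real measure" where
  "cauchy_measure = density lborel (\<lambda>x. ennreal (1 / (pi * (1 + x\<^sup>2))))"

lemma sets_cauchy [measurable_cong, simp]: "sets cauchy_measure = sets borel"
  and space_cauchy [simp]: "space cauchy_measure = UNIV"
  by (simp_all add: cauchy_measure_def)

lemma measurable_boole [measurable]: "boole \<in> borel_measurable borel"
  unfolding boole_def by measurable

lemma emeasure_cauchy:
  assumes "A \<in> sets borel"
  shows "emeasure cauchy_measure A = (\<integral>\<^sup>+x. ennreal (1 / (pi * (1 + x\<^sup>2))) * indicator A x \<partial>lborel)"
  unfolding cauchy_measure_def by (subst emeasure_density) (use assms in auto)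

lemma one_plus_sq_pos: "0 < 1 + (x::real)\<^sup>2"
  by (rule add_pos_nonneg) auto

lemma emeasure_cauchy_singleton: "emeasure cauchy_measure {c} = 0"
  by (subst emeasure_cauchy) (auto simp: nn_integral_indicator_singleton' nn_integral_indicator_singleton)

lemma emeasure_cauchy_atLeast: "emeasure cauchy_measure {c..} = ennreal (1 / 2 - arctan c / pi)"
proof -
  have "((\<lambda>x. arctan x / pi) \<longlongrightarrow> (pi/2) / pi) at_top"
    by (intro tendsto_intros tendsto_arctan_at_top) auto
  hence lim: "((\<lambda>x. arctan x / pi) \<longlongrightarrow> 1 / 2) at_top" by simp
  have der: "DERIV (\<lambda>x. arctan x / pi) x :> 1 / (pi * (1 + x\<^sup>2))" for x
    using one_plus_sq_pos[of x] by (auto intro!: derivative_eq_intros simp: divide_simps)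
  have "(\<integral>\<^sup>+x. ennreal (1 / (pi * (1 + x\<^sup>2))) * indicator {c..} x \<partial>lborel) = ennreal (1 / 2 - arctan c / pi)"
    by (rule nn_integral_FTC_atLeast[OF _ der _ lim]) (auto intro!: divide_nonneg_pos mult_pos_pos one_plus_sq_pos)
  thus ?thesis by (simp add: emeasure_cauchy)
qed

lemma emeasure_cauchy_greaterThan: "emeasure cauchy_measure {c<..} = ennreal (1 / 2 - arctan c / pi)"
proof -
  have "emeasure cauchy_measure ({c..} - {c}) = emeasure cauchy_measure {c..}"
    by (rule emeasure_Diff_null_set) (auto simp: null_sets_def emeasure_cauchy_singleton)
  moreover have "{c..} - {c} = {c<..}" by auto
  ultimately show ?thesis by (simp add: emeasure_cauchy_atLeast)
qed

lemma emeasure_cauchy_UNIV: "emeasure cauchy_measure UNIV = 1"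
proof -
  have lim: "filterlim (\<lambda>i. - real i) at_bot sequentially"
    by (simp add: filterlim_uminus_at_bot filterlim_real_sequentially)
  have "(\<lambda>i. emeasure cauchy_measure {- real i<..}) \<longlonglongrightarrow> emeasure cauchy_measure (\<Union>i. {- real i<..})"
    by (rule Lim_emeasure_incseq) (auto simp: incseq_def)
  also have "(\<Union>i. {- real i<..}) = UNIV"
  proof -
    have "\<exists>i. - real i < x" for x using reals_Archimedean2[of "-x"] by (auto simp: minus_less_iff)
    thus ?thesis by auto
  qed
  finally have 1: "(\<lambda>i. ennreal (1 / 2 - arctan (- real i) / pi)) \<longlonglongrightarrow> emeasure cauchy_measure UNIV"
    by (simp only: emeasure_cauchy_greaterThan)
  have "(\<lambda>i. ennreal (1 / 2 - arctan (- real i) / pi)) \<longlonglongrightarrow> ennreal (1 / 2 - (- (pi/2)) / pi)"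
    by (intro tendsto_intros tendsto_ennrealI filterlim_compose[OF tendsto_arctan_at_bot lim]) auto
  from LIMSEQ_unique[OF 1 this] show ?thesis by simp
qed

interpretation cauchy: prob_space cauchy_measure
  by standard (simp add: emeasure_cauchy_UNIV)

text \<open>The double angle formula for the cotangent. In the coordinate \<open>arctan\<close>, for
  which the Cauchy measure is uniform, the positive branch is affine of slope 2; monotonicity and
  the halving of measure both follow from this.\<close>

lemma arctan_boole_pos:
  assumes "u > 0" shows "arctan (boole u) = 2 * arctan u - pi / 2"
proof (rule arctan_unique)
  have a: "0 < arctan u" "arctan u < pi / 2" using assms arctan_ubound by auto
  show "- (pi / 2) < 2 * arctan u - pi / 2" "2 * arctan u - pi / 2 < pi / 2" using a by auto
  have c: "cos (arctan u) \<noteq> 0" by (simp add: cos_arctan one_plus_sq_pos less_imp_neq[symmetric])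
  have s: "sin (arctan u) \<noteq> 0" using sin_gt_zero[of "arctan u"] a pi_gt_zero by linarith
  have "tan (2 * arctan u - pi / 2) = - cos (2 * arctan u) / sin (2 * arctan u)"
    by (simp add: tan_def sin_diff cos_diff)
  also have "\<dots> = (tan (arctan u) - 1 / tan (arctan u)) / 2"
    unfolding cos_double sin_double tan_def using s c
    by (simp add: field_simps power2_eq_square)
  finally show "tan (2 * arctan u - pi / 2) = boole u" by (simp add: boole_def tan_arctan)
qed

lemma boole_minus: "boole (- x) = - boole x"
  by (simp add: boole_def field_split_simps)

lemma boole_mono_pos: "0 < x \<Longrightarrow> 0 < y \<Longrightarrow> boole x < boole y \<longleftrightarrow> x < y"
  using arctan_boole_pos[of x] arctan_boole_pos[of y] arctan_less_iff[of x y]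
    arctan_less_iff[of "boole x" "boole y"] by linarith

lemma boole_mono_neg: "x < 0 \<Longrightarrow> y < 0 \<Longrightarrow> boole x < boole y \<longleftrightarrow> x < y"
  using boole_mono_pos[of "-y" "-x"] by (simp add: boole_minus)

lemma boole_surj_pos: obtains u where "u > 0" "boole u = v"
proof
  \<comment> \<open>The equation \<open>boole u = v\<close> is
    \<open>u^2 - 2 * v * u - 1 = 0\<close>; its positive root is \<open>v + r\<close>.\<close>
  define r where "r = sqrt (v\<^sup>2 + 1)"
  have "r > \<bar>v\<bar>" unfolding r_def by (rule real_less_rsqrt) auto
  thus p: "v + r > 0" by linarith
  have "r\<^sup>2 = v\<^sup>2 + 1" unfolding r_def by simp
  hence "(v + r) * (v + r) - 1 = 2 * v * (v + r)" by (simp add: algebra_simps power2_eq_square)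
  thus "boole (v + r) = v"
    unfolding boole_def using p by (simp add: divide_simps)
qed

text \<open>Two finite measures that agree on all rays \<open>{v<..}\<close> coincide. The branch
  pulls such a ray back to \<open>{u<..}\<close>, and
  \<open>arctan u = arctan v / 2 + pi / 4\<close> halves its mass.\<close>

lemma emeasure_boole_pos:
  assumes "B \<in> sets borel"
  shows "emeasure cauchy_measure ({0<..} \<inter> boole -` B) = emeasure cauchy_measure B / 2"
proof -
  let ?N = "distr (density cauchy_measure (indicator {0<..})) borel boole"
  let ?M = "scale_measure (1/2) cauchy_measure"
  have N: "emeasure ?N B = emeasure cauchy_measure ({0<..} \<inter> boole -` B)" if [measurable]: "B \<in> sets borel" for B
  proof -
    have m: "boole -` B \<in> sets borel" using measurable_sets[OF measurable_boole that] by simp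
    show ?thesis
      by (simp add: emeasure_distr emeasure_density m that nn_integral_indicator flip: indicator_inter_arith)
  qed
  have M: "emeasure ?M B = emeasure cauchy_measure B / 2" for B
    by (simp add: mult.commute[of "1/2"] ennreal_times_divide)
  have "?N = ?M"
  proof (rule measure_eqI_lessThan)
    fix v :: real
    obtain u where u: "u > 0" "boole u = v" by (rule boole_surj_pos)
    have "{0<..} \<inter> boole -` {v<..} = {u<..}"
      using u boole_mono_pos[of u] by auto
    hence N_v: "emeasure ?N {v<..} = ennreal (1 / 2 - arctan u / pi)"
      by (simp add: N emeasure_cauchy_greaterThan)
    thus "emeasure ?N {v<..} < \<infinity>" by simp
    note N_v
    also have "arctan u = arctan v / 2 + pi / 4"
      using arctan_boole_pos[OF u(1)] unfolding u(2) by linarith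
    also have "1 / 2 - (arctan v / 2 + pi / 4) / pi = (1 / 2 - arctan v / pi) / 2"
      by (simp add: field_simps)
    finally have *: "emeasure ?N {v<..} = ennreal (1 / 2 - arctan v / pi) / 2"
      using arctan_ubound[of v] by (simp add: ennreal_divide_numeral field_simps)
    show "emeasure ?N {v<..} = emeasure ?M {v<..}"
      unfolding * M emeasure_cauchy_greaterThan ..
  qed auto
  thus ?thesis using N[OF assms] M[of B] by simp
qed

lemma emeasure_cauchy_uminus:
  assumes [measurable]: "B \<in> sets borel"
  shows "emeasure cauchy_measure (uminus -` B) = emeasure cauchy_measure B"
proof -
  have m: "uminus -` B \<in> sets borel" using measurable_sets[of uminus borel borel B] assms by simp
  have "emeasure cauchy_measure B = (\<integral>\<^sup>+x. ennreal (1 / (pi * (1 + (0 + (-1) * x)\<^sup>2))) * indicator B (0 + (-1) * x) \<partial>lborel)"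
    by (simp only: emeasure_cauchy[OF assms], subst nn_integral_real_affine[where c = "-1" and t = 0]) auto
  also have "\<dots> = emeasure cauchy_measure (uminus -` B)"
    by (simp add: emeasure_cauchy m indicator_def)
  finally show ?thesis by simp
qed

lemma emeasure_boole_neg:
  assumes [measurable]: "B \<in> sets borel"
  shows "emeasure cauchy_measure ({..<0} \<inter> boole -` B) = emeasure cauchy_measure B / 2"
proof -
  have m: "uminus -` B \<in> sets borel" using measurable_sets[of uminus borel borel B] assms by simp
  have m2: "{0<..} \<inter> boole -` uminus -` B \<in> sets borel"
    using measurable_sets[OF measurable_boole m] by auto
  have "{..<0} \<inter> boole -` B = uminus -` ({0<..} \<inter> boole -` uminus -` B)"
    by (auto simp: boole_minus)
  thus ?thesis by (simp only: emeasure_cauchy_uminus m2 emeasure_boole_pos m emeasure_cauchy_uminus assms)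
qed

lemma measure_boole_pos:
  "B \<in> sets borel \<Longrightarrow> measure cauchy_measure ({0<..} \<inter> boole -` B) = measure cauchy_measure B / 2"
  using emeasure_boole_pos[of B] by (simp add: cauchy.emeasure_eq_measure ennreal_divide_numeral)

lemma measure_boole_neg:
  "B \<in> sets borel \<Longrightarrow> measure cauchy_measure ({..<0} \<inter> boole -` B) = measure cauchy_measure B / 2"
  using emeasure_boole_neg[of B] by (simp add: cauchy.emeasure_eq_measure ennreal_divide_numeral)

lemma emeasure_boole:
  assumes [measurable]: "B \<in> sets borel"
  shows "emeasure cauchy_measure (boole -` B) = emeasure cauchy_measure B"
proof -
  have m: "boole -` B \<in> sets borel" using measurable_sets[OF measurable_boole assms] by simp
  have null: "{0} \<inter> boole -` B \<in> null_sets cauchy_measure"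
    by (cases "0 \<in> boole -` B") (auto simp: null_sets_def emeasure_cauchy_singleton)
  have "boole -` B = (({..<0} \<inter> boole -` B) \<union> ({0<..} \<inter> boole -` B)) \<union> ({0} \<inter> boole -` B)" by auto
  also have "emeasure cauchy_measure \<dots> = emeasure cauchy_measure (({..<0} \<inter> boole -` B) \<union> ({0<..} \<inter> boole -` B))"
    by (rule emeasure_Un_null_set[OF _ null]) (use m in auto)
  also have "\<dots> = emeasure cauchy_measure B / 2 + emeasure cauchy_measure B / 2"
    using m by (subst plus_emeasure[symmetric])
      (auto simp: emeasure_boole_neg emeasure_boole_pos intro!: sets.Int)
  finally show ?thesis
    by (simp add: cauchy.emeasure_eq_measure ennreal_divide_numeral flip: ennreal_plus)
qed

lemma distr_boole: "distr cauchy_measure cauchy_measure boole = cauchy_measure"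
proof (rule measure_eqI)
  fix A assume "A \<in> sets (distr cauchy_measure cauchy_measure boole)"
  hence [measurable]: "A \<in> sets borel" by simp
  show "emeasure (distr cauchy_measure cauchy_measure boole) A = emeasure cauchy_measure A"
    by (subst emeasure_distr) (auto simp: emeasure_boole)
qed auto

lemma measurable_boole_iterate [measurable]: "(boole ^^ j) \<in> borel_measurable borel"
  by (induction j) (auto intro: measurable_comp[OF _ measurable_boole] simp: id_def)

lemma measure_boole_iterate:
  "B \<in> sets borel \<Longrightarrow> measure cauchy_measure ((boole ^^ j) -` B) = measure cauchy_measure B"
proof (induction j arbitrary: B)
  case (Suc j)
  have "boole -` B \<in> sets borel" using measurable_sets[OF measurable_boole Suc.prems] by simp
  note IH = Suc.IH[OF this]
  have "(boole ^^ Suc j) -` B = (boole ^^ j) -` (boole -` B)" by (auto simp: funpow_swap1)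
  thus ?case using IH emeasure_boole[OF Suc.prems] by (simp add: measure_def del: funpow.simps)
qed simp

text \<open>The ray \<open>{..<c}\<close> is, up to a null set, a full branch or the pullback of the ray
  \<open>{..<boole c}\<close> under one branch, so each iteration halves the correlation defect.\<close>

lemma boole_correlation:
  assumes "B \<in> sets borel"
  shows "\<bar>measure cauchy_measure ({..<c} \<inter> (boole ^^ j) -` B) -
           measure cauchy_measure {..<c} * measure cauchy_measure B\<bar> \<le> (1 / 2) ^ j"
proof (induction j arbitrary: c)
  case 0
  let ?m = "measure cauchy_measure"
  have "?m ({..<c} \<inter> B) \<le> 1" "?m ({..<c} \<inter> B) \<ge> 0" "?m {..<c} * ?m B \<ge> 0" "?m {..<c} * ?m B \<le> 1"
    by (auto intro: mult_le_one)
  hence "\<bar>?m ({..<c} \<inter> B) - ?m {..<c} * ?m B\<bar> \<le> 1" by linarith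
  thus ?case by simp
next
  case (Suc j)
  let ?m = "measure cauchy_measure"
  define B' where "B' = (boole ^^ j) -` B"
  have B': "B' \<in> sets borel" unfolding B'_def using measurable_sets[OF measurable_boole_iterate assms] by simp
  have mB': "?m B' = ?m B" unfolding B'_def by (rule measure_boole_iterate[OF assms])
  have v: "(boole ^^ Suc j) -` B = boole -` B'"
    by (simp add: B'_def funpow_Suc_right vimage_comp del: funpow.simps)
  have bB': "boole -` B' \<in> sets borel" using measurable_sets[OF measurable_boole B'] by simp
  have null: "?m (X \<union> ({0} \<inter> Y)) = ?m X" if "X \<in> sets borel" for X Y
  proof -
    have "{0} \<inter> Y \<in> null_sets cauchy_measure"
      by (cases "0 \<in> Y") (auto simp: null_sets_def emeasure_cauchy_singleton)
    thus ?thesis using that by (simp add: measure_Un_null_set)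
  qed
  have halve: "\<bar>x / 2 - y / 2 * z\<bar> = \<bar>x - y * z\<bar> / 2" for x y z :: real
    by (simp add: field_simps)
  consider "c < 0" | "c = 0" | "c > 0" by linarith
  thus ?case
  proof cases
    case 1
    have *: "?m ({..<c} \<inter> boole -` D) = ?m ({..<boole c} \<inter> D) / 2" if "D \<in> sets borel" for D
    proof -
      have "{..<c} \<inter> boole -` D = {..<0} \<inter> boole -` ({..<boole c} \<inter> D)"
        using 1 boole_mono_neg by auto
      thus ?thesis using that by (simp only: measure_boole_neg sets.Int lessThan_borel)
    qed
    have c: "?m {..<c} = ?m {..<boole c} / 2" using *[of UNIV] by simp
    show ?thesis unfolding v *[OF B'] c halve using Suc.IH[of "boole c"]
      by (simp add: B'_def)
  next
    case 2
    have h: "?m {..<0} = 1 / 2" using measure_boole_neg[of UNIV] cauchy.prob_space by simp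
    show ?thesis unfolding v 2 measure_boole_neg[OF B'] h mB' by simp
  next
    case 3
    have *: "?m ({..<c} \<inter> boole -` D) = ?m D / 2 + ?m ({..<boole c} \<inter> D) / 2" if D: "D \<in> sets borel" for D
    proof -
      have bD: "boole -` D \<in> sets borel" using measurable_sets[OF measurable_boole D] by simp
      have D2: "{..<boole c} \<inter> D \<in> sets borel" using D by auto
      have bD2: "boole -` ({..<boole c} \<inter> D) \<in> sets borel" using measurable_sets[OF measurable_boole D2] by simp
      have "{..<c} \<inter> boole -` D = (({..<0} \<inter> boole -` D) \<union> ({0<..} \<inter> boole -` ({..<boole c} \<inter> D))) \<union> ({0} \<inter> boole -` D)"
        using 3 boole_mono_pos by auto
      also have "?m \<dots> = ?m (({..<0} \<inter> boole -` D) \<union> ({0<..} \<inter> boole -` ({..<boole c} \<inter> D)))"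
        by (rule null) (intro sets.Un sets.Int bD bD2; simp)
      also have "\<dots> = ?m ({..<0} \<inter> boole -` D) + ?m ({0<..} \<inter> boole -` ({..<boole c} \<inter> D))"
        by (rule cauchy.finite_measure_Union) (auto intro!: sets.Int bD bD2[simplified])
      finally show ?thesis using D D2 by (simp only: measure_boole_neg measure_boole_pos)
    qed
    have c: "?m {..<c} = 1 / 2 + ?m {..<boole c} / 2" using *[of UNIV] cauchy.prob_space by simp
    \<comment> \<open>The full negative branch contributes \<open>z / 2\<close> both to the
      intersection and to the product and cancels; half of the defect of the shifted ray
      remains.\<close>
    have halve': "\<bar>z / 2 + x / 2 - (1 / 2 + y / 2) * z\<bar> = \<bar>x - y * z\<bar> / 2" for x y z :: real
      by (simp add: halve[symmetric]) (simp add: algebra_simps)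
    show ?thesis unfolding v *[OF B'] c mB' halve' using Suc.IH[of "boole c"] by (simp add: B'_def)
  qed
qed

section \<open>Mean ergodicity\<close>

locale measure_preserving_system = prob_space +
  fixes T :: "'a \<Rightarrow> 'a"
  assumes space_UNIV: "space M = UNIV"
    and measurable_T [measurable]: "T \<in> measurable M M"
    and distr_T: "distr M M T = M"
begin

lemma measurable_iterate [measurable]: "(T ^^ j) \<in> measurable M M"
  by (induction j) (auto intro: measurable_comp[OF _ measurable_T] simp: id_def)

lemma distr_iterate: "distr M M (T ^^ j) = M"
proof (induction j)
  case (Suc j)
  have "distr M M (T ^^ Suc j) = distr (distr M M (T ^^ j)) M T"
    by (subst distr_distr) auto
  thus ?case by (simp only: Suc distr_T)
qed (simp add: id_def distr_id)

lemma integrable_iterate: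
  fixes f :: "'a \<Rightarrow> 'b :: {banach, second_countable_topology}"
  assumes "integrable M f" shows "integrable M (\<lambda>x. f ((T ^^ j) x))"
  using assms by (intro integrable_distr[OF measurable_iterate[of j]]) (simp add: distr_iterate)

lemma integral_iterate:
  fixes f :: "'a \<Rightarrow> 'b :: {banach, second_countable_topology}"
  assumes [measurable]: "f \<in> borel_measurable M" shows "(\<integral>x. f ((T ^^ j) x) \<partial>M) = (\<integral>x. f x \<partial>M)"
proof -
  have "(\<integral>x. f ((T ^^ j) x) \<partial>M) = (\<integral>x. f x \<partial>distr M M (T ^^ j))"
    by (rule integral_distr[symmetric]) auto
  thus ?thesis by (simp add: distr_iterate)
qed

definition avg :: "('a \<Rightarrow> complex) \<Rightarrow> nat \<Rightarrow> 'a \<Rightarrow> complex" where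
  "avg f K x = (\<Sum>i<K. f ((T ^^ i) x)) / of_nat K"

definition avg_error :: "('a \<Rightarrow> complex) \<Rightarrow> nat \<Rightarrow> real" where
  "avg_error f K = (\<integral>x. norm (avg f K x - (\<integral>y. f y \<partial>M)) \<partial>M)"

definition mean_ergodic :: "('a \<Rightarrow> complex) \<Rightarrow> bool" where
  "mean_ergodic f \<longleftrightarrow> avg_error f \<longlonglongrightarrow> 0"

lemma avg_error_nonneg: "avg_error f K \<ge> 0"
  unfolding avg_error_def by (rule integral_nonneg_AE) auto

lemma integrable_avg: "integrable M f \<Longrightarrow> integrable M (avg f K)"
  unfolding avg_def
  by (intro integrable_divide_zero Bochner_Integration.integrable_sum integrable_iterate)

lemma avg_add: "avg (\<lambda>x. f x + g x) K x = avg f K x + avg g K x"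
  by (simp add: avg_def sum.distrib add_divide_distrib)

lemma norm_integral_avg_le:
  assumes "integrable M f"
  shows "(\<integral>x. norm (avg f K x) \<partial>M) \<le> (\<integral>x. norm (f x) \<partial>M)"
proof -
  have i: "integrable M (\<lambda>x. norm (f x))" using assms by simp
  have "(\<integral>x. norm (avg f K x) \<partial>M) \<le> (\<integral>x. (\<Sum>i<K. norm (f ((T ^^ i) x))) / real K \<partial>M)"
    using assms integrable_iterate[OF i]
    by (intro integral_mono integrable_norm integrable_avg)
       (auto simp: avg_def norm_divide intro!: divide_right_mono sum_norm_le)
  also have "\<dots> = (\<Sum>i<K. (\<integral>x. norm (f x) \<partial>M)) / real K"
    using integrable_iterate[OF i] integral_iterate[of "\<lambda>x. norm (f x)"] i
    by (subst integral_divide_zero, subst Bochner_Integration.integral_sum) auto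
  also have "\<dots> \<le> (\<integral>x. norm (f x) \<partial>M)"
    by (cases "K = 0") auto
  finally show ?thesis .
qed

lemma avg_error_add:
  assumes "integrable M f" "integrable M g"
  shows "avg_error (\<lambda>x. f x + g x) K \<le> avg_error f K + avg_error g K"
proof -
  have "avg_error (\<lambda>x. f x + g x) K \<le>
     (\<integral>x. norm (avg f K x - (\<integral>y. f y \<partial>M)) + norm (avg g K x - (\<integral>y. g y \<partial>M)) \<partial>M)"
    unfolding avg_error_def using assms
    by (intro integral_mono Bochner_Integration.integrable_add integrable_norm Bochner_Integration.integrable_diff integrable_avg)
       (auto simp: avg_add add_diff_add intro: norm_triangle_ineq)
  also have "\<dots> = avg_error f K + avg_error g K"
    unfolding avg_error_def using assms
    by (intro Bochner_Integration.integral_add integrable_norm Bochner_Integration.integrable_diff integrable_avg) auto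
  finally show ?thesis .
qed

lemma avg_error_le_norm:
  assumes "integrable M f"
  shows "avg_error f K \<le> 2 * (\<integral>x. norm (f x) \<partial>M)"
proof -
  have "avg_error f K \<le> (\<integral>x. norm (avg f K x) + norm (\<integral>y. f y \<partial>M) \<partial>M)"
    unfolding avg_error_def using assms
    by (intro integral_mono Bochner_Integration.integrable_add integrable_norm Bochner_Integration.integrable_diff integrable_avg)
       (auto intro: norm_triangle_ineq4)
  also have "\<dots> = (\<integral>x. norm (avg f K x) \<partial>M) + norm (\<integral>y. f y \<partial>M)"
    using assms integrable_avg[OF assms] by (subst Bochner_Integration.integral_add) (auto simp: prob_space)
  finally show ?thesis using norm_integral_avg_le[OF assms, of K] integral_norm_bound[of M f] by linarith
qed

lemma mean_ergodic_add:
  assumes "integrable M f" "integrable M g" "mean_ergodic f" "mean_ergodic g"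
  shows "mean_ergodic (\<lambda>x. f x + g x)"
  unfolding mean_ergodic_def
proof (rule tendsto_sandwich[OF _ _ tendsto_const])
  show "(\<lambda>K. avg_error f K + avg_error g K) \<longlonglongrightarrow> 0"
    using assms(3,4)[unfolded mean_ergodic_def] by (rule tendsto_add_zero)
qed (use avg_error_add[OF assms(1,2)] avg_error_nonneg in auto)

lemma mean_ergodic_mult:
  assumes "mean_ergodic f" shows "mean_ergodic (\<lambda>x. c * f x)"
proof -
  have "avg_error (\<lambda>x. c * f x) K = norm c * avg_error f K" for K
  proof -
    have "avg (\<lambda>x. c * f x) K x - (\<integral>y. c * f y \<partial>M) = c * (avg f K x - (\<integral>y. f y \<partial>M))" for x
      by (simp add: avg_def algebra_simps sum_distrib_left)
    thus ?thesis by (simp add: avg_error_def norm_mult)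
  qed
  hence "avg_error (\<lambda>x. c * f x) = (\<lambda>K. norm c * avg_error f K)" by auto
  thus ?thesis using assms unfolding mean_ergodic_def by (simp add: tendsto_mult_right_zero)
qed

lemma mean_ergodic_const: "mean_ergodic (\<lambda>x. c)"
proof -
  have "eventually (\<lambda>K. avg_error (\<lambda>x. c) K = 0) sequentially"
    using eventually_gt_at_top[of 0] by eventually_elim (simp add: avg_error_def avg_def prob_space)
  thus ?thesis unfolding mean_ergodic_def by (rule tendsto_eventually)
qed

text \<open>Averaging is a contraction in mean, so \<open>avg_error\<close> changes by at most twice
  the mean distance of the functions, uniformly in \<open>K\<close>.\<close>

lemma mean_ergodic_approx:
  assumes f: "integrable M f"
    and approx: "\<And>e. e > 0 \<Longrightarrow> \<exists>g. integrable M g \<and> mean_ergodic g \<and> (\<integral>x. norm (f x - g x) \<partial>M) \<le> e"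
  shows "mean_ergodic f"
  unfolding mean_ergodic_def
proof (rule LIMSEQ_I)
  fix e :: real assume e: "e > 0"
  from approx[of "e/4"] e obtain g where g: "integrable M g" "mean_ergodic g" "(\<integral>x. norm (f x - g x) \<partial>M) \<le> e / 4" by auto
  from g(2) e have "\<exists>no. \<forall>n\<ge>no. norm (avg_error g n - 0) < e/2"
    unfolding mean_ergodic_def by (intro LIMSEQ_D) auto
  then obtain no where no: "\<And>n. n \<ge> no \<Longrightarrow> norm (avg_error g n) < e / 2" by auto
  have "norm (avg_error f n - 0) < e" if "n \<ge> no" for n
  proof -
    have "avg_error (\<lambda>x. (f x - g x) + g x) n \<le> avg_error (\<lambda>x. f x - g x) n + avg_error g n"
      by (rule avg_error_add) (use f g in auto)
    moreover have "avg_error (\<lambda>x. f x - g x) n \<le> 2 * (\<integral>x. norm (f x - g x) \<partial>M)"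
      by (rule avg_error_le_norm) (use f g in auto)
    ultimately show ?thesis using g(3) no[OF that] avg_error_nonneg[of f n] by auto
  qed
  thus "\<exists>no. \<forall>n\<ge>no. norm (avg_error f n - 0) < e" by blast
qed

text \<open>Variance method: covariances at distance d are at most \<open>(1 / 2) ^ d\<close>, so
  the \<open>K^2\<close> of them sum to at most \<open>4 * K\<close>. The average has variance at
  most \<open>4 / K\<close>, and its mean deviation is at most the square root of that.\<close>

lemma mean_ergodic_indicator_correlation:
  assumes S [measurable]: "S \<in> sets M"
    and corr: "\<And>j. \<bar>prob (S \<inter> (T ^^ j) -` S) - prob S * prob S\<bar> \<le> (1 / 2) ^ j"
  shows "mean_ergodic (indicator S)"
proof -
  define p where "p = prob S"
  define h where "h = (\<lambda>i x. indicat_real S ((T ^^ i) x) - p)"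
  have hm [measurable]: "h i \<in> borel_measurable M" for i unfolding h_def by measurable
  have p01: "0 \<le> p" "p \<le> 1" by (auto simp: p_def)
  have hb: "\<bar>h i x\<bar> \<le> 1" for i x using p01 by (auto simp: h_def indicator_def)
  have hi: "integrable M (\<lambda>x. h i x * h j x)" for i j
    by (rule integrable_const_bound[where B = 1])
      (auto simp: abs_mult intro!: mult_le_one hb AE_I2)
  have vim: "(T ^^ j) -` S \<in> sets M" for j
    using measurable_sets[OF measurable_iterate S] by (simp add: space_UNIV)
  have cov: "\<bar>\<integral>x. h i x * h (i + d) x \<partial>M\<bar> \<le> (1/2) ^ d" for i d
  proof -
    define u where "u = (\<lambda>x. h 0 x * h d x)"
    have "(\<integral>x. h i x * h (i + d) x \<partial>M) = (\<integral>x. u ((T ^^ i) x) \<partial>M)"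
      by (simp add: u_def h_def funpow_add add.commute[of i])
    also have "\<dots> = (\<integral>x. u x \<partial>M)" by (rule integral_iterate) (simp add: u_def)
    also have "u = (\<lambda>x. indicat_real (S \<inter> (T ^^ d) -` S) x - p * indicat_real S x - p * indicat_real ((T ^^ d) -` S) x + p * p)"
      by (auto simp: u_def h_def algebra_simps indicator_def)
    also have "(\<integral>x. \<dots> x \<partial>M) = prob (S \<inter> (T ^^ d) -` S) - p * p - p * prob ((T ^^ d) -` S) + p * p"
      using vim[of d]
      by (simp add: prob_space p_def less_top[symmetric] emeasure_eq_measure sets.Int)
    also have "prob ((T ^^ d) -` S) = p"
    proof -
      have "measure (distr M M (T ^^ d)) S = prob ((T ^^ d) -` S \<inter> space M)"
        by (rule measure_distr) auto
      thus ?thesis by (simp add: distr_iterate p_def space_UNIV)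
    qed
    finally show ?thesis using corr[of d] by (simp add: p_def)
  qed
  \<comment> \<open>Of the truncated differences \<open>i - j\<close> and \<open>j - i\<close> one
    is always \<open>0\<close>; the product encodes the exponent \<open>\<bar>i - j\<bar>\<close>
    without a case distinction.\<close>
  have cov': "(\<integral>x. h i x * h j x \<partial>M) \<le> (1/2) ^ (i - j) * (1/2) ^ (j - i)" for i j
    using cov[of i "j - i"] cov[of j "i - j"]
    by (cases "i \<le> j") (auto simp: mult.commute)
  have geo: "(\<Sum>j<K. (1/2) ^ (i - j) * (1/2) ^ (j - i)) \<le> (4 :: real)" for K i
  proof -
    have g2: "(\<Sum>d\<in>A. (1/2) ^ d) \<le> (2 :: real)" if "finite A" for A
      using sum_le_suminf[OF complete_algebra_summable_geometric[of "1/2::real"] that] suminf_geometric[of "1/2::real"] by simp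
    have "(\<Sum>j<K. (1/2) ^ (i - j) * (1/2) ^ (j - i) :: real) \<le> (\<Sum>j\<in>{..i} \<union> {i..<i+K}. (1/2) ^ (i - j) * (1/2) ^ (j - i))"
      by (rule sum_mono2) auto
    also have "\<dots> \<le> (\<Sum>j\<in>{..i}. (1/2) ^ (i - j) * (1/2) ^ (j - i)) + (\<Sum>j\<in>{i..<i+K}. (1/2) ^ (i - j) * (1/2) ^ (j - i))"
      by (subst sum.union_inter[symmetric]) (auto intro!: sum_nonneg)
    also have "(\<Sum>j\<in>{..i}. (1/2) ^ (i - j) * (1/2) ^ (j - i) :: real) = (\<Sum>d\<in>{..i}. (1/2) ^ d)"
      by (rule sum.reindex_bij_witness[of _ "\<lambda>d. i - d" "\<lambda>j. i - j"]) auto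
    also have "(\<Sum>j\<in>{i..<i+K}. (1/2) ^ (i - j) * (1/2) ^ (j - i) :: real) = (\<Sum>d\<in>{..<K}. (1/2) ^ d)"
      by (rule sum.reindex_bij_witness[of _ "\<lambda>d. i + d" "\<lambda>j. j - i"]) auto
    finally show ?thesis using g2[of "{..i}"] g2[of "{..<K}"] by simp
  qed
  have bound: "avg_error (indicator S) K \<le> sqrt (4 / K)" if K: "K > 0" for K
  proof -
    define Y where "Y = (\<lambda>x. \<bar>(\<Sum>i<K. h i x) / K\<bar>)"
    have Y [measurable]: "Y \<in> borel_measurable M" unfolding Y_def by measurable
    have Yb: "\<bar>Y x\<bar> \<le> 1" for x
    proof -
      have "\<bar>\<Sum>i<K. h i x\<bar> \<le> (\<Sum>i<K. 1)" by (rule order_trans[OF sum_abs sum_mono]) (rule hb)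
      thus ?thesis using K by (simp add: Y_def)
    qed
    have iY: "integrable M Y" "integrable M (\<lambda>x. (Y x)\<^sup>2)"
      by (rule integrable_const_bound[where B = 1]; use Yb in \<open>auto simp: power_le_one abs_square_le_1\<close>)+
    have ci: "(indicator S :: 'a \<Rightarrow> complex) = (\<lambda>x. of_real (indicat_real S x))"
      by (auto simp: indicator_def)
    have "(\<integral>y. indicator S y \<partial>M) = complex_of_real (\<integral>y. indicat_real S y \<partial>M)"
      unfolding ci by (rule integral_complex_of_real)
    hence "(\<integral>y. indicator S y \<partial>M) = complex_of_real p" by (simp add: p_def)
    moreover have "avg (indicator S) K x - complex_of_real p = of_real ((\<Sum>i<K. h i x) / K)" for x
      using K unfolding ci avg_def h_def
      by (simp del: of_real_indicator add: sum_subtractf diff_divide_distrib)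
    ultimately have "avg (indicator S) K x - (\<integral>y. indicator S y \<partial>M) = of_real ((\<Sum>i<K. h i x) / K)" for x
      by simp
    hence err: "avg_error (indicator S) K = (\<integral>x. Y x \<partial>M)"
      unfolding avg_error_def Y_def by (simp only: norm_of_real)
    \<comment> \<open>Nonnegativity of the variance of \<open>Y\<close> serves as the Cauchy-Schwarz
      inequality.\<close>
    have "(\<integral>x. Y x \<partial>M)\<^sup>2 \<le> (\<integral>x. (Y x)\<^sup>2 \<partial>M)"
      using variance_eq[OF iY] variance_positive[of Y] by simp
    also have "(\<lambda>x. (Y x)\<^sup>2) = (\<lambda>x. (\<Sum>i<K. \<Sum>j<K. h i x * h j x) / (real K)\<^sup>2)"
      by (simp add: Y_def power_divide power2_eq_square sum_product)
    also have "(\<integral>x. \<dots> x \<partial>M) = (\<Sum>i<K. \<Sum>j<K. (\<integral>x. h i x * h j x \<partial>M)) / (real K)\<^sup>2"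
      using hi by (simp add: Bochner_Integration.integral_sum)
    also have "\<dots> \<le> (\<Sum>i<K. 4) / (real K)\<^sup>2"
      by (intro divide_right_mono sum_mono order_trans[OF sum_mono[OF cov'] geo]) auto
    also have "\<dots> = 4 / K" by (simp add: power2_eq_square)
    finally show ?thesis unfolding err by (rule real_le_rsqrt)
  qed
  show ?thesis unfolding mean_ergodic_def
  proof (rule tendsto_sandwich[OF _ _ tendsto_const])
    have "(\<lambda>K. sqrt (4 / real K)) \<longlonglongrightarrow> sqrt 0"
      by (intro tendsto_real_sqrt tendsto_divide_0[OF tendsto_const] filterlim_real_sequentially[THEN filterlim_at_top_imp_at_infinity])
    thus "(\<lambda>K. sqrt (4 / real K)) \<longlonglongrightarrow> 0" by simp
    show "eventually (\<lambda>K. avg_error (indicator S) K \<le> sqrt (4 / K)) sequentially"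
      using eventually_gt_at_top[of 0] by eventually_elim (rule bound)
  qed (use avg_error_nonneg in auto)
qed

text \<open>The rate of decay is needed on the generators alone. Mean ergodicity, unlike a rate,
  survives linear combinations and limits in mean. Hence it passes through complements and disjoint
  unions to the whole \<sigma>-algebra, and from there to integrable functions.\<close>

lemma mean_ergodic_integrable:
  assumes G: "Int_stable G" "G \<subseteq> Pow (space M)" "sets M = sigma_sets (space M) G"
    and corr: "\<And>S j. S \<in> G \<Longrightarrow> \<bar>prob (S \<inter> (T ^^ j) -` S) - prob S * prob S\<bar> \<le> (1 / 2) ^ j"
    and f: "integrable M f"
  shows "mean_ergodic f"
proof -
  have int_ind: "integrable M (indicator S :: 'a \<Rightarrow> complex)" if "S \<in> sets M" for S
    using that by (intro integrable_const_bound[where B = 1]) (auto simp: indicator_def)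
  have ind: "mean_ergodic (indicator S)" if "S \<in> sigma_sets (space M) G" for S
    using G(1,2) that
  proof (induction rule: sigma_sets_induct_disjoint)
    case (basic S)
    thus ?case using G(3) by (intro mean_ergodic_indicator_correlation corr) auto
  next
    case empty
    show ?case using mean_ergodic_const[of 0] by (simp add: indicator_def[abs_def])
  next
    case (compl A)
    have "A \<in> sets M" using compl G by simp
    hence "mean_ergodic (\<lambda>x. 1 + (-1) * indicator A x)"
      using compl int_ind by (intro mean_ergodic_add mean_ergodic_mult mean_ergodic_const) auto
    also have "(\<lambda>x. 1 + (-1) * indicator A x) = (indicator (space M - A) :: 'a \<Rightarrow> complex)"
      by (auto simp: indicator_def space_UNIV)
    finally show ?case .
  next
    case (union A)
    have A: "A i \<in> sets M" for i using union G by auto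
    have fin: "mean_ergodic (indicator (\<Union>i<n. A i))" for n
    proof (induction n)
      case 0
      show ?case using mean_ergodic_const[of 0] by (simp add: indicator_def[abs_def])
    next
      case (Suc n)
      have "(\<lambda>x. indicator (\<Union>i<n. A i) x + indicator (A n) x) = (indicator (\<Union>i<Suc n. A i) :: 'a \<Rightarrow> complex)"
      proof -
        have "A n \<inter> A i = {}" if "i < n" for i
          using union(1) that by (auto simp: disjoint_family_on_def)
        hence "A n \<inter> (\<Union>i<n. A i) = {}" by blast
        moreover have "(\<Union>i<Suc n. A i) = (\<Union>i<n. A i) \<union> A n" by (auto simp: lessThan_Suc)
        ultimately show ?thesis by (auto simp: indicator_def fun_eq_iff)
      qed
      thus ?case using mean_ergodic_add[OF int_ind int_ind Suc union(3)[of n]] A by auto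
    qed
    have U: "(\<Union>i. A i) \<in> sets M" and Un: "(\<Union>i<n. A i) \<in> sets M" for n using A by auto
    show ?case
    proof (rule mean_ergodic_approx[OF int_ind[OF U]])
      fix e :: real assume e: "e > 0"
      have "(\<lambda>n. prob (\<Union>i<n. A i)) \<longlonglongrightarrow> prob (\<Union>n. \<Union>i<n. A i)"
      proof (rule finite_Lim_measure_incseq)
        show "incseq (\<lambda>n. \<Union>i<n. A i)" by (intro monoI UN_mono) auto
      qed (use Un in auto)
      also have "(\<Union>n. \<Union>i<n. A i) = (\<Union>i. A i)" by auto
      finally obtain n where n: "\<bar>prob (\<Union>i<n. A i) - prob (\<Union>i. A i)\<bar> < e"
        using LIMSEQ_D[OF _ e] by (metis order_refl real_norm_def)
      have "(\<integral>x. norm (indicator (\<Union>i. A i) x - indicator (\<Union>i<n. A i) x :: complex) \<partial>M) =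
        (\<integral>x. indicator ((\<Union>i. A i) - (\<Union>i<n. A i)) x \<partial>M)"
        by (rule Bochner_Integration.integral_cong) (auto simp: indicator_def)
      also have "\<dots> = prob ((\<Union>i. A i) - (\<Union>i<n. A i))" using U Un by simp
      also have "\<dots> = prob (\<Union>i. A i) - prob (\<Union>i<n. A i)"
        by (rule finite_measure_Diff) (use U Un in auto)
      finally show "\<exists>g. integrable M g \<and> mean_ergodic g \<and> (\<integral>x. norm (indicator (\<Union>i. A i) x - g x) \<partial>M) \<le> e"
        using fin[of n] int_ind[OF Un[of n]] n by (intro exI[of _ "indicator (\<Union>i<n. A i)"]) auto
    qed
  qed
  show ?thesis using f
  proof (induction rule: integrable_induct)
    case (base A c)
    thus ?case using mean_ergodic_mult[OF ind[of A], of c] G(3)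
      by (simp add: scaleR_conv_of_real mult.commute of_real_indicator)
  next
    case (add f g)
    thus ?case by (intro mean_ergodic_add)
  next
    case (lim f s)
    have si: "integrable M (s i)" and sm: "mean_ergodic (s i)" and fi: "integrable M f" for i by fact+
    have conv: "(\<lambda>i. s i x) \<longlonglongrightarrow> f x" and bd: "norm (s i x) \<le> 2 * norm (f x)" for i x
      using lim.hyps by (auto simp: space_UNIV)
    show ?case
    proof (rule mean_ergodic_approx[OF fi])
      fix e :: real assume e: "e > 0"
      have [measurable]: "f \<in> borel_measurable M" "s i \<in> borel_measurable M" for i using si fi by auto
      have "(\<lambda>i. \<integral>x. norm (f x - s i x) \<partial>M) \<longlonglongrightarrow> (\<integral>x. 0 \<partial>M)"
      proof (rule integral_dominated_convergence[where w = "\<lambda>x. 3 * norm (f x)"])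
        show "AE x in M. (\<lambda>i. norm (f x - s i x)) \<longlonglongrightarrow> 0"
          using conv by (intro AE_I2 tendsto_norm_zero) (auto intro!: tendsto_eq_intros)
        have "norm (f x - s i x) \<le> 3 * norm (f x)" for x i
          using norm_triangle_ineq4[of "f x" "s i x"] bd[of i x] by simp
        thus "AE x in M. norm (norm (f x - s i x)) \<le> 3 * norm (f x)" for i by simp
      qed (use si fi in auto)
      then obtain n where "norm ((\<integral>x. norm (f x - s n x) \<partial>M) - (\<integral>x. 0 \<partial>M)) < e"
        using LIMSEQ_D[OF _ e] by blast
      thus "\<exists>g. integrable M g \<and> mean_ergodic g \<and> (\<integral>x. norm (f x - g x) \<partial>M) \<le> e"
        using si sm by (intro exI[of _ "s n"]) auto
    qed
  qed
qed

end

section \<open>Moving averages along Stoltz sequences\<close>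

text \<open>Vitali's greedy selection: keep a window of maximal length, discard all that meet it,
  and continue with the rest. By maximality a discarded window is never longer than the one it is
  charged to.\<close>

lemma disjoint_subfamily_of_windows:
  fixes W :: "'i \<Rightarrow> 'b set" and k :: "'i \<Rightarrow> nat"
  assumes "finite E" and "\<And>i. i \<in> E \<Longrightarrow> W i \<noteq> {}"
  shows "\<exists>S\<subseteq>E. disjoint_family_on W S \<and> (\<forall>i\<in>E. \<exists>l\<in>S. W i \<inter> W l \<noteq> {} \<and> k i \<le> k l)"
  using assms
proof (induction "card E" arbitrary: E rule: less_induct)
  case less
  show ?case
  proof (cases "E = {}")
    case False
    define m where "m = Max (k ` E)"
    have "m \<in> k ` E" unfolding m_def using less.prems False by (intro Max_in) auto
    then obtain i0 where i0: "i0 \<in> E" "k i0 = m" by auto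
    have max: "k i \<le> k i0" if "i \<in> E" for i using that less.prems i0 by (simp add: m_def)
    define E' where "E' = {i \<in> E. W i \<inter> W i0 = {}}"
    have "i0 \<notin> E'" using less.prems i0 by (auto simp: E'_def)
    hence "E' \<subset> E" using i0 by (auto simp: E'_def)
    hence "card E' < card E" using less.prems by (intro psubset_card_mono) auto
    from less.hyps[OF this] obtain S where S: "S \<subseteq> E'" "disjoint_family_on W S"
      "\<forall>i\<in>E'. \<exists>l\<in>S. W i \<inter> W l \<noteq> {} \<and> k i \<le> k l"
      using less.prems by (auto simp: E'_def)
    have "disjoint_family_on W (insert i0 S)"
      using S(1,2) unfolding disjoint_family_on_def E'_def by blast
    moreover have "\<forall>i\<in>E. \<exists>l\<in>insert i0 S. W i \<inter> W l \<noteq> {} \<and> k i \<le> k l"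
      using S(3) max unfolding E'_def by blast
    moreover have "insert i0 S \<subseteq> E" using i0 S(1) by (auto simp: E'_def)
    ultimately show ?thesis by blast
  qed (auto simp: disjoint_family_on_def)
qed

text \<open>Reading the cone section at height \<open>K + \<lceil>K / \<alpha>\<^sub>0\<rceil> + 1\<close> backwards from \<open>p\<close> captures every
  window of length at most \<open>K\<close> that starts within distance \<open>K\<close> of \<open>p\<close>.\<close>

definition window_starts :: "(nat \<Rightarrow> nat) \<Rightarrow> (nat \<Rightarrow> nat) \<Rightarrow> nat \<Rightarrow> nat \<Rightarrow> nat \<Rightarrow> nat set" where
  "window_starts n k q\<^sub>0 p K = {i. \<exists>q\<ge>q\<^sub>0. k q \<le> K \<and> \<bar>int p - int (i + n q)\<bar> \<le> int K}"

text \<open>The cone condition as a counting statement at all places \<open>p\<close> and scales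
  \<open>K\<close>. The index \<open>q\<^sub>0\<close> drops the finitely many initial pairs that
  need not lie in the truncated set or have positive length.\<close>

definition stoltz_bound :: "(nat \<Rightarrow> nat) \<Rightarrow> (nat \<Rightarrow> nat) \<Rightarrow> nat \<Rightarrow> real \<Rightarrow> bool" where
  "stoltz_bound n k q\<^sub>0 C \<longleftrightarrow> C > 0 \<and> (\<forall>q\<ge>q\<^sub>0. k q > 0) \<and>
     (\<forall>p K. K > 0 \<longrightarrow> finite (window_starts n k q\<^sub>0 p K) \<and> real (card (window_starts n k q\<^sub>0 p K)) \<le> C * real K)"

lemma stoltz_imp_bound:
  assumes "stoltz n k"
  shows "filterlim k at_top sequentially" "\<exists>q\<^sub>0 C. stoltz_bound n k q\<^sub>0 C"
proof -
  from assms obtain Z h h0 \<alpha> A where h: "filterlim h at_top sequentially"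
    and Z: "\<And>t l. t \<ge> 1 \<Longrightarrow> l \<ge> t \<Longrightarrow> (int (n l), k l) \<in> trunc_set Z (h t)"
    and \<alpha>: "\<alpha> > 0" and A: "A > 0"
    and fin: "\<And>l. l > 0 \<Longrightarrow> finite (cone_section Z h0 \<alpha> l)"
    and card: "\<And>l. l > 0 \<Longrightarrow> real (card (cone_section Z h0 \<alpha> l)) \<le> A * real_of_int l"
    unfolding stoltz_def by blast
  \<comment> \<open>The membership condition at \<open>t = l\<close> forces the lengths to infinity
    along with \<open>h\<close>.\<close>
  have kh: "real (k l) \<ge> h l" if "l \<ge> 1" for l using Z[of l l] that by (auto simp: trunc_set_def)
  have "filterlim (\<lambda>l. real (k l)) at_top sequentially"
    by (rule filterlim_at_top_mono[OF h]) (use kh in \<open>auto simp: eventually_at_top_linorder intro!: exI[of _ 1]\<close>)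
  thus klim: "filterlim k at_top sequentially"
    by (simp add: filterlim_sequentially_iff_filterlim_real)
  have "eventually (\<lambda>t. h t \<ge> max h0 1) sequentially" using h unfolding filterlim_at_top by blast
  then obtain t where t: "t \<ge> 1" "h t \<ge> h0" "h t \<ge> 1"
    unfolding eventually_at_top_linorder by (metis max.bounded_iff max.cobounded1 max.cobounded2)
  have inZ: "(int (n l), k l) \<in> trunc_set Z h0" and kpos: "k l > 0" if "l \<ge> t" for l
    using Z[OF t(1) that] t(2,3) by (auto simp: trunc_set_def)
  \<comment> \<open>The height used below is at most \<open>K + K / \<alpha> + 2\<close>, and
    \<open>2 \<le> 2 * K\<close>.\<close>
  define C where "C = A * (3 + 1 / \<alpha>)"
  have "stoltz_bound n k t C" unfolding stoltz_bound_def
  proof (intro conjI allI impI)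
    show "C > 0" using A \<alpha> by (auto simp: C_def intro!: mult_pos_pos add_pos_pos)
  next
    fix p K :: nat assume K: "K > 0"
    define l where "l = int K + \<lceil>real K / \<alpha>\<rceil> + 1"
    have "real K / \<alpha> \<ge> 0" using \<alpha> by simp
    hence l0: "l > 0" unfolding l_def by linarith
    have "(\<lambda>i. int p - int i) ` window_starts n k t p K \<subseteq> cone_section Z h0 \<alpha> l"
    proof clarify
      fix i assume "i \<in> window_starts n k t p K"
      then obtain q where q: "q \<ge> t" "k q \<le> K" "\<bar>int p - int (i + n q)\<bar> \<le> int K"
        by (auto simp: window_starts_def)
      have "real K / \<alpha> < real_of_int l - real (k q)" unfolding l_def using q(2) by linarith
      hence "real K < \<alpha> * (real_of_int l - real (k q))" using \<alpha> by (simp add: field_simps)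
      moreover have "real_of_int \<bar>int p - int i - int (n q)\<bar> \<le> real K"
        using q(3) by linarith
      ultimately have "real_of_int \<bar>int p - int i - int (n q)\<bar> < \<alpha> * (real_of_int l - real (k q))" by linarith
      thus "int p - int i \<in> cone_section Z h0 \<alpha> l"
        unfolding cone_section_def cone_set_def by (auto intro!: bexI[OF _ inZ[OF q(1)]])
    qed
    moreover have inj: "inj_on (\<lambda>i. int p - int i) (window_starts n k t p K)" by (auto simp: inj_on_def)
    ultimately have f: "finite (window_starts n k t p K)" and c: "card (window_starts n k t p K) \<le> card (cone_section Z h0 \<alpha> l)"
      using fin[OF l0] by (auto intro: inj_on_finite card_inj_on_le)
    show "finite (window_starts n k t p K)" by (rule f)
    have "real_of_int l \<le> real K + real K / \<alpha> + 2" unfolding l_def by linarith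
    also have "\<dots> \<le> (3 + 1 / \<alpha>) * real K" using K by (simp add: algebra_simps)
    finally have "A * real_of_int l \<le> C * real K" using A unfolding C_def by (simp add: mult.assoc)
    thus "real (card (window_starts n k t p K)) \<le> C * real K" using c card[OF l0] by linarith
  qed (use kpos in auto)
  thus "\<exists>q\<^sub>0 C. stoltz_bound n k q\<^sub>0 C" by blast
qed

text \<open>The covering argument along one orbit, with \<phi> the values of the function there.
  Every bad starting point is charged to a selected window of length at least its own. By the
  counting bound a selected window carries at most \<open>C\<close> times its length, and
  disjointness adds the windows up without overlap.\<close>

lemma maximal_inequality_nat:
  fixes \<phi> :: "nat \<Rightarrow> real"
  assumes sb: "stoltz_bound n k q\<^sub>0 C" and \<phi>: "\<And>m. \<phi> m \<ge> 0" and t: "t > 0"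
    and E: "E \<subseteq> {..<L}"
    and big: "\<And>i. i \<in> E \<Longrightarrow> \<exists>q\<ge>q\<^sub>0. n q + k q \<le> R \<and> t * real (k q) < (\<Sum>j=1..k q. \<phi> (i + (n q + j)))"
  shows "t * real (card E) \<le> C * (\<Sum>m\<le>L + R. \<phi> m)"
proof -
  from big obtain Q where Q: "\<And>i. i \<in> E \<Longrightarrow> Q i \<ge> q\<^sub>0" "\<And>i. i \<in> E \<Longrightarrow> n (Q i) + k (Q i) \<le> R"
    "\<And>i. i \<in> E \<Longrightarrow> t * real (k (Q i)) < (\<Sum>j=1..k (Q i). \<phi> (i + (n (Q i) + j)))" by metis
  have C: "C > 0" and kpos: "\<And>i. i \<in> E \<Longrightarrow> k (Q i) > 0"
    and cnt: "\<And>p K. K > 0 \<Longrightarrow> finite (window_starts n k q\<^sub>0 p K)"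
      "\<And>p K. K > 0 \<Longrightarrow> real (card (window_starts n k q\<^sub>0 p K)) \<le> C * real K"
    using sb Q(1) by (auto simp: stoltz_bound_def)
  define W where "W = (\<lambda>i. {i + n (Q i) <.. i + n (Q i) + k (Q i)})"
  have finE: "finite E" using E finite_subset by blast
  obtain S where S: "S \<subseteq> E" "disjoint_family_on W S"
    "\<And>i. i \<in> E \<Longrightarrow> \<exists>l\<in>S. W i \<inter> W l \<noteq> {} \<and> k (Q i) \<le> k (Q l)"
    using disjoint_subfamily_of_windows[OF finE, of W "\<lambda>i. k (Q i)"] kpos by (fastforce simp: W_def)
  have finS: "finite S" using S(1) finE finite_subset by blast
  define D where "D = (\<lambda>l. window_starts n k q\<^sub>0 (l + n (Q l)) (k (Q l)))"
  have "E \<subseteq> (\<Union>l\<in>S. D l)"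
  proof
    fix i assume i: "i \<in> E"
    from S(3)[OF i] obtain l m where l: "l \<in> S" "k (Q i) \<le> k (Q l)" "m \<in> W i" "m \<in> W l" by auto
    \<comment> \<open>If two windows meet, their left ends differ by less than the greater
      length.\<close>
    hence "i \<in> D l" unfolding D_def window_starts_def W_def using Q(1)[OF i] by (auto intro!: exI[of _ "Q i"])
    thus "i \<in> (\<Union>l\<in>S. D l)" using l(1) by auto
  qed
  hence "card E \<le> card (\<Union>l\<in>S. D l)"
    using finS cnt(1) kpos S(1) by (intro card_mono) (auto simp: D_def)
  also have "\<dots> \<le> (\<Sum>l\<in>S. card (D l))" by (rule card_UN_le[OF finS])
  finally have "real (card E) \<le> (\<Sum>l\<in>S. real (card (D l)))" by (metis of_nat_le_iff of_nat_sum)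
  also have "\<dots> \<le> (\<Sum>l\<in>S. C * real (k (Q l)))"
    using kpos S(1) by (intro sum_mono) (auto simp: D_def intro!: cnt(2))
  finally have "t * real (card E) \<le> t * (\<Sum>l\<in>S. C * real (k (Q l)))" using t by simp
  also have "\<dots> = C * (\<Sum>l\<in>S. t * real (k (Q l)))" by (simp add: sum_distrib_left mult_ac)
  also have "\<dots> \<le> C * (\<Sum>l\<in>S. \<Sum>m\<in>W l. \<phi> m)"
  proof (intro mult_left_mono sum_mono)
    fix l assume "l \<in> S"
    hence "l \<in> E" using S(1) by auto
    have "(\<Sum>m\<in>W l. \<phi> m) = (\<Sum>j=1..k (Q l). \<phi> (l + (n (Q l) + j)))"
      unfolding W_def by (rule sum.reindex_bij_witness[of _ "\<lambda>j. l + (n (Q l) + j)" "\<lambda>m. m - l - n (Q l)"]) auto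
    thus "t * real (k (Q l)) \<le> (\<Sum>m\<in>W l. \<phi> m)" using Q(3)[OF \<open>l \<in> E\<close>] by simp
  qed (use C in auto)
  also have "(\<Sum>l\<in>S. \<Sum>m\<in>W l. \<phi> m) = (\<Sum>m\<in>(\<Union>l\<in>S. W l). \<phi> m)"
    using S(2) finS by (subst sum.UNION_disjoint) (auto simp: W_def disjoint_family_on_def)
  also have "C * \<dots> \<le> C * (\<Sum>m\<le>L + R. \<phi> m)"
  proof (intro mult_left_mono sum_mono2)
    show "(\<Union>l\<in>S. W l) \<subseteq> {..L + R}"
    proof clarify
      fix l m assume "l \<in> S" "m \<in> W l"
      moreover from this have "l \<in> E" using S(1) by auto
      ultimately show "m \<le> L + R" using Q(2)[of l] E by (fastforce simp: W_def)
    qed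
  qed (use C \<phi> in auto)
  finally show ?thesis .
qed

section \<open>The weak type inequality and its use for convergence\<close>

context measure_preserving_system begin

text \<open>Transference: the orbit inequality is integrated over the space, where invariance makes
  all summands equal. The boundary costs only the factor \<open>(L + R + 1) / L\<close>, which tends
  to 1 as \<open>L\<close> grows.\<close>

lemma maximal_inequality:
  fixes f :: "'a \<Rightarrow> real"
  assumes sb: "stoltz_bound n k q\<^sub>0 C" and f: "integrable M f" and f0: "\<And>x. f x \<ge> 0" and t: "t > 0"
  shows "t * prob {x. \<exists>q\<ge>q\<^sub>0. t * real (k q) < (\<Sum>j=1..k q. f ((T ^^ (n q + j)) x))} \<le> C * (\<integral>x. f x \<partial>M)"
proof -
  \<comment> \<open>Truncation by \<open>R\<close> keeps all windows from starting points below
    \<open>L\<close> inside \<open>{..L + R}\<close>; the union over \<open>R\<close> is taken at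
    the end.\<close>
  define E where "E = (\<lambda>R. {x. \<exists>q\<ge>q\<^sub>0. n q + k q \<le> R \<and> t * real (k q) < (\<Sum>j=1..k q. f ((T ^^ (n q + j)) x))})"
  have [measurable]: "f \<in> borel_measurable M" using f by auto
  have Em [measurable]: "E R \<in> sets M" for R
  proof -
    have "{x \<in> space M. \<exists>q\<in>{q. q\<ge>q\<^sub>0 \<and> n q + k q \<le> R}. t * real (k q) < (\<Sum>j=1..k q. f ((T ^^ (n q + j)) x))} \<in> sets M"
      by measurable
    thus ?thesis by (simp add: E_def space_UNIV)
  qed
  have C: "C > 0" using sb by (simp add: stoltz_bound_def)
  have bound: "t * prob (E R) \<le> C * (\<integral>x. f x \<partial>M)" for R
  proof -
    have main: "real L * (t * prob (E R)) \<le> real (L + R + 1) * (C * (\<integral>x. f x \<partial>M))" for L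
    proof -
      have 1: "t * (\<Sum>i<L. indicat_real (E R) ((T ^^ i) x)) \<le> C * (\<Sum>m\<le>L + R. f ((T ^^ m) x))" for x
      proof -
        have "t * real (card {i\<in>{..<L}. (T ^^ i) x \<in> E R}) \<le> C * (\<Sum>m\<le>L + R. f ((T ^^ m) x))"
        proof (rule maximal_inequality_nat[OF sb _ t])
          fix i assume "i \<in> {i\<in>{..<L}. (T ^^ i) x \<in> E R}"
          thus "\<exists>q\<ge>q\<^sub>0. n q + k q \<le> R \<and> t * real (k q) < (\<Sum>j=1..k q. f ((T ^^ (i + (n q + j))) x))"
            by (auto simp: E_def add.commute[of i] funpow_add)
        qed (use f0 in auto)
        also have "real (card {i\<in>{..<L}. (T ^^ i) x \<in> E R}) = (\<Sum>i<L. indicat_real (E R) ((T ^^ i) x))"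
          by (simp add: indicator_def sum.If_cases Int_def)
        finally show ?thesis .
      qed
      have int1: "integrable M (\<lambda>x. indicat_real (E R) ((T ^^ i) x))" for i
        by (rule integrable_iterate) (simp add: emeasure_eq_measure)
      have int2: "integrable M (\<lambda>x. f ((T ^^ i) x))" for i by (rule integrable_iterate[OF f])
      have "(\<integral>x. t * (\<Sum>i<L. indicat_real (E R) ((T ^^ i) x)) \<partial>M) \<le> (\<integral>x. C * (\<Sum>m\<le>L + R. f ((T ^^ m) x)) \<partial>M)"
        by (intro integral_mono integrable_mult_right Bochner_Integration.integrable_sum int1 int2 1)
      also have "(\<integral>x. t * (\<Sum>i<L. indicat_real (E R) ((T ^^ i) x)) \<partial>M) = t * (\<Sum>i<L. (\<integral>x. indicat_real (E R) x \<partial>M))"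
        using int1 integral_iterate[of "indicat_real (E R)"] by (simp add: Bochner_Integration.integral_sum)
      also have "(\<integral>x. C * (\<Sum>m\<le>L + R. f ((T ^^ m) x)) \<partial>M) = C * (\<Sum>m\<le>L + R. (\<integral>x. f x \<partial>M))"
        using int2 integral_iterate[of f] by (simp add: Bochner_Integration.integral_sum)
      finally show ?thesis by (simp add: mult_ac)
    qed
    show ?thesis
    proof (rule ccontr)
      assume neg: "\<not> ?thesis"
      define a b where "a = t * prob (E R)" and "b = C * (\<integral>x. f x \<partial>M)"
      have ab: "a > b" using neg by (simp add: a_def b_def)
      obtain L :: nat where "real L > real (R + 1) * b / (a - b)" using reals_Archimedean2 by blast
      hence "real L * (a - b) > real (R + 1) * b" using ab by (simp add: field_simps)
      thus False using main[of L, folded a_def b_def] by (simp add: algebra_simps)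
    qed
  qed
  have "(\<lambda>R. prob (E R)) \<longlonglongrightarrow> prob (\<Union>R. E R)"
  proof (rule finite_Lim_measure_incseq)
    show "incseq E" unfolding incseq_def E_def by (auto intro: order_trans)
  qed (use Em in auto)
  hence "(\<lambda>R. t * prob (E R)) \<longlonglongrightarrow> t * prob (\<Union>R. E R)" by (intro tendsto_intros)
  hence "t * prob (\<Union>R. E R) \<le> C * (\<integral>x. f x \<partial>M)"
    by (rule LIMSEQ_le_const2) (use bound in auto)
  also have "(\<Union>R. E R) = {x. \<exists>q\<ge>q\<^sub>0. t * real (k q) < (\<Sum>j=1..k q. f ((T ^^ (n q + j)) x))}"
    by (auto simp: E_def)
  finally show ?thesis .
qed

definition window_avg :: "('a \<Rightarrow> complex) \<Rightarrow> nat \<Rightarrow> nat \<Rightarrow> 'a \<Rightarrow> complex" where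
  "window_avg f n k x = 1 / of_nat k * (\<Sum>j=1..k. f ((T ^^ (n + j)) x))"

lemma window_avg_add: "window_avg (\<lambda>x. f x + g x) n k x = window_avg f n k x + window_avg g n k x"
  by (simp add: window_avg_def sum.distrib algebra_simps)

lemma window_avg_const: "k > 0 \<Longrightarrow> window_avg (\<lambda>x. c) n k x = c"
  by (simp add: window_avg_def)

lemma window_avg_coboundary: "window_avg (\<lambda>x. u x - u (T x)) n k x = 1 / of_nat k * (u ((T ^^ (n + 1)) x) - u ((T ^^ (n + k + 1)) x))"
proof -
  have "(\<Sum>j=1..k. u ((T ^^ (n + j)) x) - u (T ((T ^^ (n + j)) x))) = u ((T ^^ (n + 1)) x) - u ((T ^^ (n + k + 1)) x)"
    by (induction k) auto
  thus ?thesis by (simp only: window_avg_def)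
qed

text \<open>The Birkhoff sum \<open>v i\<close> solves the coboundary equation for \<open>g\<close>
  minus its \<open>i\<close>-th iterate. Averaging the solutions over \<open>i < K\<close> solves it
  for \<open>g - avg g K\<close>.\<close>

lemma bounded_minus_avg_coboundary:
  assumes g: "\<And>x. norm (g x) \<le> B" and K: "K > 0"
  shows "\<exists>u. (\<forall>x. norm (u x) \<le> real K * B) \<and> (\<forall>x. g x - avg g K x = u x - u (T x))"
proof -
  define v where "v = (\<lambda>i x. \<Sum>l<i. g ((T ^^ l) x))"
  define u where "u = (\<lambda>x. (\<Sum>i<K. v i x) / of_nat K)"
  have B: "B \<ge> 0" using norm_ge_zero[of "g undefined"] g[of undefined] by linarith
  have "g x - avg g K x = u x - u (T x) \<and> norm (u x) \<le> real K * B" for x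
  proof
    have vT: "v i x - v i (T x) = g x - g ((T ^^ i) x)" for i
    proof -
      have "v i x - v i (T x) = (\<Sum>l<i. g ((T ^^ l) x) - g ((T ^^ Suc l) x))"
        by (simp add: v_def sum_subtractf funpow_swap1)
      also have "\<dots> = g x - g ((T ^^ i) x)" by (subst sum_lessThan_telescope') simp
      finally show ?thesis .
    qed
    have "u x - u (T x) = (\<Sum>i<K. v i x - v i (T x)) / of_nat K"
      by (simp add: u_def sum_subtractf diff_divide_distrib)
    also have "\<dots> = g x - avg g K x"
      unfolding vT using K by (simp add: avg_def sum_subtractf diff_divide_distrib)
    finally show "g x - avg g K x = u x - u (T x)" by simp
    have "norm (v i x) \<le> real K * B" if "i < K" for i
    proof -
      have "norm (v i x) \<le> (\<Sum>l<i. B)" unfolding v_def by (rule sum_norm_le) (rule g)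
      also have "\<dots> \<le> real K * B" using that B by (simp add: mult_right_mono)
      finally show ?thesis .
    qed
    hence "norm (\<Sum>i<K. v i x) \<le> (\<Sum>i<K. real K * B)" by (intro sum_norm_le) auto
    thus "norm (u x) \<le> real K * B" using K by (simp add: u_def norm_divide divide_le_eq mult_ac)
  qed
  thus ?thesis by blast
qed

lemma integrable_bounded_approx:
  fixes f :: "'a \<Rightarrow> complex"
  assumes f: "integrable M f" and e: "e > 0"
  obtains g B where "integrable M g" "\<And>x. norm (g x) \<le> B" "(\<integral>x. norm (f x - g x) \<partial>M) < e"
proof -
  define s where "s = (\<lambda>(m::nat) x. if norm (f x) \<le> real m then f x else 0)"
  have [measurable]: "f \<in> borel_measurable M" using f by auto
  have sm [measurable]: "s m \<in> borel_measurable M" for m unfolding s_def by measurable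
  have si: "integrable M (s m)" for m
    by (rule Bochner_Integration.integrable_bound[OF f]) (auto simp: s_def)
  have "(\<lambda>m. \<integral>x. norm (f x - s m x) \<partial>M) \<longlonglongrightarrow> (\<integral>x. 0 \<partial>M)"
  proof (rule integral_dominated_convergence[where w = "\<lambda>x. norm (f x)"])
    show "AE x in M. (\<lambda>m. norm (f x - s m x)) \<longlonglongrightarrow> 0"
    proof (rule AE_I2)
      fix x
      obtain N :: nat where "norm (f x) \<le> real N" using real_arch_simple by blast
      hence "norm (f x - s m x) = 0" if "m \<ge> N" for m using that by (auto simp: s_def)
      thus "(\<lambda>m. norm (f x - s m x)) \<longlonglongrightarrow> 0"
        by (intro tendsto_eventually) (auto simp: eventually_at_top_linorder)
    qed
  qed (use f in \<open>auto simp: s_def\<close>)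
  then obtain N where "norm ((\<integral>x. norm (f x - s N x) \<partial>M) - (\<integral>x. 0 \<partial>M)) < e"
    using LIMSEQ_D[OF _ e] by blast
  hence "(\<integral>x. norm (f x - s N x) \<partial>M) < e" by simp
  thus ?thesis by (intro that[of "s N" "real N"] si) (auto simp: s_def)
qed

text \<open>Write \<open>f\<close> as a bounded coboundary plus a constant plus an error of small
  mean. The moving averages of the coboundary vanish pointwise because the lengths tend to infinity,
  and the weak type inequality makes the set where the error averages are large as small as
  desired.\<close>

theorem window_avg_converges:
  assumes mean: "\<And>f. integrable M f \<Longrightarrow> mean_ergodic f"
    and st: "stoltz n k" and f: "integrable M f"
  shows "AE x in M. (\<lambda>q. window_avg f (n q) (k q) x) \<longlonglongrightarrow> (\<integral>y. f y \<partial>M)"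
proof -
  define c where "c = (\<integral>y. f y \<partial>M)"
  have [measurable]: "f \<in> borel_measurable M" using f by auto
  obtain q0 C where sb: "stoltz_bound n k q0 C" using stoltz_imp_bound[OF st] by blast
  have kpos: "\<And>q. q \<ge> q0 \<Longrightarrow> k q > 0" and C: "C > 0" using sb by (auto simp: stoltz_bound_def)
  have klim: "filterlim k at_top sequentially" using stoltz_imp_bound[OF st] by blast
  define Bad where "Bad = (\<lambda>d. {x. \<forall>N. \<exists>q\<ge>N. norm (window_avg f (n q) (k q) x - c) > d})"
  have Badm [measurable]: "Bad d \<in> sets M" for d
  proof -
    have "{x \<in> space M. \<forall>N. \<exists>q\<in>{N..}. norm (window_avg f (n q) (k q) x - c) > d} \<in> sets M"
      unfolding window_avg_def by measurable
    thus ?thesis by (simp add: Bad_def space_UNIV Bex_def)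
  qed
  have small: "prob (Bad d) \<le> 4 * C / d * e" if d: "d > 0" and e: "0 < e" "e \<le> d / 4" for d e
  proof -
    obtain g B where g: "integrable M g" "\<And>x. norm (g x) \<le> B" "(\<integral>x. norm (f x - g x) \<partial>M) < e"
      using integrable_bounded_approx[OF f e(1)] by blast
    obtain N where N: "\<And>K. K \<ge> N \<Longrightarrow> norm (avg_error g K - 0) < e"
      using LIMSEQ_D[OF mean[OF g(1), unfolded mean_ergodic_def] e(1)] by blast
    define K where "K = max N 1"
    have K: "K > 0" "avg_error g K < e" using N[of K] by (auto simp: K_def)
    obtain u where u: "\<And>x. norm (u x) \<le> real K * B" "\<And>x. g x - avg g K x = u x - u (T x)"
      using bounded_minus_avg_coboundary[of g B K, OF g(2) K(1)] by metis
    define m where "m = (\<integral>y. g y \<partial>M)"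
    \<comment> \<open>Both parts of the error: cutting \<open>f\<close> down to a bounded function,
      and the distance of the averages of \<open>g\<close> from their mean.\<close>
    define r where "r = (\<lambda>x. norm (f x - g x) + norm (avg g K x - m))"
    have ri: "integrable M r" unfolding r_def
      by (intro Bochner_Integration.integrable_add integrable_norm Bochner_Integration.integrable_diff f g(1) integrable_avg integrable_const)
    have rI: "(\<integral>x. r x \<partial>M) \<le> 2 * e"
    proof -
      have "(\<integral>x. r x \<partial>M) = (\<integral>x. norm (f x - g x) \<partial>M) + avg_error g K"
        unfolding r_def avg_error_def m_def
        by (intro Bochner_Integration.integral_add integrable_norm Bochner_Integration.integrable_diff f g(1) integrable_avg integrable_const)
      thus ?thesis using g(3) K(2) by linarith
    qed
    have mc: "norm (m - c) \<le> e"
    proof -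
      have "m - c = (\<integral>y. g y - f y \<partial>M)" unfolding m_def c_def
        by (rule Bochner_Integration.integral_diff[OF g(1) f, symmetric])
      also have "norm \<dots> \<le> (\<integral>x. norm (g x - f x) \<partial>M)" by (rule integral_norm_bound)
      finally show ?thesis using g(3) by (simp add: norm_minus_commute)
    qed
    define D where "D = {x. \<exists>q\<ge>q0. d / 2 * real (k q) < (\<Sum>j=1..k q. r ((T ^^ (n q + j)) x))}"
    have "d / 2 * prob D \<le> C * (\<integral>x. r x \<partial>M)"
      unfolding D_def by (rule maximal_inequality[OF sb ri]) (use d in \<open>auto simp: r_def\<close>)
    also have "\<dots> \<le> C * (2 * e)" using rI C by simp
    finally have pD: "prob D \<le> 4 * C / d * e" using d by (simp add: field_simps)
    have [measurable]: "r \<in> borel_measurable M" using ri by auto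
    have Dm: "D \<in> sets M"
    proof -
      have "{x \<in> space M. \<exists>q\<in>{q0..}. d / 2 * real (k q) < (\<Sum>j=1..k q. r ((T ^^ (n q + j)) x))} \<in> sets M"
        by measurable
      thus ?thesis by (simp add: D_def space_UNIV Bex_def)
    qed
    have "Bad d \<subseteq> D"
    proof
      fix x assume x: "x \<in> Bad d"
      \<comment> \<open>The budget for \<open>d\<close>: a quarter for the coboundary, whose average
        is at most \<open>2 * K * B / k q\<close>; a quarter for \<open>m - c\<close>; the remaining
        half must come from \<open>r\<close>.\<close>
      have "eventually (\<lambda>q. k q \<ge> nat \<lceil>8 * (real K * B) / d\<rceil>) sequentially"
        using klim unfolding filterlim_at_top by blast
      then obtain q1 where q1: "\<And>q. q \<ge> q1 \<Longrightarrow> k q \<ge> nat \<lceil>8 * (real K * B) / d\<rceil>"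
        by (auto simp: eventually_at_top_linorder)
      from x obtain q where q: "q \<ge> max q0 q1" "norm (window_avg f (n q) (k q) x - c) > d"
        unfolding Bad_def by blast
      have kq: "k q > 0" "real (k q) \<ge> 8 * (real K * B) / d" using kpos q1[of q] q(1) by (auto simp: nat_le_iff ceiling_le_iff)
      define w where "w = (\<lambda>h. window_avg h (n q) (k q) x)"
      have "f = (\<lambda>x. (((f x - g x) + (avg g K x - m)) + (u x - u (T x))) + m)"
        by (simp add: u(2)[symmetric])
      hence "w f = w (\<lambda>x. (((f x - g x) + (avg g K x - m)) + (u x - u (T x))) + m)" by (rule arg_cong)
      also have "\<dots> = w (\<lambda>x. (f x - g x) + (avg g K x - m)) + w (\<lambda>x. u x - u (T x)) + m"
        unfolding w_def using kq(1) by (simp only: window_avg_add window_avg_const)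
      finally have wf: "w f - c = w (\<lambda>x. (f x - g x) + (avg g K x - m)) + w (\<lambda>x. u x - u (T x)) + (m - c)" by simp
      have "norm (w f - c) \<le> norm (w (\<lambda>x. (f x - g x) + (avg g K x - m))) + norm (w (\<lambda>x. u x - u (T x))) + norm (m - c)"
        unfolding wf by (rule order_trans[OF norm_triangle_ineq add_right_mono[OF norm_triangle_ineq]])
      moreover have "norm (w (\<lambda>x. u x - u (T x))) \<le> d / 4"
      proof -
        have "norm (u ((T ^^ (n q + 1)) x) - u ((T ^^ (n q + k q + 1)) x)) \<le> real K * B + real K * B"
          by (rule order_trans[OF norm_triangle_ineq4 add_mono]) (rule u)+
        also have "\<dots> \<le> d / 4 * real (k q)" using kq d by (simp add: field_simps)
        finally show ?thesis using kq(1) unfolding w_def window_avg_coboundary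
          by (simp add: norm_divide field_simps)
      qed
      moreover have "norm (w (\<lambda>x. (f x - g x) + (avg g K x - m))) \<le> (\<Sum>j=1..k q. r ((T ^^ (n q + j)) x)) / real (k q)"
        unfolding w_def window_avg_def norm_mult norm_divide
        by (simp add: divide_right_mono r_def) (intro divide_right_mono sum_norm_le norm_triangle_ineq; simp)
      ultimately have "(\<Sum>j=1..k q. r ((T ^^ (n q + j)) x)) / real (k q) > d / 2"
        using q(2) mc e(2) unfolding w_def by linarith
      thus "x \<in> D" using kq(1) q(1) by (auto simp: D_def field_simps)
    qed
    hence "prob (Bad d) \<le> prob D" using Dm by (intro finite_measure_mono)
    thus ?thesis using pD by linarith
  qed
  have Bad0: "AE x in M. x \<notin> Bad d" if d: "d > 0" for d
  proof -
    have "prob (Bad d) \<le> 0"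
    proof (rule field_le_epsilon)
      fix e :: real assume e: "e > 0"
      \<comment> \<open>The first bound satisfies the condition of \<open>small\<close>, the second
        turns its estimate into \<open>e\<close>.\<close>
      define e' where "e' = min (d / 4) (e * d / (4 * C))"
      have "e' > 0" "e' \<le> d / 4" using d e C by (auto simp: e'_def)
      from small[OF d this] have "prob (Bad d) \<le> 4 * C / d * e'" .
      also have "\<dots> \<le> 4 * C / d * (e * d / (4 * C))" using C d by (intro mult_left_mono) (auto simp: e'_def)
      also have "\<dots> = e" using C d by simp
      finally show "prob (Bad d) \<le> 0 + e" by simp
    qed
    hence "prob (Bad d) = 0" by (simp add: measure_le_0_iff)
    hence "Bad d \<in> null_sets M" by (auto simp: null_sets_def emeasure_eq_measure)
    thus ?thesis by (rule AE_not_in)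
  qed
  have "AE x in M. \<forall>i::nat. x \<notin> Bad (1 / Suc i)" by (subst AE_all_countable) (auto intro!: Bad0)
  thus ?thesis
  proof eventually_elim
    fix x assume x: "\<forall>i::nat. x \<notin> Bad (1 / Suc i)"
    show "(\<lambda>q. window_avg f (n q) (k q) x) \<longlonglongrightarrow> (\<integral>y. f y \<partial>M)"
    proof (rule LIMSEQ_I)
      fix e :: real assume "e > 0"
      then obtain i where i: "1 / Suc i < e" using nat_approx_posE by metis
      from x obtain N where "\<And>q. q \<ge> N \<Longrightarrow> norm (window_avg f (n q) (k q) x - c) \<le> 1 / Suc i"
        unfolding Bad_def by (auto simp: not_less)
      with i show "\<exists>no. \<forall>q\<ge>no. norm (window_avg f (n q) (k q) x - (\<integral>y. f y \<partial>M)) < e"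
        unfolding c_def by (intro exI[of _ N]) (auto intro: le_less_trans)
    qed
  qed
qed

end

section \<open>Averages of zeta derivatives\<close>

text \<open>The singular point \<beta> corresponds to \<open>u = 0\<close>, which both maps fix, so
  the conjugacy is exact and not merely almost everywhere.\<close>

lemma boole_map_affine:
  assumes "\<alpha> > 0" shows "boole_map \<alpha> \<beta> (\<beta> + \<alpha> * u) = \<beta> + \<alpha> * boole u"
  using assms by (simp add: boole_map_def boole_def divide_simps) (simp add: algebra_simps)

lemma boole_map_iterate_affine:
  assumes "\<alpha> > 0" shows "(boole_map \<alpha> \<beta> ^^ j) (\<beta> + \<alpha> * u) = \<beta> + \<alpha> * (boole ^^ j) u"
  by (induction j) (simp_all add: boole_map_affine[OF assms])

interpretation boole: measure_preserving_system cauchy_measure boole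
  by standard (auto simp: distr_boole)

lemma boole_mean_ergodic:
  assumes "integrable cauchy_measure f" shows "boole.mean_ergodic f"
proof (rule boole.mean_ergodic_integrable)
  show "Int_stable (range (lessThan :: real \<Rightarrow> real set))"
  proof (rule Int_stableI)
    fix A B :: "real set" assume "A \<in> range lessThan" "B \<in> range lessThan"
    then obtain a b :: real where "A = {..<a}" "B = {..<b}" by auto
    hence "A \<inter> B = {..<min a b}" by auto
    thus "A \<inter> B \<in> range lessThan" by auto
  qed
  have "(borel :: real measure) = sigma UNIV (range lessThan)"
    by (rule borel_Iio)
  hence "sets (borel :: real measure) = sigma_sets UNIV (range lessThan)"
    by (metis Pow_UNIV sets_measure_of top_greatest)
  thus "sets cauchy_measure = sigma_sets (space cauchy_measure) (range lessThan)" by simp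
  fix S :: "real set" and j assume "S \<in> range lessThan"
  then obtain c where "S = {..<c}" by auto
  thus "\<bar>cauchy.prob (S \<inter> (boole ^^ j) -` S) - cauchy.prob S * cauchy.prob S\<bar> \<le> (1 / 2) ^ j"
    using boole_correlation[of "{..<c}" c j] by simp
qed (use assms in auto)

text \<open>For \<open>Re s = 1\<close> the path of integration runs through the pole, where the
  \<open>k\<close>-th derivative has order \<open>k + 1\<close> and is not integrable; hence the
  hypothesis \<open>Re s \<noteq> 1\<close>. Integrability is asserted along with the limit because
  the integral of a nonintegrable function is \<open>0\<close> by convention, so the value alone
  would say nothing.\<close>

theorem theorem7p6:
  fixes \<alpha> \<beta> a :: real and s :: complex and k :: nat and n\<^sub>q k\<^sub>q :: "nat \<Rightarrow> nat"
  assumes "\<alpha> > 0"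
    and "stoltz n\<^sub>q k\<^sub>q"
    and "Re s > - 1 / 2" and "s \<noteq> 1" and "Re s \<noteq> 1"
    and "0 \<le> a" and "a < 1"
  shows "integrable lborel
           (\<lambda>\<tau>. hurwitz_zeta_deriv k (s + \<i> * of_real \<tau>) a / of_real (\<alpha>\<^sup>2 + (\<tau> - \<beta>)\<^sup>2)) \<and>
         (AE x in lborel.
           (\<lambda>q. 1 / of_nat (k\<^sub>q q) *
                (\<Sum>j=1..k\<^sub>q q.
                   hurwitz_zeta_deriv k (s + \<i> * of_real ((boole_map \<alpha> \<beta> ^^ (n\<^sub>q q + j)) x)) a))
           \<longlonglongrightarrow>
           of_real (\<alpha> / pi) *
             (LINT \<tau>|lborel.
                hurwitz_zeta_deriv k (s + \<i> * of_real \<tau>) a / of_real (\<alpha>\<^sup>2 + (\<tau> - \<beta>)\<^sup>2)))"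
proof -
  define g where "g = (\<lambda>t. hurwitz_zeta_deriv k (Complex (Re s) t) a)"
  define h where "h = (\<lambda>\<tau>. hurwitz_zeta_deriv k (s + \<i> * of_real \<tau>) a)"
  define f where "f = (\<lambda>u. h (\<beta> + \<alpha> * u))"
  define p where "p = Im s + \<beta>"
  have hg: "h \<tau> = g (Im s + \<tau>)" for \<tau>
  proof -
    have "s + \<i> * of_real \<tau> = Complex (Re s) (Im s + \<tau>)" by (simp add: complex_eq_iff)
    thus ?thesis by (simp add: h_def g_def)
  qed
  have fg: "f u = g (p + \<alpha> * u)" for u by (simp add: f_def hg p_def add_ac)
  have gc: "continuous_on UNIV g"
    unfolding g_def using continuous_hurwitz_zeta_deriv_line assms by blast
  have fc: "continuous_on UNIV f" unfolding fg[abs_def]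
    by (rule continuous_on_compose2[OF gc]) (auto intro!: continuous_intros)
  have hc: "continuous_on UNIV h" unfolding hg[abs_def]
    by (rule continuous_on_compose2[OF gc]) (auto intro!: continuous_intros)
  have fm [measurable]: "f \<in> borel_measurable borel" and hm [measurable]: "h \<in> borel_measurable borel"
    using fc hc by (auto intro: borel_measurable_continuous_onI)
  have int_u: "integrable lborel (\<lambda>u. (1 / (1 + u\<^sup>2)) *\<^sub>R f u)"
  proof (rule Bochner_Integration.integrable_bound)
    \<comment> \<open>From \<open>(x + y)^2 \<le> 2 * x^2 + 2 * y^2\<close>: it compares the weight
      of the vertical line estimate with that of the rescaled variable.\<close>
    define C where "C = 1 + 2 * p\<^sup>2 + 2 * \<alpha>\<^sup>2"
    have "integrable lborel (\<lambda>t. g t / of_real (1 + t\<^sup>2))"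
      unfolding g_def using integrable_hurwitz_zeta_deriv_line assms by blast
    hence "integrable lborel (\<lambda>u. g (p + \<alpha> * u) / of_real (1 + (p + \<alpha> * u)\<^sup>2))"
      by (rule lborel_integrable_real_affine) (use assms in auto)
    thus "integrable lborel (\<lambda>u. of_real C * (g (p + \<alpha> * u) / of_real (1 + (p + \<alpha> * u)\<^sup>2)))"
      by (rule integrable_mult_right)
    show "(\<lambda>u. (1 / (1 + u\<^sup>2)) *\<^sub>R f u) \<in> borel_measurable lborel" by measurable
    have "norm ((1 / (1 + u\<^sup>2)) *\<^sub>R f u) \<le> norm (of_real C * (g (p + \<alpha> * u) / of_real (1 + (p + \<alpha> * u)\<^sup>2)))" for u
    proof -
      define t where "t = p + \<alpha> * u"
      have "2 * (p * (\<alpha> * u)) \<le> p\<^sup>2 + (\<alpha> * u)\<^sup>2" using sum_squares_bound[of p "\<alpha> * u"] by simp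
      hence "1 + t\<^sup>2 \<le> 1 + 2 * p\<^sup>2 + 2 * (\<alpha>\<^sup>2 * u\<^sup>2)" by (simp add: t_def power2_sum power_mult_distrib)
      also have "\<dots> \<le> C * (1 + u\<^sup>2)"
      proof -
        have "C * (1 + u\<^sup>2) = 1 + 2 * p\<^sup>2 + 2 * (\<alpha>\<^sup>2 * u\<^sup>2) + (2 * \<alpha>\<^sup>2 + u\<^sup>2 + 2 * (p\<^sup>2 * u\<^sup>2))"
          by (simp add: C_def algebra_simps)
        thus ?thesis by simp
      qed
      finally have le: "1 + t\<^sup>2 \<le> C * (1 + u\<^sup>2)" .
      have pos: "1 + t\<^sup>2 > 0" "1 + u\<^sup>2 > 0" by (rule one_plus_sq_pos)+
      hence "1 / (1 + u\<^sup>2) \<le> C / (1 + t\<^sup>2)" using le by (simp add: divide_simps mult.commute)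
      hence "1 / (1 + u\<^sup>2) * norm (g t) \<le> C / (1 + t\<^sup>2) * norm (g t)" by (rule mult_right_mono) simp
      moreover have "C > 0" by (simp add: C_def add_pos_nonneg)
      moreover have "norm (complex_of_real (1 + t\<^sup>2)) = 1 + t\<^sup>2" using pos by (simp only: norm_of_real)
      ultimately show ?thesis using pos
        unfolding fg t_def[symmetric] norm_mult norm_divide norm_scaleR by simp
    qed
    thus "AE u in lborel. norm ((1 / (1 + u\<^sup>2)) *\<^sub>R f u) \<le> norm (of_real C * (g (p + \<alpha> * u) / of_real (1 + (p + \<alpha> * u)\<^sup>2)))"
      by simp
  qed
  have conv: "h (\<beta> + \<alpha> * u) / of_real (\<alpha>\<^sup>2 + (\<beta> + \<alpha> * u - \<beta>)\<^sup>2) = of_real (1 / \<alpha>\<^sup>2) * ((1 / (1 + u\<^sup>2)) *\<^sub>R f u)" for u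
  proof -
    have "\<alpha>\<^sup>2 + (\<beta> + \<alpha> * u - \<beta>)\<^sup>2 = \<alpha>\<^sup>2 * (1 + u\<^sup>2)" by (simp add: power_mult_distrib algebra_simps)
    thus ?thesis by (simp add: f_def scaleR_conv_of_real)
  qed
  have int: "integrable lborel (\<lambda>\<tau>. h \<tau> / of_real (\<alpha>\<^sup>2 + (\<tau> - \<beta>)\<^sup>2))"
  proof -
    have "integrable lborel (\<lambda>u. h (\<beta> + \<alpha> * u) / of_real (\<alpha>\<^sup>2 + (\<beta> + \<alpha> * u - \<beta>)\<^sup>2))"
      unfolding conv by (rule integrable_mult_right[OF int_u])
    thus ?thesis using assms by (subst (asm) lborel_integrable_real_affine_iff) auto
  qed
  have dens: "(1 / (pi * (1 + u\<^sup>2))) *\<^sub>R f u = of_real (1 / pi) * ((1 / (1 + u\<^sup>2)) *\<^sub>R f u)" for u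
    by (simp add: scaleR_conv_of_real)
  have dnn: "1 / (pi * (1 + u\<^sup>2)) \<ge> 0" for u :: real
    using one_plus_sq_pos[of u] by (intro divide_nonneg_nonneg mult_nonneg_nonneg) auto
  have fint: "integrable cauchy_measure f"
  proof -
    have i: "integrable lborel (\<lambda>u. (1 / (pi * (1 + u\<^sup>2))) *\<^sub>R f u)"
      unfolding dens by (rule integrable_mult_right[OF int_u])
    show ?thesis unfolding cauchy_measure_def
      by (rule iffD2[OF integrable_density i]) (auto simp: dnn)
  qed
  have flim: "(\<integral>u. f u \<partial>cauchy_measure) = of_real (\<alpha> / pi) * (LINT \<tau>|lborel. h \<tau> / of_real (\<alpha>\<^sup>2 + (\<tau> - \<beta>)\<^sup>2))"
  proof -
    have "(LINT \<tau>|lborel. h \<tau> / of_real (\<alpha>\<^sup>2 + (\<tau> - \<beta>)\<^sup>2)) =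
       \<bar>\<alpha>\<bar> *\<^sub>R (LINT u|lborel. h (\<beta> + \<alpha> * u) / of_real (\<alpha>\<^sup>2 + (\<beta> + \<alpha> * u - \<beta>)\<^sup>2))"
      by (rule lborel_integral_real_affine) (use assms in auto)
    also have "\<dots> = \<alpha> *\<^sub>R (of_real (1 / \<alpha>\<^sup>2) * (LINT u|lborel. (1 / (1 + u\<^sup>2)) *\<^sub>R f u))"
      unfolding conv using assms by (simp only: integral_mult_right_zero) simp
    finally have 1: "(LINT \<tau>|lborel. h \<tau> / of_real (\<alpha>\<^sup>2 + (\<tau> - \<beta>)\<^sup>2)) =
       of_real (1 / \<alpha>) * (LINT u|lborel. (1 / (1 + u\<^sup>2)) *\<^sub>R f u)"
      using assms by (simp add: scaleR_conv_of_real power2_eq_square)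
    have "(\<integral>u. f u \<partial>cauchy_measure) = (LINT u|lborel. (1 / (pi * (1 + u\<^sup>2))) *\<^sub>R f u)"
      unfolding cauchy_measure_def by (rule integral_density) (auto simp: dnn)
    also have "\<dots> = of_real (1 / pi) * (LINT u|lborel. (1 / (1 + u\<^sup>2)) *\<^sub>R f u)"
      unfolding dens by (rule integral_mult_right_zero)
    finally show ?thesis unfolding 1 using assms by simp
  qed
  define P where "P = (\<lambda>x. (\<lambda>q. 1 / of_nat (k\<^sub>q q) * (\<Sum>j=1..k\<^sub>q q. h ((boole_map \<alpha> \<beta> ^^ (n\<^sub>q q + j)) x))) \<longlonglongrightarrow> (\<integral>u. f u \<partial>cauchy_measure))"
  have Pu: "P (\<beta> + \<alpha> * u) \<longleftrightarrow> (\<lambda>q. boole.window_avg f (n\<^sub>q q) (k\<^sub>q q) u) \<longlonglongrightarrow> (\<integral>u. f u \<partial>cauchy_measure)" for u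
    unfolding P_def boole.window_avg_def boole_map_iterate_affine[OF assms(1)] f_def ..
  have "AE u in cauchy_measure. P (\<beta> + \<alpha> * u)"
    unfolding Pu by (rule boole.window_avg_converges[OF boole_mean_ergodic assms(2) fint])
  \<comment> \<open>The Cauchy density is positive everywhere, so a Cauchy null set is a Lebesgue
    null set.\<close>
  hence AEu: "AE u in lborel. P (\<beta> + \<alpha> * u)"
  proof -
    assume "AE u in cauchy_measure. P (\<beta> + \<alpha> * u)"
    hence "AE u in lborel. 0 < ennreal (1 / (pi * (1 + u\<^sup>2))) \<longrightarrow> P (\<beta> + \<alpha> * u)"
      unfolding cauchy_measure_def by (subst (asm) AE_density) auto
    thus ?thesis using one_plus_sq_pos by (auto elim!: eventually_mono simp: zero_less_divide_iff zero_less_mult_iff)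
  qed
  have [measurable]: "(boole_map \<alpha> \<beta> ^^ j) \<in> borel_measurable borel" for j
  proof (induction j)
    case (Suc j)
    have "boole_map \<alpha> \<beta> \<in> borel_measurable borel" unfolding boole_map_def[abs_def] by measurable
    from measurable_comp[OF Suc this] show ?case by (simp add: comp_def)
  qed (simp add: id_def)
  \<comment> \<open>Measurability of the convergence set is what allows the almost everywhere
    statement to be carried through the affine change of variable.\<close>
  have Pm: "Measurable.pred borel P"
    unfolding P_def by measurable
  have "Measurable.pred borel (\<lambda>u. P (\<beta> + \<alpha> * u))" using Pm by measurable
  hence "AE x in lborel. P (\<beta> + \<alpha> * (- \<beta> / \<alpha> + 1 / \<alpha> * x))"
    using AE_borel_affine[of "1 / \<alpha>" "\<lambda>u. P (\<beta> + \<alpha> * u)" "- \<beta> / \<alpha>"] AEu assms(1) by simp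
  moreover have "\<beta> + \<alpha> * (- \<beta> / \<alpha> + 1 / \<alpha> * x) = x" for x using assms(1) by (simp add: field_simps)
  ultimately have "AE x in lborel. P x" by simp
  thus ?thesis using int unfolding P_def flim h_def by blast
qed

end
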